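(* Let $\alpha_1,\alpha_2\in(\tfrac12,1)$ with $\alpha_1+\alpha_2-1=\alpha$, and consider a sequence of problems indexed by $n\to\infty$. Suppose $\frac{\lambda}{n}\in\big[6\sigma_0^2\frac{(|\tau_0|+1)\log(p/2)}{n}+t,\ 0.05\,C_{\min}\big]$ for a positive constant $t>0$, and that $\frac{|\tau_0|\log(p)}{n}<0.23$ and $C_{\min}>120\frac{(|\tau_0|+2)\log(p+1)}{n}\sigma_0^2$ when $n$ is large enough. Then for any finite $d$, the joint confidence set $\Gamma_\alpha^{\eta_\tau}$ satisfies $$\mathbb P_{(\mathcal U^d,Y)}\{(\tau_0,\beta_0)\in\Gamma_\alpha^{\eta_\tau}(Y)\}\ge\alpha-o(e^{-c_2n})\quad(n\to\infty)$$ for some $c_2>0$. Further, $\mathbb P_{Y|\mathcal U^d}\{(\tau_0,\beta_0)\in\Gamma_\alpha^{\eta_\tau}(Y)\}\ge\alpha-o_p(e^{-c_2n})$.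
   Context: Setting. $n,p$ are positive integers and $X\in\mathbb R^{n\times p}$ is a fixed matrix. For $\tau\subset[p]=\{1,\dots,p\}$ (a "model"), $X_\tau$ is the submatrix of the columns of $X$ indexed by $\tau$, $|\tau|$ is the cardinality, and $H_\tau$ is the orthogonal projection matrix onto the column span of $X_\tau$. The data are $Y=X_{\tau_0}\beta_0+\sigma_0U$, where $\tau_0\subset[p]$ (nonempty), $\beta_0\in\mathbb R^{|\tau_0|}$, $\sigma_0>0$ are fixed and $U\sim N(0,I_n)$. In the sequence of problems, $p,X,\tau_0,\beta_0,\lambda$ may depend on $n$, while $d,t,\sigma_0,\alpha_1,\alpha_2$ are fixed. Identifiability: $\tau_0$ is the unique model of smallest cardinality in $\{\tau\subset[p]: X_\tau\beta_\tau=X_{\tau_0}\beta_0\text{ for some }\beta_\tau\}$. Define $$C_{\min}=\min_{\tau\ne\tau_0,\ |\tau|\le|\tau_0|}\ \min_{\beta_\tau\in\mathbb R^{|\tau|}}\ \frac{\|X_{\tau_0}\beta_0-X_\tau\beta_\tau\|_2^2}{n\max(|\tau_0\setminus\tau|,1)}>0.$$ Candidate set. $\mathcal U^d=(U_1^*,\dots,U_d^* )$ are i.i.d. $N(0,I_n)$, independent of $U$. For $\lambda>0$, $\hat\tau_b=\arg\min_{\tau}\min_{\beta_\tau\in\mathbb R^{|\tau|},\sigma\in\mathbb R}\{\|Y-X_\tau\beta_\tau-\sigma U_b^*\|_2^2+\lambda|\tau|\}$ (fixed tie-breaking rule) and $S^{(d)}=\{\hat\tau_b:b=1,\dots,d\}$.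 Model confidence set. For $y\in\mathbb R^n$ and a model $\tau$ let $\tilde T_0(y,\tau)=\arg\min_{\tilde\tau\subset[p],|\tilde\tau|\le|\tau|}\min_{\beta_{\tilde\tau}}\|y-X_{\tilde\tau}\beta_{\tilde\tau}\|^2$ (fixed tie-breaking rule) and $\widetilde W(y,\tau)=(H_\tau y,\|(I-H_\tau)y\|)$. For $w=(a,b)$ let $p_{(w,\tau)}(\tau')=\mathbb P_V\{\tilde T_0(a+b\,(I-H_\tau)V/\|(I-H_\tau)V\|,\tau)=\tau'\}$ with $V\sim N(0,I_n)$, and for a level $\alpha_1$ let $$B_{\alpha_1}(\tau,w)=\Big\{\tau^*\subset[p]:\sum_{\tau':\,p_{(w,\tau)}(\tau')\le p_{(w,\tau)}(\tau^* )}p_{(w,\tau)}(\tau')\ge1-\alpha_1\Big\},\quad \bar\Gamma^\tau_{\alpha_1}(y)=\{\tau\in S^{(d)}:\tilde T_0(y,\tau)\in B_{\alpha_1}(\tau,\widetilde W(y,\tau))\}.$$ Joint confidence set. For $\eta_\tau=(\tau,\beta_\tau)$ let $$\tilde T(y,\eta_\tau)=\frac{(y-X_\tau\beta_\tau)^\top H_\tau(y-X_\tau\beta_\tau)/|\tau|}{(y-X_\tau\beta_\tau)^\top(I-H_\tau)(y-X_\tau\beta_\tau)/(n-|\tau|)}$$ and $B_{\alpha_2}(\eta_\tau)=[0,F^{-1}_{|\tau|,n-|\tau|}(\alpha_2)]$ with $F^{-1}_{k,m}$ the quantile function of the $F$ distribution with $(k,m)$ degrees of freedom (any fixed convention when $|\tau|=0$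 or $|\tau|\ge n$). Then $$\Gamma_\alpha^{\eta_\tau}(y)=\bigcup_{\tau\in\bar\Gamma^\tau_{\alpha_1}(y)}\{\eta_\tau=(\tau,\beta_\tau):\tilde T(y,\eta_\tau)\in B_{\alpha_2}(\eta_\tau)\}.$$ $\mathbb P_{(\mathcal U^d,Y)}$ is the joint probability over $U$ and $\mathcal U^d$; $\mathbb P_{Y|\mathcal U^d}$ is the conditional probability given $\mathcal U^d$, and $o_p$ is with respect to $\mathcal U^d$ as $n\to\infty$. *)

theory Defs
  imports "HOL-Probability.Probability" "HOL-Library.Landau_Symbols"
begin

text \<open>
  Dimensions vary with the sample size, so vectors of dimension \<open>n\<close> are functions on the index set
  \<open>{1..n}\<close> that are \<^const>\<open>undefined\<close> elsewhere (the points of a product measure over \<open>{1..n}\<close>),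
  an \<open>n \<times> p\<close> matrix is a function \<open>X\<close> used at \<open>X i j\<close> with \<open>i \<in> {1..n}\<close>, \<open>j \<in> {1..p}\<close>, a model
  is a set \<open>\<tau> \<subseteq> {1..p}\<close>, and a coefficient vector for \<open>\<tau>\<close> is indexed by the elements of \<open>\<tau>\<close>.
\<close>

definition std_gauss :: "nat \<Rightarrow> (nat \<Rightarrow> real) measure" where
  "std_gauss n = Pi\<^sub>M {1..n} (\<lambda>_. density lborel (\<lambda>x. ennreal (std_normal_density x)))"

definition coeffs_of :: "nat set \<Rightarrow> (nat \<Rightarrow> real) set" where
  "coeffs_of \<tau> = \<tau> \<rightarrow>\<^sub>E UNIV"

definition fit :: "nat \<Rightarrow> (nat \<Rightarrow> nat \<Rightarrow> real) \<Rightarrow> nat set \<Rightarrow> (nat \<Rightarrow> real) \<Rightarrow> nat \<Rightarrow> real" where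
  "fit n X \<tau> \<beta> = (\<lambda>i\<in>{1..n}. \<Sum>j\<in>\<tau>. X i j * \<beta> j)"

definition col_span :: "nat \<Rightarrow> (nat \<Rightarrow> nat \<Rightarrow> real) \<Rightarrow> nat set \<Rightarrow> (nat \<Rightarrow> real) set" where
  "col_span n X \<tau> = fit n X \<tau> ` coeffs_of \<tau>"

text \<open>The orthogonal projection onto the column span, as an operator \<open>y \<mapsto> H\<^sub>\<tau> y\<close>.\<close>

definition proj :: "nat \<Rightarrow> (nat \<Rightarrow> nat \<Rightarrow> real) \<Rightarrow> nat set \<Rightarrow> (nat \<Rightarrow> real) \<Rightarrow> nat \<Rightarrow> real" where
  "proj n X \<tau> y =
     (THE v. v \<in> col_span n X \<tau> \<and> (\<forall>w\<in>col_span n X \<tau>. (\<Sum>i=1..n. (y i - v i) * w i) = 0))"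

definition resid :: "nat \<Rightarrow> (nat \<Rightarrow> nat \<Rightarrow> real) \<Rightarrow> nat set \<Rightarrow> (nat \<Rightarrow> real) \<Rightarrow> nat \<Rightarrow> real" where
  "resid n X \<tau> y = (\<lambda>i\<in>{1..n}. y i - proj n X \<tau> y i)"

definition observation ::
  "nat \<Rightarrow> (nat \<Rightarrow> nat \<Rightarrow> real) \<Rightarrow> nat set \<Rightarrow> (nat \<Rightarrow> real) \<Rightarrow> real \<Rightarrow> (nat \<Rightarrow> real) \<Rightarrow> nat \<Rightarrow> real" where
  "observation n X \<tau>0 \<beta>0 \<sigma>0 u = (\<lambda>i\<in>{1..n}. fit n X \<tau>0 \<beta>0 i + \<sigma>0 * u i)"

definition identifiable ::
  "nat \<Rightarrow> nat \<Rightarrow> (nat \<Rightarrow> nat \<Rightarrow> real) \<Rightarrow> nat set \<Rightarrow> (nat \<Rightarrow> real) \<Rightarrow> bool" where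
  "identifiable n p X \<tau>0 \<beta>0 \<longleftrightarrow>
     {\<tau>. is_arg_min card
          (\<lambda>\<tau>. \<tau> \<subseteq> {1..p} \<and> (\<exists>\<beta>\<in>coeffs_of \<tau>. fit n X \<tau> \<beta> = fit n X \<tau>0 \<beta>0)) \<tau>} = {\<tau>0}"

text \<open>Here and below, minima over coefficients are written as infima; each of them is attained,
  since a column span is a closed set.\<close>

definition C_min ::
  "nat \<Rightarrow> nat \<Rightarrow> (nat \<Rightarrow> nat \<Rightarrow> real) \<Rightarrow> nat set \<Rightarrow> (nat \<Rightarrow> real) \<Rightarrow> real" where
  "C_min n p X \<tau>0 \<beta>0 =
     Min ((\<lambda>\<tau>. INF \<beta>\<in>coeffs_of \<tau>.
                 (L2_set (\<lambda>i. fit n X \<tau>0 \<beta>0 i - fit n X \<tau> \<beta> i) {1..n})\<^sup>2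
                   / (real n * real (max (card (\<tau>0 - \<tau>)) 1)))
          ` {\<tau>. \<tau> \<subseteq> {1..p} \<and> \<tau> \<noteq> \<tau>0 \<and> card \<tau> \<le> card \<tau>0})"

text \<open>A tie-breaking rule selects one element from every nonempty set of tied minimizers.\<close>

definition tie_rule :: "(nat set set \<Rightarrow> nat set) \<Rightarrow> bool" where
  "tie_rule tie \<longleftrightarrow> (\<forall>A. A \<noteq> {} \<longrightarrow> tie A \<in> A)"

definition tau_hat ::
  "nat \<Rightarrow> nat \<Rightarrow> (nat \<Rightarrow> nat \<Rightarrow> real) \<Rightarrow> real \<Rightarrow> (nat set set \<Rightarrow> nat set)
    \<Rightarrow> (nat \<Rightarrow> real) \<Rightarrow> (nat \<Rightarrow> real) \<Rightarrow> nat set" where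
  "tau_hat n p X lam tie ub y =
     tie {\<tau>. is_arg_min
               (\<lambda>\<tau>. INF (\<beta>, \<sigma>)\<in>coeffs_of \<tau> \<times> (UNIV :: real set).
                  (L2_set (\<lambda>i. y i - fit n X \<tau> \<beta> i - \<sigma> * ub i) {1..n})\<^sup>2 + lam * real (card \<tau>))
               (\<lambda>\<tau>. \<tau> \<subseteq> {1..p}) \<tau>}"

definition candidates ::
  "nat \<Rightarrow> nat \<Rightarrow> (nat \<Rightarrow> nat \<Rightarrow> real) \<Rightarrow> real \<Rightarrow> (nat set set \<Rightarrow> nat set)
    \<Rightarrow> nat \<Rightarrow> (nat \<Rightarrow> nat \<Rightarrow> real) \<Rightarrow> (nat \<Rightarrow> real) \<Rightarrow> nat set set" where
  "candidates n p X lam tie d us y = (\<lambda>b. tau_hat n p X lam tie (us b) y) ` {1..d}"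

definition T0_stat ::
  "nat \<Rightarrow> nat \<Rightarrow> (nat \<Rightarrow> nat \<Rightarrow> real) \<Rightarrow> (nat set set \<Rightarrow> nat set)
    \<Rightarrow> (nat \<Rightarrow> real) \<Rightarrow> nat set \<Rightarrow> nat set" where
  "T0_stat n p X tie y \<tau> =
     tie {\<tau>'. is_arg_min
                (\<lambda>\<tau>'. INF \<beta>\<in>coeffs_of \<tau>'. (L2_set (\<lambda>i. y i - fit n X \<tau>' \<beta> i) {1..n})\<^sup>2)
                (\<lambda>\<tau>'. \<tau>' \<subseteq> {1..p} \<and> card \<tau>' \<le> card \<tau>) \<tau>'}"

definition W_stat ::
  "nat \<Rightarrow> (nat \<Rightarrow> nat \<Rightarrow> real) \<Rightarrow> (nat \<Rightarrow> real) \<Rightarrow> nat set \<Rightarrow> (nat \<Rightarrow> real) \<times> real" where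
  "W_stat n X y \<tau> = (proj n X \<tau> y, L2_set (resid n X \<tau> y) {1..n})"

definition T0_prob ::
  "nat \<Rightarrow> nat \<Rightarrow> (nat \<Rightarrow> nat \<Rightarrow> real) \<Rightarrow> (nat set set \<Rightarrow> nat set)
    \<Rightarrow> (nat \<Rightarrow> real) \<times> real \<Rightarrow> nat set \<Rightarrow> nat set \<Rightarrow> real" where
  "T0_prob n p X tie w \<tau> \<tau>' =
     measure (std_gauss n)
       {v \<in> space (std_gauss n).
          T0_stat n p X tie
            (\<lambda>i\<in>{1..n}. fst w i + snd w * (resid n X \<tau> v i / L2_set (resid n X \<tau> v) {1..n})) \<tau> = \<tau>'}"

definition B_model ::
  "nat \<Rightarrow> nat \<Rightarrow> (nat \<Rightarrow> nat \<Rightarrow> real) \<Rightarrow> (nat set set \<Rightarrow> nat set)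
    \<Rightarrow> real \<Rightarrow> nat set \<Rightarrow> (nat \<Rightarrow> real) \<times> real \<Rightarrow> nat set set" where
  "B_model n p X tie \<alpha>1 \<tau> w =
     {\<tau>s. \<tau>s \<subseteq> {1..p} \<and>
        (\<Sum>\<tau>' | \<tau>' \<subseteq> {1..p} \<and> T0_prob n p X tie w \<tau> \<tau>' \<le> T0_prob n p X tie w \<tau> \<tau>s.
           T0_prob n p X tie w \<tau> \<tau>') \<ge> 1 - \<alpha>1}"

definition model_conf_set ::
  "nat \<Rightarrow> nat \<Rightarrow> (nat \<Rightarrow> nat \<Rightarrow> real) \<Rightarrow> real \<Rightarrow> (nat set set \<Rightarrow> nat set) \<Rightarrow> (nat set set \<Rightarrow> nat set)
    \<Rightarrow> nat \<Rightarrow> real \<Rightarrow> (nat \<Rightarrow> nat \<Rightarrow> real) \<Rightarrow> (nat \<Rightarrow> real) \<Rightarrow> nat set set" where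
  "model_conf_set n p X lam tieS tieT d \<alpha>1 us y =
     {\<tau> \<in> candidates n p X lam tieS d us y.
        T0_stat n p X tieT y \<tau> \<in> B_model n p X tieT \<alpha>1 \<tau> (W_stat n X y \<tau>)}"

text \<open>The \<open>F\<close> distribution is the law of \<open>(\<chi>\<^sup>2\<^sub>k / k) / (\<chi>\<^sup>2\<^sub>m / m)\<close> with independent numerator and
  denominator, realised by the first \<open>k\<close> and the last \<open>m\<close> of \<open>k + m\<close> independent standard normal
  variables. For \<open>k = 0\<close> or \<open>m = 0\<close> division by zero makes it the point mass at \<open>0\<close>.\<close>

definition F_dist :: "nat \<Rightarrow> nat \<Rightarrow> real measure" where
  "F_dist k m =
     distr (std_gauss (k + m)) borel
       (\<lambda>z. ((\<Sum>i=1..k. (z i)\<^sup>2) / real k) / ((\<Sum>i=k+1..k+m. (z i)\<^sup>2) / real m))"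

definition quantile :: "real measure \<Rightarrow> real \<Rightarrow> real" where
  "quantile M q = Inf {x. q \<le> cdf M x}"

definition F_stat ::
  "nat \<Rightarrow> (nat \<Rightarrow> nat \<Rightarrow> real) \<Rightarrow> (nat \<Rightarrow> real) \<Rightarrow> nat set \<times> (nat \<Rightarrow> real) \<Rightarrow> real" where
  "F_stat n X y \<eta> =
     (let \<tau> = fst \<eta>; r = (\<lambda>i\<in>{1..n}. y i - fit n X \<tau> (snd \<eta>) i) in
      ((\<Sum>i=1..n. r i * proj n X \<tau> r i) / real (card \<tau>))
        / ((\<Sum>i=1..n. r i * resid n X \<tau> r i) / real (n - card \<tau>)))"

definition B_joint :: "nat \<Rightarrow> real \<Rightarrow> nat set \<times> (nat \<Rightarrow> real) \<Rightarrow> real set" where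
  "B_joint n \<alpha>2 \<eta> = {0 .. quantile (F_dist (card (fst \<eta>)) (n - card (fst \<eta>))) \<alpha>2}"

definition joint_conf_set ::
  "nat \<Rightarrow> nat \<Rightarrow> (nat \<Rightarrow> nat \<Rightarrow> real) \<Rightarrow> real \<Rightarrow> (nat set set \<Rightarrow> nat set) \<Rightarrow> (nat set set \<Rightarrow> nat set)
    \<Rightarrow> nat \<Rightarrow> real \<Rightarrow> real \<Rightarrow> (nat \<Rightarrow> nat \<Rightarrow> real) \<Rightarrow> (nat \<Rightarrow> real)
    \<Rightarrow> (nat set \<times> (nat \<Rightarrow> real)) set" where
  "joint_conf_set n p X lam tieS tieT d \<alpha>1 \<alpha>2 us y =
     (\<Union>\<tau>\<in>model_conf_set n p X lam tieS tieT d \<alpha>1 us y.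
        {(\<tau>, \<beta>) | \<beta>. \<beta> \<in> coeffs_of \<tau> \<and> F_stat n X y (\<tau>, \<beta>) \<in> B_joint n \<alpha>2 (\<tau>, \<beta>)})"

text \<open>Law of \<open>\<U>\<^sup>d = (U\<^sub>1\<^sup>*, \<dots>, U\<^sub>d\<^sup>*)\<close>, and joint law of \<open>(U, \<U>\<^sup>d)\<close>.\<close>

definition Ud_law :: "nat \<Rightarrow> nat \<Rightarrow> (nat \<Rightarrow> nat \<Rightarrow> real) measure" where
  "Ud_law n d = Pi\<^sub>M {1..d} (\<lambda>_. std_gauss n)"

definition joint_law :: "nat \<Rightarrow> nat \<Rightarrow> ((nat \<Rightarrow> real) \<times> (nat \<Rightarrow> nat \<Rightarrow> real)) measure" where
  "joint_law n d = std_gauss n \<Otimes>\<^sub>M Ud_law n d"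

text \<open>The sub-sigma-algebra generated by \<open>\<U>\<^sup>d\<close>.\<close>

definition Ud_algebra :: "nat \<Rightarrow> nat \<Rightarrow> ((nat \<Rightarrow> real) \<times> (nat \<Rightarrow> nat \<Rightarrow> real)) measure" where
  "Ud_algebra n d = vimage_algebra (space (joint_law n d)) snd (Ud_law n d)"

definition little_op ::
  "(nat \<Rightarrow> 'a measure) \<Rightarrow> (nat \<Rightarrow> 'a \<Rightarrow> real) \<Rightarrow> (nat \<Rightarrow> real) \<Rightarrow> bool" where
  "little_op M R a \<longleftrightarrow>
     (\<forall>n. R n \<in> borel_measurable (M n)) \<and>
     (\<forall>\<epsilon>>0. (\<lambda>n. measure (M n) {x \<in> space (M n). \<bar>R n x\<bar> > \<epsilon> * \<bar>a n\<bar>}) \<longlonglongrightarrow> 0)"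

end

theory Submission
  imports Defs
begin

text \<open>
  Write \<open>y = \<mu> + \<sigma> u\<close>. A rank-revealing QR decomposition by Givens rotations, which preserve the Gaussian
  law, turns each residual sum of squares into a sum of squared coordinates of a Gaussian vector, so
  that comparisons of nested models become exponential moment bounds.

  Only one candidate is needed. The artificial noise \<open>u\<^sub>1\<^sup>*\<close> acts as an extra regressor; outside an
  exponentially unlikely event it leaves at least a fifth of the signal missed by any model of size at
  most \<open>|\<tau>\<^sub>0|\<close>. Given this, larger models lose through the penalty and other models through the
  signal, each up to an exponentially small probability, and the union bound over models is a
  binomial sum of the form \<open>(1 + q)\<^sup>p \<le> exp (p q)\<close>.

  Given that \<open>\<tau>\<^sub>0\<close> is a candidate, the two tests have exact levels: the \<open>F\<close> statistic has the \<open>F\<close>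
  distribution, and the direction of the residual is independent of the projection and of the residual
  norm, so the conditional law of the model statistic is the one used by the model test. The
  conditional probability given \<open>\<U>\<^sup>d\<close> is a section probability, which gives both claims.
\<close>

section \<open>Gaussian measure and plane rotations\<close>

text \<open>Columns may be linearly dependent and the artificial noise may fall into a column span,
  so distances are computed without assuming full rank: \<open>qr\<close> carries its own rank,
  bounded by the number of columns. The F test alone needs the exact rank of \<open>\<tau>0\<close>,
  and minimality of \<open>\<tau>0\<close> provides it. As \<open>U\<close> and the artificial noise
  are independent, the latter is held fixed while the former is integrated, with bounds uniform over
  all harmless values of the fixed noise. To keep compared spaces nested, a larger model is replaced
  by its union with \<open>\<tau>0\<close>, and any other model is compared with its intersection
  with \<open>\<tau>0\<close>. The constants meet in the second case. If M bounds the missed signal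
  from below, the fifth that survives enters the exponent with factor 1/8, the penalty costs at most
  0.05 M / 4, and M / 80 remains. Half of this pays for the number of models through the lower bound
  on \<open>C_min\<close>; the other half gives the rate t / 16, because the range of
  \<open>lam\<close> eventually forces 10 t \<le> \<open>C_min\<close>.\<close>

declare One_nat_def [simp del]

abbreviation gauss :: "real measure" where
  "gauss \<equiv> density lborel (\<lambda>x. ennreal (std_normal_density x))"

lemma prob_space_gauss: "prob_space gauss"
  using prob_space_normal_density[of 1 0] by simp

interpretation gauss: prob_space gauss
  by (rule prob_space_gauss)

interpretation gaussP: product_sigma_finite "\<lambda>_::nat. gauss"
  by unfold_locales

lemma prob_space_std_gauss: "prob_space (std_gauss n)"
  unfolding std_gauss_def by (rule prob_space_PiM) (rule prob_space_gauss)

lemma sets_std_gauss [measurable_cong]: "sets (std_gauss n) = sets (Pi\<^sub>M {1..n} (\<lambda>_. borel))"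
  unfolding std_gauss_def by (intro sets_PiM_cong) auto

lemma space_std_gauss: "space (std_gauss n) = {1..n} \<rightarrow>\<^sub>E UNIV"
  by (simp add: std_gauss_def space_PiM)

lemma nn_integral_gauss:
  "f \<in> borel_measurable borel \<Longrightarrow>
    (\<integral>\<^sup>+x. f x \<partial>gauss) = (\<integral>\<^sup>+x. ennreal (std_normal_density x) * f x \<partial>lborel)"
  by (subst nn_integral_density) auto

text \<open>With \<open>y\<close> fixed the shear is a translation in \<open>x\<close>, so the order
  of integration is swapped first.\<close>

lemma nn_integral_shear_fst:
  fixes f :: "real \<times> real \<Rightarrow> ennreal"
  assumes [measurable]: "f \<in> borel_measurable (borel \<Otimes>\<^sub>M borel)"
  shows "(\<integral>\<^sup>+x. \<integral>\<^sup>+y. f (x + a * y, y) \<partial>lborel \<partial>lborel) = (\<integral>\<^sup>+x. \<integral>\<^sup>+y. f (x, y) \<partial>lborel \<partial>lborel)"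
proof -
  have "(\<integral>\<^sup>+x. \<integral>\<^sup>+y. f (x + a * y, y) \<partial>lborel \<partial>lborel) = (\<integral>\<^sup>+y. \<integral>\<^sup>+x. f (x + a * y, y) \<partial>lborel \<partial>lborel)"
    by (rule lborel_pair.Fubini'[symmetric]) measurable
  also have "\<dots> = (\<integral>\<^sup>+y. \<integral>\<^sup>+x. f (x, y) \<partial>lborel \<partial>lborel)"
  proof (rule nn_integral_cong)
    fix y :: real
    show "(\<integral>\<^sup>+x. f (x + a * y, y) \<partial>lborel) = (\<integral>\<^sup>+x. f (x, y) \<partial>lborel)"
      using nn_integral_real_affine[of "\<lambda>x. f (x, y)" 1 "a * y"] by (simp add: add.commute)
  qed
  also have "\<dots> = (\<integral>\<^sup>+x. \<integral>\<^sup>+y. f (x, y) \<partial>lborel \<partial>lborel)"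
    by (rule lborel_pair.Fubini') measurable
  finally show ?thesis .
qed

lemma nn_integral_shear_snd:
  fixes f :: "real \<times> real \<Rightarrow> ennreal"
  assumes [measurable]: "f \<in> borel_measurable (borel \<Otimes>\<^sub>M borel)"
  shows "(\<integral>\<^sup>+x. \<integral>\<^sup>+y. f (x, y + a * x) \<partial>lborel \<partial>lborel) = (\<integral>\<^sup>+x. \<integral>\<^sup>+y. f (x, y) \<partial>lborel \<partial>lborel)"
proof (rule nn_integral_cong)
  fix x :: real
  show "(\<integral>\<^sup>+y. f (x, y + a * x) \<partial>lborel) = (\<integral>\<^sup>+y. f (x, y) \<partial>lborel)"
    using nn_integral_real_affine[of "\<lambda>y. f (x, y)" 1 "a * x"] by (simp add: add.commute)
qed

text \<open>A plane rotation with \<open>s \<noteq> 0\<close> is a product of three shears.\<close>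

lemma nn_integral_lborel_rotate:
  fixes f :: "real \<times> real \<Rightarrow> ennreal" and c s :: real
  assumes f [measurable]: "f \<in> borel_measurable (borel \<Otimes>\<^sub>M borel)" and cs: "c\<^sup>2 + s\<^sup>2 = 1" "s \<noteq> 0"
  shows "(\<integral>\<^sup>+x. \<integral>\<^sup>+y. f (c * x - s * y, s * x + c * y) \<partial>lborel \<partial>lborel)
       = (\<integral>\<^sup>+x. \<integral>\<^sup>+y. f (x, y) \<partial>lborel \<partial>lborel)"
proof -
  \<comment> \<open>For a rotation by \<theta> the two outer shears have parameter - tan (\<theta> /
    2), which is (c - 1) / s; the middle one has parameter \<open>s\<close>.\<close>
  define a where "a = (c - 1) / s"
  have as: "a * s = c - 1" using cs by (simp add: a_def)
  have aa: "a * (1 + c) = - s"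
  proof -
    have "(c - 1) * (1 + c) = - s * s" using cs(1) by (simp add: algebra_simps power2_eq_square)
    then show ?thesis using cs(2) by (simp add: a_def divide_simps)
  qed
  define h where "h = (\<lambda>(x, y). f (x + a * y, y))"
  define g where "g = (\<lambda>(x, y). h (x, y + s * x))"
  have [measurable]: "h \<in> borel_measurable (borel \<Otimes>\<^sub>M borel)" unfolding h_def by measurable
  have [measurable]: "g \<in> borel_measurable (borel \<Otimes>\<^sub>M borel)" unfolding g_def by measurable
  have "g (x + a * y, y) = f (c * x - s * y, s * x + c * y)" for x y
  proof -
    have *: "y + s * (x + a * y) = s * x + c * y"
    proof -
      have "y + s * (x + a * y) = s * x + (1 + a * s) * y" by (simp add: algebra_simps)
      then show ?thesis by (simp add: as)
    qed
    have "x + a * y + a * (s * x + c * y) = x * (1 + a * s) + y * (a * (1 + c))"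
      by (simp add: algebra_simps)
    also have "\<dots> = c * x - s * y" unfolding as aa by (simp add: algebra_simps)
    finally show ?thesis unfolding g_def h_def by (simp add: *)
  qed
  then have "(\<integral>\<^sup>+x. \<integral>\<^sup>+y. f (c * x - s * y, s * x + c * y) \<partial>lborel \<partial>lborel)
     = (\<integral>\<^sup>+x. \<integral>\<^sup>+y. g (x + a * y, y) \<partial>lborel \<partial>lborel)" by simp
  also have "\<dots> = (\<integral>\<^sup>+x. \<integral>\<^sup>+y. g (x, y) \<partial>lborel \<partial>lborel)" by (rule nn_integral_shear_fst) measurable
  also have "\<dots> = (\<integral>\<^sup>+x. \<integral>\<^sup>+y. h (x, y + s * x) \<partial>lborel \<partial>lborel)" by (simp add: g_def)
  also have "\<dots> = (\<integral>\<^sup>+x. \<integral>\<^sup>+y. h (x, y) \<partial>lborel \<partial>lborel)" by (rule nn_integral_shear_snd) measurable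
  also have "\<dots> = (\<integral>\<^sup>+x. \<integral>\<^sup>+y. f (x + a * y, y) \<partial>lborel \<partial>lborel)" by (simp add: h_def)
  also have "\<dots> = (\<integral>\<^sup>+x. \<integral>\<^sup>+y. f (x, y) \<partial>lborel \<partial>lborel)" by (rule nn_integral_shear_fst) measurable
  finally show ?thesis .
qed

lemma std_normal_density_mult:
  "std_normal_density x * std_normal_density y = exp (- (x\<^sup>2 + y\<^sup>2) / 2) / (2 * pi)"
  by (simp add: std_normal_density_def exp_add[symmetric] field_simps power2_eq_square[symmetric])

text \<open>The product density depends on x^2 + y^2 only, so the Lebesgue case applies to density
  times \<open>f\<close>.\<close>

lemma nn_integral_gauss_rotate:
  fixes f :: "real \<times> real \<Rightarrow> ennreal" and c s :: real
  assumes f [measurable]: "f \<in> borel_measurable (borel \<Otimes>\<^sub>M borel)" and cs: "c\<^sup>2 + s\<^sup>2 = 1" "s \<noteq> 0"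
  shows "(\<integral>\<^sup>+x. \<integral>\<^sup>+y. f (c * x - s * y, s * x + c * y) \<partial>gauss \<partial>gauss)
       = (\<integral>\<^sup>+x. \<integral>\<^sup>+y. f (x, y) \<partial>gauss \<partial>gauss)"
proof -
  define d where "d = (\<lambda>(x::real, y::real). ennreal (std_normal_density x * std_normal_density y))"
  have [measurable]: "d \<in> borel_measurable (borel \<Otimes>\<^sub>M borel)" unfolding d_def by measurable
  have eq: "(\<integral>\<^sup>+x. \<integral>\<^sup>+y. h (x, y) \<partial>gauss \<partial>gauss) = (\<integral>\<^sup>+x. \<integral>\<^sup>+y. d (x, y) * h (x, y) \<partial>lborel \<partial>lborel)"
    if [measurable]: "h \<in> borel_measurable (borel \<Otimes>\<^sub>M borel)" for h :: "real \<times> real \<Rightarrow> ennreal"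
    by (simp add: nn_integral_gauss nn_integral_cmult[symmetric] d_def ennreal_mult mult.assoc)
  have d: "d (c * x - s * y, s * x + c * y) = d (x, y)" for x y
  proof -
    have "(c * x - s * y)\<^sup>2 + (s * x + c * y)\<^sup>2 = (c\<^sup>2 + s\<^sup>2) * (x\<^sup>2 + y\<^sup>2)"
      by (simp add: power2_eq_square algebra_simps)
    then show ?thesis by (simp only: d_def prod.case std_normal_density_mult) (simp add: cs)
  qed
  have "(\<integral>\<^sup>+x. \<integral>\<^sup>+y. f (c * x - s * y, s * x + c * y) \<partial>gauss \<partial>gauss)
    = (\<integral>\<^sup>+x. \<integral>\<^sup>+y. (\<lambda>(x, y). f (c * x - s * y, s * x + c * y)) (x, y) \<partial>gauss \<partial>gauss)" by simp
  also have "\<dots> = (\<integral>\<^sup>+x. \<integral>\<^sup>+y. (\<lambda>z. d z * f z) (c * x - s * y, s * x + c * y) \<partial>lborel \<partial>lborel)"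
    by (subst eq) (auto simp: d)
  also have "\<dots> = (\<integral>\<^sup>+x. \<integral>\<^sup>+y. (\<lambda>z. d z * f z) (x, y) \<partial>lborel \<partial>lborel)"
    by (rule nn_integral_lborel_rotate) (use cs in auto)
  also have "\<dots> = (\<integral>\<^sup>+x. \<integral>\<^sup>+y. f (x, y) \<partial>gauss \<partial>gauss)"
    by (subst eq) auto
  finally show ?thesis .
qed

lemma nn_integral_std_gauss_two:
  assumes ij: "i \<in> {1..n}" "j \<in> {1..n}" "i \<noteq> j"
    and f [measurable]: "f \<in> borel_measurable (std_gauss n)"
  shows "(\<integral>\<^sup>+x. f x \<partial>std_gauss n)
    = (\<integral>\<^sup>+x. \<integral>\<^sup>+a. \<integral>\<^sup>+b. f (x(i := a, j := b)) \<partial>gauss \<partial>gauss \<partial>Pi\<^sub>M ({1..n} - {i, j}) (\<lambda>_. gauss))"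
proof -
  let ?K = "{1..n} - {i, j}"
  have I: "{1..n} = insert j (insert i ?K)" using ij by auto
  have ins: "insert i ({1..n} - {i, j}) = {1..n} - {j}" using ij by auto
  have f': "f \<in> borel_measurable (Pi\<^sub>M (insert j (insert i ?K)) (\<lambda>_. gauss))"
    using f unfolding std_gauss_def I[symmetric] .
  have upd: "(\<lambda>x. \<integral>\<^sup>+b. f (x(j := b)) \<partial>gauss) \<in> borel_measurable (Pi\<^sub>M (insert i ?K) (\<lambda>_. gauss))"
  proof -
    have "(\<lambda>(x, b). f (x(j := b))) \<in> borel_measurable (Pi\<^sub>M (insert i ?K) (\<lambda>_. gauss) \<Otimes>\<^sub>M gauss)"
      unfolding split_def
      by (rule measurable_compose[OF _ f']) (intro measurable_fun_upd[where J="insert i ?K"]; simp)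
    then show ?thesis by measurable
  qed
  have "(\<integral>\<^sup>+x. f x \<partial>std_gauss n) = (\<integral>\<^sup>+x. f x \<partial>Pi\<^sub>M (insert j (insert i ?K)) (\<lambda>_. gauss))"
    unfolding std_gauss_def I[symmetric] ..
  also have "\<dots> = (\<integral>\<^sup>+x. \<integral>\<^sup>+b. f (x(j := b)) \<partial>gauss \<partial>Pi\<^sub>M (insert i ?K) (\<lambda>_. gauss))"
    by (rule gaussP.product_nn_integral_insert) (use ij f' in auto)
  also have "\<dots> = (\<integral>\<^sup>+x. \<integral>\<^sup>+a. \<integral>\<^sup>+b. f (x(i := a, j := b)) \<partial>gauss \<partial>gauss \<partial>Pi\<^sub>M ?K (\<lambda>_. gauss))"
    by (rule gaussP.product_nn_integral_insert) (use ij upd in auto)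
  finally show ?thesis .
qed

definition givens :: "nat \<Rightarrow> nat \<Rightarrow> real \<Rightarrow> real \<Rightarrow> (nat \<Rightarrow> real) \<Rightarrow> nat \<Rightarrow> real" where
  "givens i j c s x = x(i := c * x i - s * x j, j := s * x i + c * x j)"

lemma measurable_givens:
  assumes "i \<in> {1..n}" "j \<in> {1..n}"
  shows "givens i j c s \<in> std_gauss n \<rightarrow>\<^sub>M std_gauss n"
proof -
  have "givens i j c s \<in> Pi\<^sub>M {1..n} (\<lambda>_. borel) \<rightarrow>\<^sub>M Pi\<^sub>M {1..n} (\<lambda>_. borel :: real measure)"
    unfolding givens_def
  proof (rule measurable_PiM_single')
    fix l assume l: "l \<in> {1..n}"
    have [measurable]: "(\<lambda>x. x i) \<in> borel_measurable (Pi\<^sub>M {1..n} (\<lambda>_. borel :: real measure))"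
      "(\<lambda>x. x j) \<in> borel_measurable (Pi\<^sub>M {1..n} (\<lambda>_. borel :: real measure))"
      "(\<lambda>x. x l) \<in> borel_measurable (Pi\<^sub>M {1..n} (\<lambda>_. borel :: real measure))"
      using assms l by auto
    show "(\<lambda>x. (x(i := c * x i - s * x j, j := s * x i + c * x j)) l) \<in> borel_measurable (Pi\<^sub>M {1..n} (\<lambda>_. borel))"
      by (cases "l = j"; cases "l = i") auto
  qed (use assms in \<open>auto simp: space_PiM PiE_def extensional_def\<close>)
  then show ?thesis by (simp add: measurable_def sets_std_gauss space_std_gauss space_PiM)
qed

text \<open>Freezing all coordinates except \<open>i\<close> and \<open>j\<close> leaves the planar
  rotation inside the integral.\<close>

lemma distr_givens:
  assumes ij: "i \<in> {1..n}" "j \<in> {1..n}" "i \<noteq> j" and cs: "c\<^sup>2 + s\<^sup>2 = 1" "s \<noteq> 0"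
  shows "distr (std_gauss n) (std_gauss n) (givens i j c s) = std_gauss n"
proof (rule measure_eqI)
  fix A assume "A \<in> sets (distr (std_gauss n) (std_gauss n) (givens i j c s))"
  then have A [measurable]: "A \<in> sets (std_gauss n)" by simp
  note [measurable] = measurable_givens[OF ij(1,2), of c s]
  let ?K = "{1..n} - {i, j}"
  have "emeasure (distr (std_gauss n) (std_gauss n) (givens i j c s)) A
      = (\<integral>\<^sup>+x. indicator A (givens i j c s x) \<partial>std_gauss n)"
    using nn_integral_distr[of "givens i j c s" "std_gauss n" "std_gauss n" "indicator A"] by simp
  also have "\<dots> = (\<integral>\<^sup>+x. \<integral>\<^sup>+a. \<integral>\<^sup>+b. indicator A (givens i j c s (x(i := a, j := b))) \<partial>gauss \<partial>gauss \<partial>Pi\<^sub>M ?K (\<lambda>_. gauss))"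
    by (rule nn_integral_std_gauss_two[OF ij]) measurable
  also have "\<dots> = (\<integral>\<^sup>+x. \<integral>\<^sup>+a. \<integral>\<^sup>+b. indicator A (x(i := a, j := b)) \<partial>gauss \<partial>gauss \<partial>Pi\<^sub>M ?K (\<lambda>_. gauss))"
  proof (rule nn_integral_cong)
    fix x assume x: "x \<in> space (Pi\<^sub>M ?K (\<lambda>_. gauss))"
    have m: "(\<lambda>(a, b). indicator A (x(i := a, j := b)) :: ennreal) \<in> borel_measurable (borel \<Otimes>\<^sub>M borel)"
    proof -
      have "(\<lambda>(a, b). x(i := a, j := b)) \<in> borel \<Otimes>\<^sub>M borel \<rightarrow>\<^sub>M Pi\<^sub>M {1..n} (\<lambda>_. borel)"
      proof (rule measurable_PiM_single')
        fix l assume l: "l \<in> {1..n}"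
        show "(\<lambda>z. (case z of (a, b) \<Rightarrow> x(i := a, j := b)) l) \<in> borel_measurable (borel \<Otimes>\<^sub>M borel)"
          by (cases "l = j"; cases "l = i") (auto simp: split_def)
      qed (use x ij in \<open>auto simp: space_PiM PiE_def extensional_def\<close>)
      then have "(\<lambda>(a, b). x(i := a, j := b)) \<in> borel \<Otimes>\<^sub>M borel \<rightarrow>\<^sub>M std_gauss n"
        by (simp add: measurable_def sets_std_gauss space_std_gauss space_PiM)
      from measurable_compose[OF this borel_measurable_indicator[OF A]] show ?thesis
        by (simp add: split_def)
    qed
    have "(\<integral>\<^sup>+a. \<integral>\<^sup>+b. indicator A (givens i j c s (x(i := a, j := b))) \<partial>gauss \<partial>gauss)
       = (\<integral>\<^sup>+a. \<integral>\<^sup>+b. (\<lambda>(a, b). indicator A (x(i := a, j := b))) (c * a - s * b, s * a + c * b) \<partial>gauss \<partial>gauss)"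
    proof -
      have "givens i j c s (x(i := a, j := b)) = x(i := c * a - s * b, j := s * a + c * b)" for a b
        using ij(3) by (auto simp: givens_def)
      then show ?thesis by simp
    qed
    also have "\<dots> = (\<integral>\<^sup>+a. \<integral>\<^sup>+b. (\<lambda>(a, b). indicator A (x(i := a, j := b))) (a, b) \<partial>gauss \<partial>gauss)"
      by (rule nn_integral_gauss_rotate[OF m cs])
    finally show "(\<integral>\<^sup>+a. \<integral>\<^sup>+b. indicator A (givens i j c s (x(i := a, j := b))) \<partial>gauss \<partial>gauss)
       = (\<integral>\<^sup>+a. \<integral>\<^sup>+b. indicator A (x(i := a, j := b)) \<partial>gauss \<partial>gauss)" by simp
  qed
  also have "\<dots> = (\<integral>\<^sup>+x. indicator A x \<partial>std_gauss n)"
    by (rule nn_integral_std_gauss_two[OF ij, symmetric]) measurable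
  also have "\<dots> = emeasure (std_gauss n) A" by simp
  finally show "emeasure (distr (std_gauss n) (std_gauss n) (givens i j c s)) A = emeasure (std_gauss n) A" .
qed simp

section \<open>QR decomposition by rotations\<close>

text \<open>An orthogonal map given by its action instead of a matrix. Invariance of the Gaussian
  law is part of the definition: it is checked for plane rotations and inherited by compositions and
  inverses. Linearity and inversion concern all functions on the naturals, the norm only the
  coordinates in {1..n}.\<close>

definition rot :: "nat \<Rightarrow> ((nat \<Rightarrow> real) \<Rightarrow> nat \<Rightarrow> real) \<Rightarrow> ((nat \<Rightarrow> real) \<Rightarrow> nat \<Rightarrow> real) \<Rightarrow> bool" where
  "rot n T T' \<longleftrightarrow>
     (\<forall>a b x y. T (\<lambda>i. a * x i + b * y i) = (\<lambda>i. a * T x i + b * T y i)) \<and>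
     (\<forall>x. (\<Sum>i=1..n. (T x i)\<^sup>2) = (\<Sum>i=1..n. (x i)\<^sup>2)) \<and>
     (\<forall>x. T' (T x) = x) \<and> (\<forall>x. T (T' x) = x) \<and>
     T \<in> std_gauss n \<rightarrow>\<^sub>M std_gauss n \<and> T' \<in> std_gauss n \<rightarrow>\<^sub>M std_gauss n \<and>
     distr (std_gauss n) (std_gauss n) T = std_gauss n"

lemma rot_linear: "rot n T T' \<Longrightarrow> T (\<lambda>i. a * x i + b * y i) = (\<lambda>i. a * T x i + b * T y i)"
  and rot_norm: "rot n T T' \<Longrightarrow> (\<Sum>i=1..n. (T x i)\<^sup>2) = (\<Sum>i=1..n. (x i)\<^sup>2)"
  and rot_inv1: "rot n T T' \<Longrightarrow> T' (T x) = x"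
  and rot_inv2: "rot n T T' \<Longrightarrow> T (T' x) = x"
  and measurable_rot: "rot n T T' \<Longrightarrow> T \<in> std_gauss n \<rightarrow>\<^sub>M std_gauss n"
  and measurable_rot_inv: "rot n T T' \<Longrightarrow> T' \<in> std_gauss n \<rightarrow>\<^sub>M std_gauss n"
  and distr_rot: "rot n T T' \<Longrightarrow> distr (std_gauss n) (std_gauss n) T = std_gauss n"
  by (simp_all add: rot_def)

lemma rot_id: "rot n (\<lambda>x. x) (\<lambda>x. x)"
  by (simp add: rot_def distr_id2)

lemma rot_comp:
  assumes S: "rot n S S'" and T: "rot n T T'"
  shows "rot n (\<lambda>x. S (T x)) (\<lambda>x. T' (S' x))"
proof -
  note [measurable] = measurable_rot[OF S] measurable_rot_inv[OF S] measurable_rot[OF T] measurable_rot_inv[OF T]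
  have "distr (std_gauss n) (std_gauss n) (\<lambda>x. S (T x)) = std_gauss n"
    using distr_distr[OF measurable_rot[OF S] measurable_rot[OF T]]
    by (simp add: distr_rot[OF S] distr_rot[OF T] comp_def)
  then show ?thesis
    unfolding rot_def using rot_linear[OF S] rot_linear[OF T] rot_norm[OF S] rot_norm[OF T]
      rot_inv1[OF S] rot_inv1[OF T] rot_inv2[OF S] rot_inv2[OF T] by simp
qed

lemma rot_sym:
  assumes T: "rot n T T'"
  shows "rot n T' T"
proof -
  note [measurable] = measurable_rot[OF T] measurable_rot_inv[OF T]
  have lin: "T' (\<lambda>i. a * x i + b * y i) = (\<lambda>i. a * T' x i + b * T' y i)" for a b x y
  proof -
    have "T' (\<lambda>i. a * x i + b * y i) = T' (\<lambda>i. a * T (T' x) i + b * T (T' y) i)" by (simp add: rot_inv2[OF T])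
    also have "\<dots> = T' (T (\<lambda>i. a * T' x i + b * T' y i))" by (simp only: rot_linear[OF T])
    finally show ?thesis by (simp add: rot_inv1[OF T])
  qed
  have "distr (std_gauss n) (std_gauss n) T' = distr (distr (std_gauss n) (std_gauss n) T) (std_gauss n) T'"
    by (simp add: distr_rot[OF T])
  also have "\<dots> = std_gauss n"
    by (subst distr_distr) (simp_all add: comp_def rot_inv1[OF T] distr_id2)
  finally show ?thesis
    unfolding rot_def using lin rot_inv1[OF T] rot_inv2[OF T] rot_norm[OF T, of "T' _"]
      measurable_rot[OF T] measurable_rot_inv[OF T] by (intro conjI allI) simp_all
qed

lemma rot_diff: "rot n T T' \<Longrightarrow> T (\<lambda>i. x i - y i) = (\<lambda>i. T x i - T y i)"
  using rot_linear[of n T T' 1 x "-1" y] by simp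

lemma rot_add: "rot n T T' \<Longrightarrow> T (\<lambda>i. x i + y i) = (\<lambda>i. T x i + T y i)"
  using rot_linear[of n T T' 1 x "1" y] by simp

lemma rot_scale: "rot n T T' \<Longrightarrow> T (\<lambda>i. a * x i) = (\<lambda>i. a * T x i)"
  using rot_linear[of n T T' a x 0 x] by simp

text \<open>\<open>rot\<close> does not say that the first \<open>n\<close> output coordinates
  depend on the first \<open>n\<close> input coordinates alone. This follows from norm preservation
  applied to the difference of the inputs.\<close>

lemma rot_cong:
  assumes T: "rot n T T'" and eq: "\<And>i. i \<in> {1..n} \<Longrightarrow> x i = y i" and i: "i \<in> {1..n}"
  shows "T x i = T y i"
proof -
  have "(\<Sum>i=1..n. (T x i - T y i)\<^sup>2) = (\<Sum>i=1..n. (x i - y i)\<^sup>2)"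
    using rot_norm[OF T, of "\<lambda>i. x i - y i"] by (simp add: rot_diff[OF T])
  also have "\<dots> = 0" using eq by simp
  finally have "(T x i - T y i)\<^sup>2 = 0"
    using i by (subst (asm) sum_nonneg_eq_0_iff) auto
  then show ?thesis by simp
qed

text \<open>Polarization: inner products are combinations of squared norms.\<close>

lemma rot_inner:
  assumes T: "rot n T T'"
  shows "(\<Sum>i=1..n. T x i * T y i) = (\<Sum>i=1..n. x i * y i)"
proof -
  have eq: "(\<Sum>i=1..n. u i * v i) = ((\<Sum>i=1..n. (u i + v i)\<^sup>2) - (\<Sum>i=1..n. (u i)\<^sup>2) - (\<Sum>i=1..n. (v i)\<^sup>2)) / 2"
    for u v :: "nat \<Rightarrow> real"
    unfolding sum_subtractf[symmetric] sum_divide_distrib by (intro sum.cong) (auto simp: power2_eq_square algebra_simps)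
  have "(\<Sum>i=1..n. (T x i + T y i)\<^sup>2) = (\<Sum>i=1..n. (x i + y i)\<^sup>2)"
    using rot_norm[OF T, of "\<lambda>i. x i + y i"] by (simp add: rot_add[OF T])
  then show ?thesis unfolding eq[of "T x" "T y"] eq[of x y] rot_norm[OF T] by simp
qed

lemma rot_givens:
  assumes ij: "i \<in> {1..n}" "j \<in> {1..n}" "i \<noteq> j" and cs: "c\<^sup>2 + s\<^sup>2 = 1" "s \<noteq> 0"
  shows "rot n (givens i j c s) (givens i j c (- s))"
proof -
  have inv: "givens i j c (- s) (givens i j c s x) = x" if "c\<^sup>2 + s\<^sup>2 = 1" for c s x
  proof
    fix l
    have 1: "c * (c * x i - s * x j) - (- s) * (s * x i + c * x j) = (c\<^sup>2 + s\<^sup>2) * x i"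
      "(- s) * (c * x i - s * x j) + c * (s * x i + c * x j) = (c\<^sup>2 + s\<^sup>2) * x j"
      by (simp_all add: power2_eq_square algebra_simps)
    show "givens i j c (- s) (givens i j c s x) l = x l"
      unfolding givens_def using ij(3) 1 that by (simp add: fun_upd_apply)
  qed
  have norm: "(\<Sum>l=1..n. (givens i j c s x l)\<^sup>2) = (\<Sum>l=1..n. (x l)\<^sup>2)" for x
  proof -
    have I: "{1..n} = insert j (insert i ({1..n} - {i, j}))" using ij by auto
    have "(\<Sum>l=1..n. (givens i j c s x l)\<^sup>2)
       = (s * x i + c * x j)\<^sup>2 + ((c * x i - s * x j)\<^sup>2 + (\<Sum>l\<in>{1..n} - {i, j}. (givens i j c s x l)\<^sup>2))"
      by (subst I) (use ij in \<open>simp add: givens_def\<close>)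
    also have "(\<Sum>l\<in>{1..n} - {i, j}. (givens i j c s x l)\<^sup>2) = (\<Sum>l\<in>{1..n} - {i, j}. (x l)\<^sup>2)"
      by (rule sum.cong) (auto simp: givens_def)
    also have "(s * x i + c * x j)\<^sup>2 + ((c * x i - s * x j)\<^sup>2 + (\<Sum>l\<in>{1..n} - {i, j}. (x l)\<^sup>2))
       = (c\<^sup>2 + s\<^sup>2) * ((x j)\<^sup>2 + (x i)\<^sup>2) + (\<Sum>l\<in>{1..n} - {i, j}. (x l)\<^sup>2)"
      by (simp add: power2_eq_square algebra_simps)
    also have "\<dots> = (\<Sum>l=1..n. (x l)\<^sup>2)"
      by (subst (2) I) (use ij cs in simp)
    finally show ?thesis .
  qed
  have lin: "givens i j c s (\<lambda>l. a * x l + b * y l) = (\<lambda>l. a * givens i j c s x l + b * givens i j c s y l)" for a b x y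
    by (auto simp: givens_def fun_eq_iff algebra_simps)
  show ?thesis
    unfolding rot_def
    using inv[OF cs(1)] inv[of c "- s"] cs norm lin measurable_givens[OF ij(1,2)] distr_givens[OF ij cs] by simp
qed

text \<open>The pivot \<open>i\<close> absorbs the coordinates in \<open>J\<close> one plane
  rotation at a time. Leaving the other coordinates fixed for every vector, not just for
  \<open>b\<close>, is what protects the coordinates settled by earlier rotations.\<close>

lemma rot_annihilate:
  assumes "finite J" "J \<subseteq> {1..n}" "i \<in> {1..n}" "i \<notin> J"
  shows "\<exists>T T'. rot n T T' \<and> (\<forall>x. \<forall>l. l \<notin> insert i J \<longrightarrow> T x l = x l) \<and> (\<forall>l\<in>J. T b l = 0)"
  using assms
proof (induction J rule: finite_induct)
  case empty
  show ?case using rot_id by fastforce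
next
  case (insert j J)
  then obtain T T' where T: "rot n T T'" "\<And>x l. l \<notin> insert i J \<Longrightarrow> T x l = x l" "\<And>l. l \<in> J \<Longrightarrow> T b l = 0"
    by auto
  show ?case
  proof (cases "T b j = 0")
    case True
    then show ?thesis using T insert by (intro exI[of _ T] exI[of _ T']) auto
  next
    case False
    \<comment> \<open>The angle that turns the pair of coordinates (\<open>i\<close>,
      \<open>j\<close>) of \<open>T b\<close> into (r, 0); \<open>T b j\<close> being nonzero gives
      \<open>s \<noteq> 0\<close>.\<close>
    define r where "r = sqrt ((T b i)\<^sup>2 + (T b j)\<^sup>2)"
    have r2: "r\<^sup>2 = (T b i)\<^sup>2 + (T b j)\<^sup>2" by (simp add: r_def)
    have r: "r \<noteq> 0" using False by (simp add: r_def sum_power2_eq_zero_iff)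
    define c s where "c = T b i / r" and "s = - T b j / r"
    have cs: "c\<^sup>2 + s\<^sup>2 = 1" "s \<noteq> 0"
      using r False r2 by (simp_all add: c_def s_def power_divide add_divide_distrib[symmetric])
    have z: "s * T b i + c * T b j = 0" by (simp add: c_def s_def)
    have ij: "i \<in> {1..n}" "j \<in> {1..n}" "i \<noteq> j" using insert by auto
    show ?thesis
      by (intro exI[of _ "\<lambda>x. givens i j c s (T x)"] exI[of _ "\<lambda>x. T' (givens i j c (- s) x)"] conjI
          rot_comp[OF rot_givens[OF ij cs] T(1)])
        (use T z insert in \<open>auto simp: givens_def\<close>)
  qed
qed

text \<open>\<open>qr n T T' k V\<close>: on the coordinates \<open>{1..n}\<close>, the rotation \<open>T\<close> carries \<open>V\<close> onto the vectors
  supported on the first \<open>k\<close> coordinates.\<close>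

definition qr :: "nat \<Rightarrow> ((nat \<Rightarrow> real) \<Rightarrow> nat \<Rightarrow> real) \<Rightarrow> ((nat \<Rightarrow> real) \<Rightarrow> nat \<Rightarrow> real) \<Rightarrow> nat
    \<Rightarrow> (nat \<Rightarrow> real) set \<Rightarrow> bool" where
  "qr n T T' k V \<longleftrightarrow> rot n T T' \<and> k \<le> n \<and> (\<forall>v\<in>V. \<forall>i\<in>{k<..n}. T v i = 0) \<and>
     (\<forall>z. (\<forall>i\<in>{k<..n}. z i = 0) \<longrightarrow> (\<exists>v\<in>V. \<forall>i\<in>{1..n}. T v i = z i))"

lemma qr_rot: "qr n T T' k V \<Longrightarrow> rot n T T'"
  and qr_le: "qr n T T' k V \<Longrightarrow> k \<le> n"
  and qr_zero: "qr n T T' k V \<Longrightarrow> v \<in> V \<Longrightarrow> k < i \<Longrightarrow> i \<le> n \<Longrightarrow> T v i = 0"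
  by (simp_all add: qr_def)

lemma qr_onto:
  assumes "qr n T T' k V" "\<And>i. k < i \<Longrightarrow> i \<le> n \<Longrightarrow> z i = 0"
  shows "\<exists>v\<in>V. \<forall>i. 1 \<le> i \<longrightarrow> i \<le> n \<longrightarrow> T v i = z i"
proof -
  have "\<forall>i\<in>{k<..n}. z i = 0" using assms(2) by auto
  with assms(1) have "\<exists>v\<in>V. \<forall>i\<in>{1..n}. T v i = z i" unfolding qr_def by blast
  then show ?thesis by (metis atLeastAtMost_iff)
qed

lemma sum_split_le:
  fixes f :: "nat \<Rightarrow> real"
  assumes "k \<le> n"
  shows "(\<Sum>i=1..n. f i) = (\<Sum>i=1..k. f i) + (\<Sum>i\<in>{k<..n}. f i)"
proof -
  from assms have *: "{1..n} = {1..k} \<union> {k<..n}" by auto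
  show ?thesis unfolding * by (rule sum.union_disjoint) auto
qed

lemma rot_tail_norm:
  assumes S: "rot n S S'" and T: "rot n T T'" and k: "k \<le> n"
    and eq: "\<And>i. i \<in> {1..k} \<Longrightarrow> S x i = T x i"
  shows "(\<Sum>i\<in>{k<..n}. (S x i)\<^sup>2) = (\<Sum>i\<in>{k<..n}. (T x i)\<^sup>2)"
proof -
  have "(\<Sum>i=1..n. (S x i)\<^sup>2) = (\<Sum>i=1..n. (T x i)\<^sup>2)" by (simp add: rot_norm[OF S] rot_norm[OF T])
  then show ?thesis unfolding sum_split_le[OF k] using eq by simp
qed

text \<open>Equal heads force equal tail norms, so a tail annihilated by \<open>T\<close> is
  annihilated by \<open>S\<close> too. This allows one rotation to serve a whole chain of nested
  spaces.\<close>

lemma qr_change: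
  assumes q: "qr n T T' k V" and S: "rot n S S'" and eq: "\<And>x i. i \<in> {1..k} \<Longrightarrow> S x i = T x i"
  shows "qr n S S' k V"
proof -
  note T = qr_rot[OF q] and k = qr_le[OF q]
  have z: "S v i = 0" if "v \<in> V" "i \<in> {k<..n}" for v i
  proof -
    have "(\<Sum>i\<in>{k<..n}. (S v i)\<^sup>2) = (\<Sum>i\<in>{k<..n}. (T v i)\<^sup>2)"
      by (rule rot_tail_norm[OF S T k]) (rule eq)
    also have "\<dots> = 0" using qr_zero[OF q \<open>v \<in> V\<close>] by simp
    finally have "(\<Sum>i\<in>{k<..n}. (S v i)\<^sup>2) = 0" .
    then show ?thesis using that by (subst (asm) sum_nonneg_eq_0_iff) auto
  qed
  show ?thesis unfolding qr_def
  proof (intro conjI allI impI ballI S k)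
    fix z :: "nat \<Rightarrow> real" assume "\<forall>i\<in>{k<..n}. z i = 0"
    then have z0: "\<And>i. k < i \<Longrightarrow> i \<le> n \<Longrightarrow> z i = 0" by auto
    obtain v where v: "v \<in> V" "\<And>i. 1 \<le> i \<Longrightarrow> i \<le> n \<Longrightarrow> T v i = z i" using qr_onto[OF q, of z] z0 by blast
    show "\<exists>v\<in>V. \<forall>i\<in>{1..n}. S v i = z i"
    proof (intro bexI[OF _ v(1)] ballI)
      fix i assume "i \<in> {1..n}"
      then show "S v i = z i" using v eq[of i v] z[OF v(1), of i] z0[of i] by (cases "i \<le> k") auto
    qed
  qed (use z in auto)
qed

definition adj :: "(nat \<Rightarrow> real) \<Rightarrow> (nat \<Rightarrow> real) set \<Rightarrow> (nat \<Rightarrow> real) set" where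
  "adj c V = {\<lambda>i. a * c i + v i | a v. v \<in> V}"

lemma adjI: "v \<in> V \<Longrightarrow> (\<lambda>i. a * c i + v i) \<in> adj c V"
  by (auto simp: adj_def)

lemma subset_adj: "V \<subseteq> adj c V"
proof
  fix v assume "v \<in> V" from adjI[OF this, of 0 c] show "v \<in> adj c V" by simp
qed

text \<open>If the tail of the rotated \<open>c\<close> vanishes, \<open>c\<close> agrees on {1..n}
  with an element of \<open>V\<close> and the rank stays. Otherwise the tail is rotated into
  coordinate k + 1. Either way the first \<open>k\<close> coordinates are kept, so
  \<open>qr_change\<close> preserves every earlier space.\<close>

lemma qr_step:
  assumes q: "qr n T T' k V"
  shows "\<exists>S S' k'. qr n S S' k' (adj c V) \<and> qr n S S' k V \<and> (\<forall>x. \<forall>i\<in>{1..k}. S x i = T x i) \<and>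
     (k' = k \<and> (\<exists>v\<in>V. \<forall>i\<in>{1..n}. v i = c i) \<or> k' = k + 1)"
proof (cases "\<forall>i\<in>{k<..n}. T c i = 0")
  case True
  note T = qr_rot[OF q]
  have "\<And>i. k < i \<Longrightarrow> i \<le> n \<Longrightarrow> T c i = 0" using True by auto
  obtain v where v: "v \<in> V" "\<And>i. 1 \<le> i \<Longrightarrow> i \<le> n \<Longrightarrow> T v i = T c i"
    using qr_onto[OF q, of "T c"] True by fastforce
  have "v i = c i" if "i \<in> {1..n}" for i
    using rot_cong[OF rot_sym[OF T], of "T v" "T c" i] v(2) that by (simp add: rot_inv1[OF T])
  moreover have "qr n T T' k (adj c V)"
    unfolding qr_def
  proof (intro conjI T qr_le[OF q] ballI allI impI)
    fix w i assume "w \<in> adj c V" and i: "i \<in> {k<..n}"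
    then obtain a v where "w = (\<lambda>i. a * c i + v i)" "v \<in> V" by (auto simp: adj_def)
    then show "T w i = 0" using rot_linear[OF T, of a c 1 v] qr_zero[OF q, of v i] True i by simp
  next
    fix z :: "nat \<Rightarrow> real" assume "\<forall>i\<in>{k<..n}. z i = 0"
    then have z0: "\<And>i. k < i \<Longrightarrow> i \<le> n \<Longrightarrow> z i = 0" by auto
    obtain v where v: "v \<in> V" "\<And>i. 1 \<le> i \<Longrightarrow> i \<le> n \<Longrightarrow> T v i = z i" using qr_onto[OF q, of z] z0 by blast
    then show "\<exists>v\<in>adj c V. \<forall>i\<in>{1..n}. T v i = z i"
      by (intro bexI[OF _ subsetD[OF subset_adj v(1)]]) auto
  qed
  ultimately have *: "qr n T T' k (adj c V) \<and> qr n T T' k V \<and> (\<forall>x. \<forall>i\<in>{1..k}. T x i = T x i) \<and>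
      (k = k \<and> (\<exists>v\<in>V. \<forall>i\<in>{1..n}. v i = c i) \<or> k = k + 1)"
    using q by (intro conjI disjI1 refl bexI[OF _ v(1)] ballI) auto
  show ?thesis by (rule exI[of _ T], rule exI[of _ T'], rule exI[of _ k]) (rule *)
next
  case False
  note T = qr_rot[OF q] and kn = qr_le[OF q]
  obtain i0 where i0: "i0 \<in> {k<..n}" "T c i0 \<noteq> 0" using False by blast
  then have k: "k + 1 \<le> n" by auto
  obtain R R' where R: "rot n R R'" "\<And>x l. l \<notin> insert (k + 1) {k + 1<..n} \<Longrightarrow> R x l = x l"
      "\<And>l. l \<in> {k + 1<..n} \<Longrightarrow> R (T c) l = 0"
  proof -
    have "\<exists>R R'. rot n R R' \<and> (\<forall>x l. l \<notin> insert (k + 1) {k + 1<..n} \<longrightarrow> R x l = x l) \<and> (\<forall>l\<in>{k + 1<..n}. R (T c) l = 0)"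
      by (rule rot_annihilate) (use k in auto)
    then show ?thesis using that by blast
  qed
  define S S' where "S = (\<lambda>x. R (T x))" and "S' = (\<lambda>x. T' (R' x))"
  have S: "rot n S S'" unfolding S_def S'_def by (rule rot_comp[OF R(1) T])
  have eq: "S x i = T x i" if "i \<in> {1..k}" for x i
    using that R(2) by (auto simp: S_def)
  note qS = qr_change[OF q S eq]
  have ins: "{k<..n} = insert (k + 1) {k + 1<..n}" using k by auto
  \<comment> \<open>Otherwise the whole tail of \<open>S c\<close> would vanish, although it has the
    same norm as the nonzero tail of \<open>T c\<close>.\<close>
  have nz: "S c (k + 1) \<noteq> 0"
  proof
    assume "S c (k + 1) = 0"
    then have "(\<Sum>i\<in>{k<..n}. (S c i)\<^sup>2) = 0" using R(3) by (subst ins) (auto simp: S_def)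
    then have "(\<Sum>i\<in>{k<..n}. (T c i)\<^sup>2) = 0" using rot_tail_norm[OF S T kn, of c] eq by simp
    then show False using i0 by (subst (asm) sum_nonneg_eq_0_iff) auto
  qed
  have "qr n S S' (k + 1) (adj c V)"
    unfolding qr_def
  proof (intro conjI S k ballI allI impI)
    fix w i assume w: "w \<in> adj c V" and i: "i \<in> {k + 1<..n}"
    then obtain a v where "w = (\<lambda>i. a * c i + v i)" "v \<in> V" by (auto simp: adj_def)
    then show "S w i = 0" using rot_linear[OF S, of a c 1 v] qr_zero[OF qS, of v i] i R(3)[OF i] by (simp add: S_def)
  next
    fix z :: "nat \<Rightarrow> real" assume z: "\<forall>i\<in>{k + 1<..n}. z i = 0"
    \<comment> \<open>\<open>c\<close> supplies coordinate k + 1 of the target; what is left lives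
      on the first \<open>k\<close> coordinates and is reached by \<open>V\<close>.\<close>
    define a where "a = z (k + 1) / S c (k + 1)"
    have "z i - a * S c i = 0" if "k < i" "i \<le> n" for i
    proof (cases "i = k + 1")
      case True then show ?thesis using nz by (simp add: a_def)
    next
      case False then show ?thesis using z R(3)[of i] that by (simp add: S_def)
    qed
    then obtain v where v: "v \<in> V" "\<And>i. 1 \<le> i \<Longrightarrow> i \<le> n \<Longrightarrow> S v i = z i - a * S c i"
      using qr_onto[OF qS, of "\<lambda>i. z i - a * S c i"] by blast
    show "\<exists>v\<in>adj c V. \<forall>i\<in>{1..n}. S v i = z i"
      by (rule bexI[OF _ adjI[OF v(1), of a c]]) (use v(2) rot_linear[OF S, of a c 1 v] in auto)
  qed
  then have *: "qr n S S' (k + 1) (adj c V) \<and> qr n S S' k V \<and> (\<forall>x. \<forall>i\<in>{1..k}. S x i = T x i) \<and>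
      (k + 1 = k \<and> (\<exists>v\<in>V. \<forall>i\<in>{1..n}. v i = c i) \<or> k + 1 = k + 1)"
    by (intro conjI qS allI ballI eq disjI2 refl)
  show ?thesis by (rule exI[of _ S], rule exI[of _ S'], rule exI[of _ "k + 1"]) (rule *)
qed

section \<open>Column spans built one column at a time\<close>

definition adds :: "(nat \<Rightarrow> nat \<Rightarrow> real) \<Rightarrow> nat set \<Rightarrow> (nat \<Rightarrow> real) set \<Rightarrow> (nat \<Rightarrow> real) set" where
  "adds X B V = {\<lambda>i. (\<Sum>j\<in>B. X i j * \<beta> j) + v i | \<beta> v. v \<in> V}"

lemma adds_empty [simp]: "adds X {} V = V"
  by (auto simp: adds_def)

lemma adds_insert:
  assumes "finite B" "j \<notin> B"
  shows "adds X (insert j B) V = adj (\<lambda>i. X i j) (adds X B V)"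
proof (intro equalityI subsetI)
  fix w assume "w \<in> adds X (insert j B) V"
  then obtain \<beta> v where w: "v \<in> V" "w = (\<lambda>i. (\<Sum>j\<in>insert j B. X i j * \<beta> j) + v i)" by (auto simp: adds_def)
  have "w = (\<lambda>i. \<beta> j * X i j + ((\<Sum>j\<in>B. X i j * \<beta> j) + v i))" using assms by (simp add: w mult.commute add.assoc)
  then show "w \<in> adj (\<lambda>i. X i j) (adds X B V)" using adjI[of "\<lambda>i. (\<Sum>j\<in>B. X i j * \<beta> j) + v i" "adds X B V" "\<beta> j" "\<lambda>i. X i j"] w(1)
    by (auto simp: adds_def)
next
  fix w assume "w \<in> adj (\<lambda>i. X i j) (adds X B V)"
  then obtain a \<beta> v where w: "v \<in> V" "w = (\<lambda>i. a * X i j + ((\<Sum>j\<in>B. X i j * \<beta> j) + v i))"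
    unfolding adj_def adds_def by blast
  have "(\<Sum>l\<in>B. X i l * (\<beta>(j := a)) l) = (\<Sum>l\<in>B. X i l * \<beta> l)" for i
    using assms by (intro sum.cong) auto
  then have "w = (\<lambda>i. (\<Sum>l\<in>insert j B. X i l * (\<beta>(j := a)) l) + v i)"
    using assms by (simp add: w mult.commute add.assoc)
  then show "w \<in> adds X (insert j B) V" using w(1) unfolding adds_def by blast
qed

lemma adj_commute: "adj c (adj d V) = adj d (adj c V)"
proof -
  have "adj c (adj d V) \<subseteq> adj d (adj c V)" for c d
  proof
    fix w assume "w \<in> adj c (adj d V)"
    then obtain a b v where "v \<in> V" "w = (\<lambda>i. a * c i + (b * d i + v i))" unfolding adj_def by blast
    then have "w = (\<lambda>i. b * d i + (a * c i + v i))" "v \<in> V" by (auto simp: algebra_simps)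
    then show "w \<in> adj d (adj c V)" using adjI[OF adjI[OF \<open>v \<in> V\<close>, of a c], of b d] by simp
  qed
  then show ?thesis by blast
qed

lemma adds_adj: "finite B \<Longrightarrow> adds X B (adj u V) = adj u (adds X B V)"
  by (induction B rule: finite_induct) (simp_all add: adds_insert adj_commute)

lemma adds_Un: "finite A \<Longrightarrow> finite B \<Longrightarrow> A \<inter> B = {} \<Longrightarrow> adds X A (adds X B V) = adds X (A \<union> B) V"
  by (induction A rule: finite_induct) (simp_all add: adds_insert)

text \<open>Unlike \<open>col_span\<close>, without restriction to {1..n} and without normalising
  coefficients off \<open>\<tau>\<close>, so that adjoining a column is a plain sum of
  functions.\<close>

definition sp :: "(nat \<Rightarrow> nat \<Rightarrow> real) \<Rightarrow> nat set \<Rightarrow> (nat \<Rightarrow> real) set" where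
  "sp X \<tau> = adds X \<tau> {\<lambda>_. 0}"

lemma sp_eq: "sp X \<tau> = range (\<lambda>\<beta> i. \<Sum>j\<in>\<tau>. X i j * \<beta> j)"
  by (auto simp: sp_def adds_def)

text \<open>A common rotation for a space and its enlargement turns the difference of their residual
  sums of squares into the block of coordinates k + 1 to k'.\<close>

lemma qr_adds:
  assumes q: "qr n T T' k V" and "finite B"
  shows "\<exists>S S' k'. qr n S S' k' (adds X B V) \<and> qr n S S' k V \<and> k \<le> k' \<and> k' \<le> k + card B"
  using assms(2)
proof (induction B rule: finite_induct)
  case empty
  show ?case by (rule exI[of _ T], rule exI[of _ T'], rule exI[of _ k]) (use q in simp)
next
  case (insert j B)
  from insert.IH obtain S S' k' where S: "qr n S S' k' (adds X B V)" "qr n S S' k V" "k \<le> k'" "k' \<le> k + card B"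
    by blast
  from qr_step[OF S(1), of "\<lambda>i. X i j"] obtain R R' k'' where
    R: "qr n R R' k'' (adj (\<lambda>i. X i j) (adds X B V))" and R2: "\<forall>x. \<forall>i\<in>{1..k'}. R x i = S x i"
    and R3: "k'' = k' \<and> (\<exists>v\<in>adds X B V. \<forall>i\<in>{1..n}. v i = X i j) \<or> k'' = k' + 1"
    by blast
  have "qr n R R' k V" by (rule qr_change[OF S(2) qr_rot[OF R]]) (use R2 S(3) in auto)
  moreover have "adds X (insert j B) V = adj (\<lambda>i. X i j) (adds X B V)" using insert by (simp add: adds_insert)
  moreover have "k \<le> k''" "k'' \<le> k + card (insert j B)" using R3 S(3,4) insert by auto
  ultimately have *: "qr n R R' k'' (adds X (insert j B) V) \<and> qr n R R' k V \<and> k \<le> k'' \<and> k'' \<le> k + card (insert j B)"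
    using R by simp
  show ?case by (rule exI[of _ R], rule exI[of _ R'], rule exI[of _ k'']) (rule *)
qed

lemma qr_null: "qr n (\<lambda>x. x) (\<lambda>x. x) 0 {\<lambda>_. 0}"
  by (auto simp: qr_def rot_id)

lemma qr_sp: "finite \<tau> \<Longrightarrow> \<exists>T T' k. qr n T T' k (sp X \<tau>) \<and> k \<le> card \<tau>"
  using qr_adds[OF qr_null, of \<tau> n X] unfolding sp_def by auto

text \<open>The rank can only drop below the number of columns if some column depends on the others.\<close>

lemma qr_sp_rank:
  assumes "finite \<tau>"
  shows "\<exists>T T' k. qr n T T' k (sp X \<tau>) \<and> (k = card \<tau> \<or> (\<exists>j\<in>\<tau>. \<exists>v\<in>sp X (\<tau> - {j}). \<forall>i\<in>{1..n}. v i = X i j))"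
  using assms
proof (induction \<tau> rule: finite_induct)
  case empty
  show ?case using qr_null[of n] by (auto simp: sp_def intro!: exI)
next
  case (insert j \<tau>)
  from insert.IH obtain T T' k where T: "qr n T T' k (sp X \<tau>)"
    and k: "k = card \<tau> \<or> (\<exists>j\<in>\<tau>. \<exists>v\<in>sp X (\<tau> - {j}). \<forall>i\<in>{1..n}. v i = X i j)"
    by blast
  have ins: "sp X (insert j \<tau>) = adj (\<lambda>i. X i j) (sp X \<tau>)" using insert by (simp add: sp_def adds_insert)
  from qr_step[OF T, of "\<lambda>i. X i j"] obtain S S' k' where
    S: "qr n S S' k' (sp X (insert j \<tau>))" "k' = k \<and> (\<exists>v\<in>sp X \<tau>. \<forall>i\<in>{1..n}. v i = X i j) \<or> k' = k + 1"
    unfolding ins by blast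
  have d: "insert j \<tau> - {j} = \<tau>" using insert by auto
  have mono: "sp X (\<tau> - {l}) \<subseteq> sp X (insert j \<tau> - {l})" if "l \<in> \<tau>" for l
  proof -
    have "insert j \<tau> - {l} = insert j (\<tau> - {l})" using insert that by auto
    then show ?thesis using insert by (simp add: sp_def adds_insert subset_adj)
  qed
  from k show ?case
  proof
    assume "k = card \<tau>"
    then have "k' = card (insert j \<tau>) \<or> (\<exists>v\<in>sp X (insert j \<tau> - {j}). \<forall>i\<in>{1..n}. v i = X i j)"
      using S(2) insert d by auto
    then show ?thesis using S(1) by (intro exI[of _ S, OF exI[of _ S', OF exI[of _ k']]]) auto
  next
    assume "\<exists>j\<in>\<tau>. \<exists>v\<in>sp X (\<tau> - {j}). \<forall>i\<in>{1..n}. v i = X i j"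
    then obtain l v where "l \<in> \<tau>" "v \<in> sp X (\<tau> - {l})" "\<forall>i\<in>{1..n}. v i = X i l" by blast
    then have "\<exists>l\<in>insert j \<tau>. \<exists>v\<in>sp X (insert j \<tau> - {l}). \<forall>i\<in>{1..n}. v i = X i l"
      using mono by blast
    then show ?thesis using S(1) by (intro exI[of _ S, OF exI[of _ S', OF exI[of _ k']]]) auto
  qed
qed

section \<open>Squared distances in rotated coordinates\<close>

definition sqdist :: "nat \<Rightarrow> (nat \<Rightarrow> real) set \<Rightarrow> (nat \<Rightarrow> real) \<Rightarrow> real" where
  "sqdist n V y = (INF v\<in>V. \<Sum>i=1..n. (y i - v i)\<^sup>2)"

text \<open>Elements of \<open>V\<close> can match the first \<open>k\<close> rotated coordinates of
  \<open>y\<close> exactly and cannot influence the others.\<close>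

lemma qr_nearest:
  assumes q: "qr n T T' k V"
  shows "\<exists>v\<in>V. (\<Sum>i=1..n. (y i - v i)\<^sup>2) = (\<Sum>i\<in>{k<..n}. (T y i)\<^sup>2)"
    and "\<And>v. v \<in> V \<Longrightarrow> (\<Sum>i\<in>{k<..n}. (T y i)\<^sup>2) \<le> (\<Sum>i=1..n. (y i - v i)\<^sup>2)"
proof -
  note T = qr_rot[OF q]
  have eq: "(\<Sum>i=1..n. (y i - v i)\<^sup>2) = (\<Sum>i=1..k. (T y i - T v i)\<^sup>2) + (\<Sum>i\<in>{k<..n}. (T y i)\<^sup>2)" if "v \<in> V" for v
  proof -
    have "(\<Sum>i=1..n. (y i - v i)\<^sup>2) = (\<Sum>i=1..n. (T y i - T v i)\<^sup>2)"
      using rot_norm[OF T, of "\<lambda>i. y i - v i"] by (simp add: rot_diff[OF T])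
    then show ?thesis unfolding sum_split_le[OF qr_le[OF q]] using qr_zero[OF q that] by simp
  qed
  obtain v where v: "v \<in> V" "\<And>i. 1 \<le> i \<Longrightarrow> i \<le> n \<Longrightarrow> T v i = (if i \<le> k then T y i else 0)"
    using qr_onto[OF q, of "\<lambda>i. if i \<le> k then T y i else 0"] by fastforce
  show "\<exists>v\<in>V. (\<Sum>i=1..n. (y i - v i)\<^sup>2) = (\<Sum>i\<in>{k<..n}. (T y i)\<^sup>2)"
    by (rule bexI[OF _ v(1)]) (use v qr_le[OF q] in \<open>simp add: eq\<close>)
  show "\<And>v. v \<in> V \<Longrightarrow> (\<Sum>i\<in>{k<..n}. (T y i)\<^sup>2) \<le> (\<Sum>i=1..n. (y i - v i)\<^sup>2)"
    by (simp add: eq sum_nonneg)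
qed

text \<open>The constant \<open>c\<close> is carried along because \<open>tau_hat\<close> has its
  penalty inside the infimum.\<close>

lemma qr_INF:
  assumes q: "qr n T T' k V"
  shows "(INF v\<in>V. (\<Sum>i=1..n. (y i - v i)\<^sup>2) + c) = (\<Sum>i\<in>{k<..n}. (T y i)\<^sup>2) + c"
proof (rule cInf_eq_minimum)
  obtain v where v: "v \<in> V" "(\<Sum>i=1..n. (y i - v i)\<^sup>2) = (\<Sum>i\<in>{k<..n}. (T y i)\<^sup>2)"
    using qr_nearest(1)[OF q] by blast
  show "(\<Sum>i\<in>{k<..n}. (T y i)\<^sup>2) + c \<in> (\<lambda>v. (\<Sum>i=1..n. (y i - v i)\<^sup>2) + c) ` V"
    by (rule image_eqI[OF _ v(1)]) (simp add: v(2))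
qed (use qr_nearest(2)[OF q] in auto)

lemma sqdist_qr: "qr n T T' k V \<Longrightarrow> sqdist n V y = (\<Sum>i\<in>{k<..n}. (T y i)\<^sup>2)"
  using qr_INF[of n T T' k V y 0] by (simp add: sqdist_def)

lemma sqdist_mono:
  assumes "V \<subseteq> W" "V \<noteq> {}"
  shows "sqdist n W y \<le> sqdist n V y"
  unfolding sqdist_def by (intro cINF_superset_mono bdd_belowI2[where m=0]) (use assms in \<open>auto intro: sum_nonneg\<close>)

lemma sp_mono:
  assumes "finite \<tau>" "\<sigma> \<subseteq> \<tau>"
  shows "sp X \<sigma> \<subseteq> sp X \<tau>"
proof
  fix v assume "v \<in> sp X \<sigma>"
  then obtain \<beta> where v: "v = (\<lambda>i. \<Sum>j\<in>\<sigma>. X i j * \<beta> j)" by (auto simp: sp_eq)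
  have "v = (\<lambda>i. \<Sum>j\<in>\<tau>. X i j * (if j \<in> \<sigma> then \<beta> j else 0))"
    unfolding v by (intro ext sum.mono_neutral_cong_left) (use assms in auto)
  then show "v \<in> sp X \<tau>" unfolding sp_eq by (rule image_eqI[where x="\<lambda>j. if j \<in> \<sigma> then \<beta> j else 0"]) simp
qed

lemma sp_nonempty: "sp X \<tau> \<noteq> {}"
  by (simp add: sp_eq)

lemma adj_mono: "V \<subseteq> W \<Longrightarrow> adj u V \<subseteq> adj u W"
  by (auto simp: adj_def)

lemma adj_nonempty: "V \<noteq> {} \<Longrightarrow> adj u V \<noteq> {}"
  using subset_adj by blast

text \<open>Adjoining one direction: the Pythagorean formula, valid with \<open>x / 0 = 0\<close> also when
  \<open>u\<close> already lies in \<open>V\<close>.\<close>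

lemma sqdist_adj:
  assumes q: "qr n T T' k V"
  shows "sqdist n (adj u V) y =
    (\<Sum>i\<in>{k<..n}. (T y i)\<^sup>2) - (\<Sum>i\<in>{k<..n}. T y i * T u i)\<^sup>2 / (\<Sum>i\<in>{k<..n}. (T u i)\<^sup>2)"
proof -
  note T = qr_rot[OF q]
  let ?J = "{k<..n}"
  let ?yy = "\<Sum>i\<in>?J. (T y i)\<^sup>2" and ?yu = "\<Sum>i\<in>?J. T y i * T u i" and ?uu = "\<Sum>i\<in>?J. (T u i)\<^sup>2"
  have quad: "(\<Sum>i\<in>?J. (T (\<lambda>i. y i - a * u i) i)\<^sup>2) = ?yy - 2 * a * ?yu + a\<^sup>2 * ?uu" for a
    unfolding rot_diff[OF T] rot_scale[OF T]
  proof -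
    have "(T y i - a * T u i)\<^sup>2 = (T y i)\<^sup>2 - (2 * a) * (T y i * T u i) + a\<^sup>2 * (T u i)\<^sup>2" for i
      by (simp add: power2_eq_square algebra_simps)
    then show "(\<Sum>i\<in>?J. (T y i - a * T u i)\<^sup>2) = ?yy - 2 * a * ?yu + a\<^sup>2 * ?uu"
      by (simp only: sum.distrib sum_subtractf sum_distrib_left)
  qed
  \<comment> \<open>Completing the square in \<open>a\<close>. If \<open>u\<close> has no component
    outside \<open>V\<close>, the mixed sum vanishes as well.\<close>
  have min: "?yy - ?yu\<^sup>2 / ?uu \<le> ?yy - 2 * a * ?yu + a\<^sup>2 * ?uu" for a
  proof (cases "?uu = 0")
    case True
    then have "\<forall>i\<in>?J. T u i = 0" by (subst (asm) sum_nonneg_eq_0_iff) auto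
    then have "?yu = 0" by simp
    then show ?thesis using True by simp
  next
    case False
    then have pos: "?uu > 0" by (simp add: less_le sum_nonneg)
    have "0 \<le> (a * U - W)\<^sup>2 / U \<and> (a * U - W)\<^sup>2 / U = - 2 * a * W + a\<^sup>2 * U + W\<^sup>2 / U" if "U > 0" for U W :: real
    proof -
      have "(a * U - W)\<^sup>2 = U * (- 2 * a * W + a\<^sup>2 * U) + W\<^sup>2" by (simp add: power2_eq_square algebra_simps)
      moreover have "0 \<le> (a * U - W)\<^sup>2 / U" using that by simp
      moreover have "(U * (- 2 * a * W + a\<^sup>2 * U) + W\<^sup>2) / U = - 2 * a * W + a\<^sup>2 * U + W\<^sup>2 / U"
        using that by (simp add: add_divide_distrib)
      ultimately show ?thesis by metis
    qed
    from this[OF pos, of ?yu] show ?thesis by linarith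
  qed
  show ?thesis unfolding sqdist_def
  proof (rule cInf_eq_minimum)
    define a where "a = ?yu / ?uu"
    have val: "?yy - 2 * a * ?yu + a\<^sup>2 * ?uu = ?yy - ?yu\<^sup>2 / ?uu"
    proof -
      have "A - 2 * (W / U) * W + (W / U)\<^sup>2 * U = A - W\<^sup>2 / U" for A U W :: real
        by (cases "U = 0") (simp_all add: power2_eq_square)
      then show ?thesis by (simp only: a_def)
    qed
    obtain v where v: "v \<in> V" "(\<Sum>i=1..n. (y i - a * u i - v i)\<^sup>2) = (\<Sum>i\<in>?J. (T (\<lambda>i. y i - a * u i) i)\<^sup>2)"
      using qr_nearest(1)[OF q, of "\<lambda>i. y i - a * u i"] by auto
    have "(\<Sum>i=1..n. (y i - (a * u i + v i))\<^sup>2) = ?yy - ?yu\<^sup>2 / ?uu"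
      using v(2) unfolding quad val by (simp add: diff_diff_eq)
    from this[symmetric] show "?yy - ?yu\<^sup>2 / ?uu \<in> (\<lambda>v. \<Sum>i=1..n. (y i - v i)\<^sup>2) ` adj u V"
      by (rule image_eqI[OF _ adjI[OF v(1), of a u]])
  next
    fix x assume "x \<in> (\<lambda>v. \<Sum>i=1..n. (y i - v i)\<^sup>2) ` adj u V"
    then obtain a v where v: "v \<in> V" "x = (\<Sum>i=1..n. (y i - (a * u i + v i))\<^sup>2)" by (auto simp: adj_def)
    have "?yy - 2 * a * ?yu + a\<^sup>2 * ?uu \<le> x"
      using qr_nearest(2)[OF q v(1), of "\<lambda>i. y i - a * u i"] unfolding quad v(2) by (simp add: diff_diff_eq)
    then show "?yy - ?yu\<^sup>2 / ?uu \<le> x" using min[of a] by simp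
  qed
qed

section \<open>Norm and direction of a Gaussian vector\<close>

abbreviation gaussP :: "nat set \<Rightarrow> (nat \<Rightarrow> real) measure" where
  "gaussP J \<equiv> Pi\<^sub>M J (\<lambda>_. gauss)"

lemma emeasure_gauss_UNIV [simp]: "emeasure gauss UNIV = 1"
  using gauss.emeasure_space_1 by simp

lemma prob_space_gaussP: "prob_space (gaussP J)"
  by (rule prob_space_PiM) (rule prob_space_gauss)

lemma nn_integral_gauss_scale:
  fixes f :: "real \<Rightarrow> ennreal"
  assumes [measurable]: "f \<in> borel_measurable borel" and c: "c > 0"
  shows "(\<integral>\<^sup>+x. f x \<partial>gauss) = (\<integral>\<^sup>+x. ennreal (c * exp (- (c\<^sup>2 - 1) * x\<^sup>2 / 2)) * f (c * x) \<partial>gauss)"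
proof -
  have d: "std_normal_density (c * x) = std_normal_density x * exp (- (c\<^sup>2 - 1) * x\<^sup>2 / 2)" for x
    by (simp add: std_normal_density_def exp_add[symmetric] power_mult_distrib field_simps)
  have "(\<integral>\<^sup>+x. f x \<partial>gauss) = \<bar>c\<bar> * (\<integral>\<^sup>+x. ennreal (std_normal_density (c * x)) * f (c * x) \<partial>lborel)"
    using nn_integral_real_affine[of "\<lambda>x. ennreal (std_normal_density x) * f x" c 0] c
    by (simp add: nn_integral_gauss)
  also have "\<dots> = (\<integral>\<^sup>+x. ennreal c * (ennreal (std_normal_density (c * x)) * f (c * x)) \<partial>lborel)"
    using c by (simp add: nn_integral_cmult)
  also have "\<dots> = (\<integral>\<^sup>+x. ennreal (std_normal_density x) * (ennreal (c * exp (- (c\<^sup>2 - 1) * x\<^sup>2 / 2)) * f (c * x)) \<partial>lborel)"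
    unfolding d using c by (intro nn_integral_cong) (simp add: ennreal_mult mult_ac)
  also have "\<dots> = (\<integral>\<^sup>+x. ennreal (c * exp (- (c\<^sup>2 - 1) * x\<^sup>2 / 2)) * f (c * x) \<partial>gauss)"
    by (subst nn_integral_gauss) auto
  finally show ?thesis .
qed

text \<open>The density of the substitution x = c x' relative to the Gaussian measure on
  \<open>J\<close>, at radius \<open>r\<close>: the Jacobian times the ratio of the Gaussian
  densities at radius c r and at radius r.\<close>

definition scale_weight :: "nat set \<Rightarrow> real \<Rightarrow> real \<Rightarrow> real" where
  "scale_weight J c r = c ^ card J * exp (- (c\<^sup>2 - 1) * r\<^sup>2 / 2)"

lemma scale_weight_insert:
  assumes "finite J" "i \<notin> J"
  shows "scale_weight (insert i J) c (L2_set x (insert i J)) =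
    scale_weight J c (L2_set x J) * (c * exp (- (c\<^sup>2 - 1) * (x i)\<^sup>2 / 2))"
proof -
  have "(L2_set x (insert i J))\<^sup>2 = (x i)\<^sup>2 + (L2_set x J)\<^sup>2"
    using assms by (simp add: L2_set_def sum_nonneg)
  then show ?thesis
    using assms by (simp add: scale_weight_def exp_add[symmetric] add_divide_distrib ring_distribs)
qed

lemma measurable_L2_set [measurable]:
  assumes [measurable]: "\<And>i. i \<in> J \<Longrightarrow> (\<lambda>x. f x i) \<in> borel_measurable M"
  shows "(\<lambda>x. L2_set (f x) J) \<in> borel_measurable M"
  unfolding L2_set_def by measurable

lemma sets_gaussP [measurable_cong]: "sets (gaussP J) = sets (Pi\<^sub>M J (\<lambda>_. borel))"
  by (intro sets_PiM_cong) auto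

lemma measurable_gaussP_component:
  "i \<in> J \<Longrightarrow> (\<lambda>x. x i) \<in> borel_measurable (gaussP J)"
  using measurable_component_singleton[of i J "\<lambda>_. gauss"] by simp

lemma measurable_into_gaussP:
  "(\<And>i. i \<in> J \<Longrightarrow> X i \<in> borel_measurable M) \<Longrightarrow> (\<lambda>x. \<lambda>i\<in>J. X i x) \<in> M \<rightarrow>\<^sub>M gaussP J"
  by (rule measurable_restrict) simp

lemma measurable_scale_weight [measurable]:
  assumes [measurable]: "f \<in> borel_measurable M" "g \<in> borel_measurable M"
  shows "(\<lambda>x. scale_weight J (f x) (g x)) \<in> borel_measurable M"
  unfolding scale_weight_def by measurable

lemma nn_integral_gaussP_scale:
  assumes "finite J" and f: "f \<in> borel_measurable (gaussP J)" and c: "c > 0"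
  shows "(\<integral>\<^sup>+x. f x \<partial>gaussP J) =
    (\<integral>\<^sup>+x. ennreal (scale_weight J c (L2_set x J)) * f (\<lambda>i\<in>J. c * x i) \<partial>gaussP J)"
  using assms(1,2)
proof (induction J arbitrary: f rule: finite_induct)
  case empty
  show ?case by (rule nn_integral_cong) (simp add: scale_weight_def space_PiM restrict_def)
next
  case (insert i J)
  note fm [measurable] = insert.prems
  let ?w = "\<lambda>y. ennreal (c * exp (- (c\<^sup>2 - 1) * y\<^sup>2 / 2))"
  define g where "g = (\<lambda>x. \<integral>\<^sup>+y. ?w y * f (x(i := c * y)) \<partial>gauss)"
  have upd [measurable]: "(\<lambda>(x, y). x(i := c * y)) \<in> gaussP J \<Otimes>\<^sub>M borel \<rightarrow>\<^sub>M gaussP (insert i J)"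
    unfolding split_def by (rule measurable_fun_upd[where J=J]) auto
  have upd1 [measurable]: "(\<lambda>y. x(i := y)) \<in> borel \<rightarrow>\<^sub>M gaussP (insert i J)" if "x \<in> space (gaussP J)" for x
    by (rule measurable_fun_upd[where J=J]) (use that in auto)
  have g [measurable]: "g \<in> borel_measurable (gaussP J)"
  proof -
    have "(\<lambda>z. f ((\<lambda>(x, y). x(i := c * y)) z)) \<in> borel_measurable (gaussP J \<Otimes>\<^sub>M borel)"
      by (rule measurable_compose[OF upd fm])
    then have "(\<lambda>(x, y). ?w y * f (x(i := c * y))) \<in> borel_measurable (gaussP J \<Otimes>\<^sub>M gauss)"
      by (simp add: split_def)
    then show ?thesis unfolding g_def by measurable
  qed
  have "(\<integral>\<^sup>+x. f x \<partial>gaussP (insert i J)) = (\<integral>\<^sup>+x. \<integral>\<^sup>+y. f (x(i := y)) \<partial>gauss \<partial>gaussP J)"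
    by (rule gaussP.product_nn_integral_insert) (use insert in auto)
  also have "\<dots> = (\<integral>\<^sup>+x. g x \<partial>gaussP J)"
  proof (rule nn_integral_cong)
    fix x assume x: "x \<in> space (gaussP J)"
    show "(\<integral>\<^sup>+y. f (x(i := y)) \<partial>gauss) = g x"
      unfolding g_def by (rule nn_integral_gauss_scale[OF measurable_compose[OF upd1[OF x] fm] c])
  qed
  also have "\<dots> = (\<integral>\<^sup>+x. ennreal (scale_weight J c (L2_set x J)) * g (\<lambda>i\<in>J. c * x i) \<partial>gaussP J)"
    by (rule insert.IH) (rule g)
  also have "\<dots> = (\<integral>\<^sup>+x. \<integral>\<^sup>+y. ennreal (scale_weight (insert i J) c (L2_set (x(i := y)) (insert i J)))
      * f (\<lambda>l\<in>insert i J. c * (x(i := y)) l) \<partial>gauss \<partial>gaussP J)"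
  proof (rule nn_integral_cong)
    fix x assume x: "x \<in> space (gaussP J)"
    let ?x = "\<lambda>i\<in>J. c * x i"
    have cx: "?x \<in> space (gaussP J)" by (simp add: space_PiM)
    have [measurable]: "(\<lambda>y. f (?x(i := c * y))) \<in> borel_measurable borel"
      using measurable_compose[OF measurable_compose[OF _ upd1[OF cx]] fm, of "\<lambda>y. c * y" borel] by simp
    have L: "L2_set (x(i := y)) J = L2_set x J" for y
      using insert(2) by (intro L2_set_cong) auto
    have r: "?x(i := c * y) = (\<lambda>l\<in>insert i J. c * (x(i := y)) l)" for y
      using insert(2) by (auto simp: fun_eq_iff)
    have "ennreal (scale_weight J c (L2_set x J)) * g ?x
       = (\<integral>\<^sup>+y. ennreal (scale_weight J c (L2_set x J)) * (?w y * f (?x(i := c * y))) \<partial>gauss)"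
      unfolding g_def by (rule nn_integral_cmult[symmetric]) measurable
    also have "\<dots> = (\<integral>\<^sup>+y. ennreal (scale_weight (insert i J) c (L2_set (x(i := y)) (insert i J)))
      * f (\<lambda>l\<in>insert i J. c * (x(i := y)) l) \<partial>gauss)"
      unfolding r scale_weight_insert[OF insert(1,2)] L
      using c by (intro nn_integral_cong) (simp add: ennreal_mult mult_ac scale_weight_def)
    finally show "ennreal (scale_weight J c (L2_set x J)) * g ?x = \<dots>" .
  qed
  also have "\<dots> = (\<integral>\<^sup>+x. ennreal (scale_weight (insert i J) c (L2_set x (insert i J))) * f (\<lambda>l\<in>insert i J. c * x l) \<partial>gaussP (insert i J))"
  proof (rule gaussP.product_nn_integral_insert[symmetric])
    have "(\<lambda>x. \<lambda>l\<in>insert i J. c * x l) \<in> gaussP (insert i J) \<rightarrow>\<^sub>M gaussP (insert i J)"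
      by (rule measurable_into_gaussP) measurable
    from measurable_compose[OF this fm]
    show "(\<lambda>x. ennreal (scale_weight (insert i J) c (L2_set x (insert i J))) * f (\<lambda>l\<in>insert i J. c * x l)) \<in> borel_measurable (gaussP (insert i J))"
      by measurable
  qed (use insert in auto)
  finally show ?case .
qed

lemma AE_gaussP_pos:
  assumes "finite J" "J \<noteq> {}"
  shows "AE x in gaussP J. L2_set x J > 0"
proof -
  obtain i where i: "i \<in> J" using assms by auto
  have "AE y in gauss. y \<noteq> 0"
    by (subst AE_density) (use AE_lborel_singleton[of 0] in auto)
  then have "AE x in gaussP J. x i \<noteq> 0"
    by (intro AE_PiM_component prob_space_gauss i)
  then show ?thesis
  proof eventually_elim
    case (elim x)
    then have "L2_set x J \<noteq> 0" using i assms by (auto simp: L2_set_eq_0_iff)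
    then show ?case using L2_set_nonneg[of x J] by linarith
  qed
qed

lemma L2_set_scale: "L2_set (\<lambda>i\<in>J. c * x i) J = \<bar>c\<bar> * L2_set x J"
proof -
  have "L2_set (\<lambda>i\<in>J. c * x i) J = L2_set (\<lambda>i. c * x i) J" by (rule L2_set_cong) auto
  also have "\<dots> = \<bar>c\<bar> * L2_set x J"
    by (simp add: L2_set_def power_mult_distrib sum_distrib_left[symmetric] real_sqrt_mult)
  finally show ?thesis .
qed

text \<open>Norm and direction of a Gaussian vector are independent. Substituting \<open>z = |v| x\<close> and then
  \<open>v = y / |x|\<close> shows that \<open>|z| v / |v|\<close> has a density \<open>c(|y|)\<close> with respect to the Gaussian
  measure; testing it on radial functions, where the claim is trivial, gives \<open>c = 1\<close>.\<close>

lemma nn_integral_gaussP_polar: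
  assumes J: "finite J" "J \<noteq> {}" and f [measurable]: "f \<in> borel_measurable (gaussP J)"
  shows "(\<integral>\<^sup>+z. \<integral>\<^sup>+v. f (\<lambda>i\<in>J. L2_set z J * (v i / L2_set v J)) \<partial>gaussP J \<partial>gaussP J) = (\<integral>\<^sup>+y. f y \<partial>gaussP J)"
proof -
  let ?G = "gaussP J"
  let ?n = "\<lambda>x. L2_set x J"
  let ?w = "scale_weight J"
  interpret G: prob_space ?G by (rule prob_space_gaussP)
  interpret GG: pair_sigma_finite ?G ?G ..
  note pos = AE_gaussP_pos[OF J]
  \<comment> \<open>The product of the two Jacobian weights at |y| = r and |x| = s: z = |v| x is
    rescaled by |v| = r / s, and v = y / |x| by 1 / s. Both weights depend on norms alone, so
    integrating over \<open>x\<close> leaves the radial factor \<open>c\<close>.\<close>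
  define h where "h r s = ennreal (?w (1 / s) r) * ennreal (?w (r / s) s)" for r s
  define c where "c r = (\<integral>\<^sup>+x. h r (?n x) \<partial>?G)" for r
  have hm [measurable]: "(\<lambda>x. h (a x) (b x)) \<in> borel_measurable M"
    if [measurable]: "a \<in> borel_measurable M" "b \<in> borel_measurable M" for a b and M :: "'b measure"
    unfolding h_def by measurable
  have cm [measurable]: "c \<in> borel_measurable borel"
  proof -
    have "(\<lambda>(r, x). h r (?n x)) \<in> borel_measurable (borel \<Otimes>\<^sub>M ?G)"
      unfolding split_def by measurable
    then show ?thesis unfolding c_def by measurable
  qed
  have main: "(\<integral>\<^sup>+z. \<integral>\<^sup>+v. f (\<lambda>i\<in>J. ?n z * (v i / ?n v)) \<partial>?G \<partial>?G) = (\<integral>\<^sup>+y. c (?n y) * f y \<partial>?G)"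
    if f [measurable]: "f \<in> borel_measurable ?G" for f
  proof -
    have fm [measurable]: "(\<lambda>x. f (\<lambda>i\<in>J. a x i)) \<in> borel_measurable M"
      if "\<And>i. i \<in> J \<Longrightarrow> (\<lambda>x. a x i) \<in> borel_measurable M" for a and M :: "'b measure"
      by (rule measurable_compose[OF measurable_into_gaussP f]) (rule that)
    have "(\<integral>\<^sup>+z. \<integral>\<^sup>+v. f (\<lambda>i\<in>J. ?n z * (v i / ?n v)) \<partial>?G \<partial>?G)
        = (\<integral>\<^sup>+v. \<integral>\<^sup>+z. f (\<lambda>i\<in>J. ?n z * (v i / ?n v)) \<partial>?G \<partial>?G)"
      by (rule GG.Fubini'[symmetric]) (unfold split_def, measurable)
    also have "\<dots> = (\<integral>\<^sup>+v. \<integral>\<^sup>+x. ennreal (?w (?n v) (?n x)) * f (\<lambda>i\<in>J. ?n x * v i) \<partial>?G \<partial>?G)"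
      using pos
    proof (intro nn_integral_cong_AE, eventually_elim)
      fix v assume v: "0 < ?n v"
      have e: "(\<lambda>i\<in>J. ?n (\<lambda>i\<in>J. ?n v * x i) * (v i / ?n v)) = (\<lambda>i\<in>J. ?n x * v i)" for x
        using v by (simp add: L2_set_scale)
      have "(\<integral>\<^sup>+z. f (\<lambda>i\<in>J. ?n z * (v i / ?n v)) \<partial>?G)
          = (\<integral>\<^sup>+x. ennreal (?w (?n v) (?n x)) * f (\<lambda>i\<in>J. ?n (\<lambda>i\<in>J. ?n v * x i) * (v i / ?n v)) \<partial>?G)"
        by (rule nn_integral_gaussP_scale[OF J(1) _ v]) measurable
      then show "(\<integral>\<^sup>+z. f (\<lambda>i\<in>J. ?n z * (v i / ?n v)) \<partial>?G)
          = (\<integral>\<^sup>+x. ennreal (?w (?n v) (?n x)) * f (\<lambda>i\<in>J. ?n x * v i) \<partial>?G)"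
        unfolding e .
    qed
    also have "\<dots> = (\<integral>\<^sup>+x. \<integral>\<^sup>+v. ennreal (?w (?n v) (?n x)) * f (\<lambda>i\<in>J. ?n x * v i) \<partial>?G \<partial>?G)"
      by (rule GG.Fubini') (unfold split_def, measurable)
    also have "\<dots> = (\<integral>\<^sup>+x. \<integral>\<^sup>+y. h (?n y) (?n x) * f y \<partial>?G \<partial>?G)"
      using pos
    proof (intro nn_integral_cong_AE, eventually_elim)
      fix x assume x: "0 < ?n x"
      have e: "(\<lambda>i\<in>J. ?n x * (\<lambda>i\<in>J. 1 / ?n x * y i) i) = y" if "y \<in> space ?G" for y
        using that x by (auto simp: fun_eq_iff space_PiM PiE_def extensional_def)
      have "(\<integral>\<^sup>+v. ennreal (?w (?n v) (?n x)) * f (\<lambda>i\<in>J. ?n x * v i) \<partial>?G)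
        = (\<integral>\<^sup>+y. ennreal (?w (1 / ?n x) (?n y)) * (ennreal (?w (?n (\<lambda>i\<in>J. 1 / ?n x * y i)) (?n x))
            * f (\<lambda>i\<in>J. ?n x * (\<lambda>i\<in>J. 1 / ?n x * y i) i)) \<partial>?G)"
      proof (rule nn_integral_gaussP_scale[OF J(1)])
        show "(\<lambda>v. ennreal (?w (?n v) (?n x)) * f (\<lambda>i\<in>J. ?n x * v i)) \<in> borel_measurable ?G"
          by measurable
        show "0 < 1 / ?n x" using x by simp
      qed
      also have "\<dots> = (\<integral>\<^sup>+y. h (?n y) (?n x) * f y \<partial>?G)"
      proof (rule nn_integral_cong)
        fix y assume y: "y \<in> space ?G"
        have "?n (\<lambda>i\<in>J. 1 / ?n x * y i) = ?n y / ?n x" unfolding L2_set_scale using x by simp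
        then show "ennreal (?w (1 / ?n x) (?n y)) * (ennreal (?w (?n (\<lambda>i\<in>J. 1 / ?n x * y i)) (?n x))
            * f (\<lambda>i\<in>J. ?n x * (\<lambda>i\<in>J. 1 / ?n x * y i) i)) = h (?n y) (?n x) * f y"
          unfolding e[OF y] by (simp add: h_def mult.assoc)
      qed
      finally show "(\<integral>\<^sup>+v. ennreal (?w (?n v) (?n x)) * f (\<lambda>i\<in>J. ?n x * v i) \<partial>?G) = (\<integral>\<^sup>+y. h (?n y) (?n x) * f y \<partial>?G)" .
    qed
    also have "\<dots> = (\<integral>\<^sup>+y. \<integral>\<^sup>+x. h (?n y) (?n x) * f y \<partial>?G \<partial>?G)"
      by (rule GG.Fubini') (unfold split_def, measurable)
    also have "\<dots> = (\<integral>\<^sup>+y. c (?n y) * f y \<partial>?G)"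
      unfolding c_def by (intro nn_integral_cong nn_integral_multc) measurable
    finally show ?thesis .
  qed
  define D where "D = distr ?G borel ?n"
  interpret D: prob_space D unfolding D_def by (rule G.prob_space_distr) measurable
  have "AE r in D. c r = 1"
  proof (rule D.density_unique2)
    fix A assume "A \<in> sets D"
    then have A [measurable]: "A \<in> sets borel" by (simp add: D_def)
    have "(\<integral>\<^sup>+r\<in>A. c r \<partial>D) = (\<integral>\<^sup>+y. c (?n y) * indicator A (?n y) \<partial>?G)"
      unfolding D_def by (subst nn_integral_distr) measurable
    also have "\<dots> = (\<integral>\<^sup>+z. \<integral>\<^sup>+v. indicator A (?n (\<lambda>i\<in>J. ?n z * (v i / ?n v))) \<partial>?G \<partial>?G)"
      by (rule main[symmetric]) measurable
    also have "\<dots> = (\<integral>\<^sup>+z. \<integral>\<^sup>+v. indicator A (?n z) \<partial>?G \<partial>?G)"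
    proof (rule nn_integral_cong, rule nn_integral_cong_AE)
      fix z
      have *: "?n (\<lambda>i\<in>J. ?n z * (v i / ?n v)) = ?n z" if "?n v > 0" for v
      proof -
        have "(\<lambda>i\<in>J. ?n z * (v i / ?n v)) = (\<lambda>i\<in>J. (?n z / ?n v) * v i)" by auto
        then have "?n (\<lambda>i\<in>J. ?n z * (v i / ?n v)) = \<bar>?n z / ?n v\<bar> * ?n v"
          by (simp only: L2_set_scale)
        then show ?thesis using that by simp
      qed
      show "AE v in ?G. indicator A (?n (\<lambda>i\<in>J. ?n z * (v i / ?n v))) = (indicator A (?n z) :: ennreal)"
        using pos by eventually_elim (simp only: *)
    qed
    also have "\<dots> = (\<integral>\<^sup>+z. indicator A (?n z) \<partial>?G)" by (simp add: G.emeasure_space_1)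
    also have "\<dots> = (\<integral>\<^sup>+r\<in>A. 1 \<partial>D)"
      unfolding D_def by (subst nn_integral_distr) (auto intro!: nn_integral_cong)
    finally show "(\<integral>\<^sup>+r\<in>A. c r \<partial>D) = (\<integral>\<^sup>+r\<in>A. 1 \<partial>D)" .
  qed (auto simp: D_def)
  then have "AE y in ?G. c (?n y) = 1"
    unfolding D_def by (subst (asm) AE_distr_iff) auto
  then have "(\<integral>\<^sup>+y. c (?n y) * f y \<partial>?G) = (\<integral>\<^sup>+y. f y \<partial>?G)"
  proof (intro nn_integral_cong_AE, eventually_elim)
  qed simp
  then show ?thesis using main[OF f] by simp
qed

text \<open>In rotated coordinates this is the resampling of the model test: the head of
  \<open>z\<close> stands for the projection, the tail norm of \<open>z\<close> for the residual
  norm, and \<open>v\<close> contributes a fresh residual direction.\<close>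

definition polar :: "nat \<Rightarrow> nat \<Rightarrow> (nat \<Rightarrow> real) \<Rightarrow> (nat \<Rightarrow> real) \<Rightarrow> nat \<Rightarrow> real" where
  "polar n k z v = (\<lambda>i\<in>{1..n}. if i \<le> k then z i else L2_set z {k<..n} * (v i / L2_set v {k<..n}))"

lemma measurable_polar:
  "(\<lambda>(z, v). polar n k z v) \<in> std_gauss n \<Otimes>\<^sub>M std_gauss n \<rightarrow>\<^sub>M std_gauss n"
  unfolding std_gauss_def polar_def split_def by (rule measurable_into_gaussP) measurable

text \<open>The head of \<open>z\<close> is untouched and the head of \<open>v\<close> integrates
  out, so with the head frozen this is \<open>nn_integral_gaussP_polar\<close> for the nonempty tail
  block.\<close>

lemma nn_integral_std_gauss_polar:
  assumes k: "k < n" and f [measurable]: "f \<in> borel_measurable (std_gauss n)"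
  shows "(\<integral>\<^sup>+z. \<integral>\<^sup>+v. f (polar n k z v) \<partial>std_gauss n \<partial>std_gauss n) = (\<integral>\<^sup>+y. f y \<partial>std_gauss n)"
proof -
  let ?K = "{1..k}" and ?J = "{k<..n}"
  have I: "?K \<union> ?J = {1..n}" "?K \<inter> ?J = {}" "finite ?K" "finite ?J" "?J \<noteq> {}" using k by auto
  have fold: "(\<integral>\<^sup>+y. g y \<partial>std_gauss n) = (\<integral>\<^sup>+a. \<integral>\<^sup>+b. g (merge ?K ?J (a, b)) \<partial>gaussP ?J \<partial>gaussP ?K)"
    if "g \<in> borel_measurable (std_gauss n)" for g
    using gaussP.product_nn_integral_fold[OF I(2-4), of g] that unfolding I(1) std_gauss_def by simp
  interpret K: prob_space "gaussP ?K" by (rule prob_space_gaussP)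
  interpret G: prob_space "std_gauss n" by (rule prob_space_std_gauss)
  let ?P = "\<lambda>b v. \<lambda>i\<in>?J. L2_set b ?J * (v i / L2_set v ?J)"
  have mr: "L2_set (merge ?K ?J (a, b)) ?J = L2_set b ?J" for a b
    by (intro L2_set_cong) (auto simp: merge_def)
  have pm: "polar n k (merge ?K ?J (a, b)) (merge ?K ?J (a', v)) = merge ?K ?J (a, ?P b v)" for a b a' v
    unfolding polar_def mr using k by (auto simp: merge_def fun_eq_iff)
  have m: "(\<lambda>v. f (polar n k z v)) \<in> borel_measurable (std_gauss n)" if "z \<in> space (std_gauss n)" for z
    using measurable_compose[OF measurable_Pair1'[OF that] measurable_compose[OF measurable_polar f]] by simp
  have "(\<integral>\<^sup>+z. \<integral>\<^sup>+v. f (polar n k z v) \<partial>std_gauss n \<partial>std_gauss n)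
     = (\<integral>\<^sup>+a. \<integral>\<^sup>+b. \<integral>\<^sup>+v. f (polar n k (merge ?K ?J (a, b)) v) \<partial>std_gauss n \<partial>gaussP ?J \<partial>gaussP ?K)"
  proof (rule fold)
    have "(\<lambda>(z, v). f (polar n k z v)) \<in> borel_measurable (std_gauss n \<Otimes>\<^sub>M std_gauss n)"
      using measurable_compose[OF measurable_polar f] by (simp add: split_def)
    then show "(\<lambda>z. \<integral>\<^sup>+v. f (polar n k z v) \<partial>std_gauss n) \<in> borel_measurable (std_gauss n)" by measurable
  qed
  also have "\<dots> = (\<integral>\<^sup>+a. \<integral>\<^sup>+b. \<integral>\<^sup>+v. f (merge ?K ?J (a, ?P b v)) \<partial>gaussP ?J \<partial>gaussP ?J \<partial>gaussP ?K)"
  proof (intro nn_integral_cong)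
    fix a b assume ab: "a \<in> space (gaussP ?K)" "b \<in> space (gaussP ?J)"
    have "merge ?K ?J (a, b) \<in> space (std_gauss n)"
      using ab k by (auto simp: space_std_gauss space_PiM merge_def PiE_def extensional_def)
    from m[OF this] have "(\<integral>\<^sup>+v. f (polar n k (merge ?K ?J (a, b)) v) \<partial>std_gauss n)
       = (\<integral>\<^sup>+a'. \<integral>\<^sup>+v. f (polar n k (merge ?K ?J (a, b)) (merge ?K ?J (a', v))) \<partial>gaussP ?J \<partial>gaussP ?K)"
      by (rule fold)
    then show "(\<integral>\<^sup>+v. f (polar n k (merge ?K ?J (a, b)) v) \<partial>std_gauss n)
       = (\<integral>\<^sup>+v. f (merge ?K ?J (a, ?P b v)) \<partial>gaussP ?J)"
      unfolding pm by (simp add: K.emeasure_space_1)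
  qed
  also have "\<dots> = (\<integral>\<^sup>+a. \<integral>\<^sup>+b. f (merge ?K ?J (a, b)) \<partial>gaussP ?J \<partial>gaussP ?K)"
  proof (rule nn_integral_cong)
    fix a assume a: "a \<in> space (gaussP ?K)"
    have "(\<lambda>b. merge ?K ?J (a, b)) \<in> gaussP ?J \<rightarrow>\<^sub>M std_gauss n"
      using measurable_compose[OF measurable_Pair1'[OF a] measurable_merge[of ?K ?J]] unfolding I(1) std_gauss_def .
    from measurable_compose[OF this f]
    show "(\<integral>\<^sup>+b. \<integral>\<^sup>+v. f (merge ?K ?J (a, ?P b v)) \<partial>gaussP ?J \<partial>gaussP ?J) = (\<integral>\<^sup>+b. f (merge ?K ?J (a, b)) \<partial>gaussP ?J)"
      by (rule nn_integral_gaussP_polar[OF I(4,5)])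
  qed
  also have "\<dots> = (\<integral>\<^sup>+y. f y \<partial>std_gauss n)" by (rule fold[symmetric]) (rule f)
  finally show ?thesis .
qed

section \<open>Gaussian exponential moments\<close>

lemma nn_integral_gauss_exp_sq:
  assumes "c < 1 / 2"
  shows "(\<integral>\<^sup>+x. ennreal (exp (c * x\<^sup>2)) \<partial>gauss) = ennreal (1 / sqrt (1 - 2 * c))"
proof -
  \<comment> \<open>Rescaling by this factor makes the exponent of the weight cancel that of the
    integrand, leaving the constant \<open>a\<close>.\<close>
  define a where "a = 1 / sqrt (1 - 2 * c)"
  have a: "a > 0" "a\<^sup>2 * (1 - 2 * c) = 1" using assms by (simp_all add: a_def power_divide)
  have e: "- (a\<^sup>2 - 1) * x\<^sup>2 / 2 + c * (a * x)\<^sup>2 = 0" for x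
  proof -
    have "- (a\<^sup>2 - 1) * x\<^sup>2 / 2 + c * (a * x)\<^sup>2 = (1 - a\<^sup>2 * (1 - 2 * c)) * x\<^sup>2 / 2"
      by (simp add: power_mult_distrib field_simps)
    then show ?thesis using a by simp
  qed
  have "(\<integral>\<^sup>+x. ennreal (exp (c * x\<^sup>2)) \<partial>gauss)
     = (\<integral>\<^sup>+x. ennreal (a * exp (- (a\<^sup>2 - 1) * x\<^sup>2 / 2)) * ennreal (exp (c * (a * x)\<^sup>2)) \<partial>gauss)"
    by (rule nn_integral_gauss_scale) (use a in auto)
  also have "\<dots> = (\<integral>\<^sup>+x. ennreal a \<partial>gauss)"
  proof (rule nn_integral_cong)
    fix x
    have "ennreal (a * exp (- (a\<^sup>2 - 1) * x\<^sup>2 / 2)) * ennreal (exp (c * (a * x)\<^sup>2))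
       = ennreal (a * exp (- (a\<^sup>2 - 1) * x\<^sup>2 / 2 + c * (a * x)\<^sup>2))"
      using a by (subst ennreal_mult[symmetric]) (simp_all add: exp_add mult.assoc)
    then show "ennreal (a * exp (- (a\<^sup>2 - 1) * x\<^sup>2 / 2)) * ennreal (exp (c * (a * x)\<^sup>2)) = ennreal a"
      by (simp only: e exp_zero mult_1_right)
  qed
  also have "\<dots> = ennreal a" by simp
  finally show ?thesis by (simp add: a_def)
qed

text \<open>Translation by \<open>b\<close> completes the square.\<close>

lemma nn_integral_gauss_exp_linear:
  "(\<integral>\<^sup>+x. ennreal (exp (b * x)) \<partial>gauss) = ennreal (exp (b\<^sup>2 / 2))"
proof -
  have d: "std_normal_density (b + x) * exp (b * (b + x)) = exp (b\<^sup>2 / 2) * std_normal_density x" for x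
    by (simp add: std_normal_density_def exp_add[symmetric] power2_eq_square field_simps)
  have "(\<integral>\<^sup>+x. ennreal (exp (b * x)) \<partial>gauss) = (\<integral>\<^sup>+x. ennreal (std_normal_density x * exp (b * x)) \<partial>lborel)"
    by (simp add: nn_integral_gauss ennreal_mult)
  also have "\<dots> = (\<integral>\<^sup>+x. ennreal (std_normal_density (b + x) * exp (b * (b + x))) \<partial>lborel)"
    using nn_integral_real_affine[of "\<lambda>x. ennreal (std_normal_density x * exp (b * x))" 1 b] by simp
  also have "\<dots> = (\<integral>\<^sup>+x. ennreal (exp (b\<^sup>2 / 2)) * ennreal (std_normal_density x) \<partial>lborel)"
    unfolding d by (simp add: ennreal_mult)
  also have "\<dots> = ennreal (exp (b\<^sup>2 / 2)) * (\<integral>\<^sup>+x. 1 \<partial>gauss)"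
    by (subst nn_integral_gauss) (simp_all add: nn_integral_cmult)
  finally show ?thesis by simp
qed

lemma nn_integral_std_gauss_prod:
  assumes "\<And>i. i \<in> {1..n} \<Longrightarrow> f i \<in> borel_measurable borel"
  shows "(\<integral>\<^sup>+z. (\<Prod>i\<in>{1..n}. f i (z i)) \<partial>std_gauss n) = (\<Prod>i\<in>{1..n}. \<integral>\<^sup>+x. f i x \<partial>gauss)"
  unfolding std_gauss_def by (rule gaussP.product_nn_integral_prod) (use assms in auto)

text \<open>A block \<open>J\<close> of equal terms plus one separate coordinate \<open>j\<close> is
  the shape of the statistics in \<open>underfit_tail\<close> and \<open>aligned_tail\<close>, where
  \<open>j\<close> carries the signal direction.\<close>

lemma nn_integral_std_gauss_exp:
  assumes J: "J \<subseteq> {1..n}" and j: "j \<in> {1..n} - J"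
    and f [measurable]: "f \<in> borel_measurable borel" and g [measurable]: "g \<in> borel_measurable borel"
  shows "(\<integral>\<^sup>+z. ennreal (exp ((\<Sum>i\<in>J. f (z i)) + g (z j))) \<partial>std_gauss n) =
    (\<integral>\<^sup>+x. ennreal (exp (f x)) \<partial>gauss) ^ card J * (\<integral>\<^sup>+x. ennreal (exp (g x)) \<partial>gauss)"
proof -
  let ?h = "\<lambda>i x. if i \<in> J then ennreal (exp (f x)) else if i = j then ennreal (exp (g x)) else 1"
  have fin: "finite J" using J finite_subset by blast
  have I: "{1..n} = J \<union> insert j ({1..n} - J - {j})" using J j by auto
  have split: "(\<Prod>i\<in>{1..n}. P i) = (\<Prod>i\<in>J. P i) * (P j * (\<Prod>i\<in>{1..n} - J - {j}. P i))" for P :: "nat \<Rightarrow> ennreal"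
  proof -
    have "(\<Prod>i\<in>{1..n}. P i) = (\<Prod>i\<in>J. P i) * (\<Prod>i\<in>insert j ({1..n} - J - {j}). P i)"
      by (subst I, rule prod.union_disjoint) (use fin j J in auto)
    then show ?thesis by (subst (asm) prod.insert) auto
  qed
  have "ennreal (exp ((\<Sum>i\<in>J. f (z i)) + g (z j))) = (\<Prod>i\<in>{1..n}. ?h i (z i))" for z
  proof -
    have "(\<Prod>i\<in>J. ?h i (z i)) = ennreal (exp (\<Sum>i\<in>J. f (z i)))"
      using fin by (simp add: exp_sum prod_ennreal)
    moreover have "(\<Prod>i\<in>{1..n} - J - {j}. ?h i (z i)) = 1" by (rule prod.neutral) auto
    ultimately show ?thesis unfolding split using j by (simp add: exp_add ennreal_mult)
  qed
  then have "(\<integral>\<^sup>+z. ennreal (exp ((\<Sum>i\<in>J. f (z i)) + g (z j))) \<partial>std_gauss n) = (\<Prod>i\<in>{1..n}. \<integral>\<^sup>+x. ?h i x \<partial>gauss)"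
    by (simp only:) (rule nn_integral_std_gauss_prod, measurable)
  also have "\<dots> = (\<integral>\<^sup>+x. ennreal (exp (f x)) \<partial>gauss) ^ card J * (\<integral>\<^sup>+x. ennreal (exp (g x)) \<partial>gauss)"
  proof -
    have "(\<Prod>i\<in>{1..n} - J - {j}. \<integral>\<^sup>+x. ?h i x \<partial>gauss) = 1"
      by (rule prod.neutral) auto
    then show ?thesis unfolding split using j by simp
  qed
  finally show ?thesis .
qed

section \<open>Tail bounds for residual sums of squares\<close>

lemma measure_rot:
  assumes T: "rot n T T'" and P: "{z \<in> space (std_gauss n). P z} \<in> sets (std_gauss n)"
  shows "\<P>(u in std_gauss n. P (T u)) = \<P>(z in std_gauss n. P z)"
proof -
  have "\<P>(z in std_gauss n. P z)
      = measure (distr (std_gauss n) (std_gauss n) T) {z \<in> space (std_gauss n). P z}"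
    by (simp add: distr_rot[OF T])
  also have "\<dots> = measure (std_gauss n) (T -` {z \<in> space (std_gauss n). P z} \<inter> space (std_gauss n))"
    by (rule measure_distr[OF measurable_rot[OF T] P])
  also have "T -` {z \<in> space (std_gauss n). P z} \<inter> space (std_gauss n) = {u \<in> space (std_gauss n). P (T u)}"
    using measurable_space[OF measurable_rot[OF T]] by auto
  finally show ?thesis ..
qed

lemma measurable_std_gauss_component: "i \<in> {1..n} \<Longrightarrow> (\<lambda>x. x i) \<in> borel_measurable (std_gauss n)"
  unfolding std_gauss_def by (rule measurable_gaussP_component)

lemma exp_Markov:
  assumes [measurable]: "h \<in> borel_measurable M" and B: "(\<integral>\<^sup>+z. ennreal (exp (h z)) \<partial>M) \<le> ennreal B" "B \<ge> 0"
  shows "measure M {z \<in> space M. a \<le> h z} \<le> B * exp (- a)"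
proof -
  have "emeasure M {z \<in> space M. a \<le> h z} \<le> emeasure M ({z \<in> space M. 1 \<le> ennreal (exp (- a)) * ennreal (exp (h z))})"
    by (rule emeasure_mono) (auto simp: ennreal_mult[symmetric] exp_add[symmetric] ennreal_ge_1)
  also have "\<dots> \<le> ennreal (exp (- a)) * (\<integral>\<^sup>+z. ennreal (exp (h z)) \<partial>M)"
    using nn_integral_Markov_inequality[of "\<lambda>z. ennreal (exp (h z))" "space M" M "ennreal (exp (- a))"]
    by (simp add: Int_def conj_commute)
  also have "\<dots> \<le> ennreal (exp (- a)) * ennreal B" by (intro mult_left_mono B) simp
  also have "\<dots> = ennreal (B * exp (- a))" using B by (simp add: ennreal_mult mult.commute)
  finally show ?thesis using B by (simp add: measure_def enn2real_leI)
qed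

text \<open>The Chernoff parameter used for sums of squares that should stay small: half of the
  critical value 1/2, at the price of a factor sqrt 2 per degree of freedom.\<close>

lemma exp_quarter: "(\<integral>\<^sup>+x. ennreal (exp (x\<^sup>2 / 4)) \<partial>gauss) = ennreal (sqrt 2)"
  using nn_integral_gauss_exp_sq[of "1/4"] by (simp add: real_div_sqrt real_sqrt_divide)

lemma measurable_sum_sq [measurable]:
  "J \<subseteq> {1..n} \<Longrightarrow> (\<lambda>z. \<Sum>i\<in>J. (z i)\<^sup>2) \<in> borel_measurable (std_gauss n)"
  by (intro borel_measurable_sum borel_measurable_power measurable_std_gauss_component) auto

text \<open>The number of coordinates will be a difference of ranks, known only up to the number of
  added columns; hence the bound \<open>m\<close>.\<close>

lemma chi_square_tail:
  assumes J: "J \<subseteq> {1..n}" "card J \<le> m"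
  shows "\<P>(z in std_gauss n. x \<le> (\<Sum>i\<in>J. (z i)\<^sup>2)) \<le> sqrt 2 ^ m * exp (- x / 4)"
proof -
  have fin: "finite J" using J finite_subset by blast
  have "(\<integral>\<^sup>+z. ennreal (exp ((\<Sum>i\<in>J. (z i)\<^sup>2) / 4)) \<partial>std_gauss n)
     = (\<integral>\<^sup>+z. (\<Prod>i\<in>{1..n}. if i \<in> J then ennreal (exp ((z i)\<^sup>2 / 4)) else 1) \<partial>std_gauss n)"
  proof (rule nn_integral_cong)
    fix z
    have "(\<Prod>i\<in>{1..n}. if i \<in> J then ennreal (exp ((z i)\<^sup>2 / 4)) else 1) = (\<Prod>i\<in>J. ennreal (exp ((z i)\<^sup>2 / 4)))"
      by (rule prod.mono_neutral_cong_right) (use J in auto)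
    also have "\<dots> = ennreal (exp ((\<Sum>i\<in>J. (z i)\<^sup>2) / 4))"
      using fin by (simp add: prod_ennreal exp_sum sum_divide_distrib)
    finally show "ennreal (exp ((\<Sum>i\<in>J. (z i)\<^sup>2) / 4)) = (\<Prod>i\<in>{1..n}. if i \<in> J then ennreal (exp ((z i)\<^sup>2 / 4)) else 1)" ..
  qed
  also have "\<dots> = (\<Prod>i\<in>{1..n}. \<integral>\<^sup>+x. (if i \<in> J then ennreal (exp (x\<^sup>2 / 4)) else 1) \<partial>gauss)"
    by (rule nn_integral_std_gauss_prod) auto
  also have "\<dots> = (\<Prod>i\<in>J. ennreal (sqrt 2))"
    by (rule prod.mono_neutral_cong_right) (use J in \<open>auto simp: exp_quarter\<close>)
  also have "\<dots> = ennreal (sqrt 2 ^ card J)" by (simp add: ennreal_power)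
  also have "\<dots> \<le> ennreal (sqrt 2 ^ m)" by (intro ennreal_leI power_increasing J) simp
  finally have "\<P>(z in std_gauss n. x / 4 \<le> (\<Sum>i\<in>J. (z i)\<^sup>2) / 4) \<le> sqrt 2 ^ m * exp (- (x / 4))"
    by (intro exp_Markov borel_measurable_divide measurable_sum_sq J) auto
  then show ?thesis by simp
qed

lemma rot_observation:
  assumes T: "rot n T T'" and i: "i \<in> {1..n}"
  shows "T (\<lambda>i\<in>{1..n}. \<mu> i + \<sigma> * u i) i = T \<mu> i + \<sigma> * T u i"
proof -
  have "T (\<lambda>i\<in>{1..n}. \<mu> i + \<sigma> * u i) i = T (\<lambda>i. 1 * \<mu> i + \<sigma> * u i) i"
    by (rule rot_cong[OF T _ i]) auto
  then show ?thesis unfolding rot_linear[OF T] by simp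
qed

lemma sqdist_observation:
  assumes q: "qr n T T' k V" and \<mu>: "\<mu> \<in> V"
  shows "sqdist n V (\<lambda>i\<in>{1..n}. \<mu> i + \<sigma> * u i) = \<sigma>\<^sup>2 * sqdist n V u"
proof -
  have "(T (\<lambda>i\<in>{1..n}. \<mu> i + \<sigma> * u i) i)\<^sup>2 = \<sigma>\<^sup>2 * (T u i)\<^sup>2" if "i \<in> {k<..n}" for i
    using that rot_observation[OF qr_rot[OF q], of i \<mu> \<sigma> u] qr_zero[OF q \<mu>, of i] by (simp add: power_mult_distrib)
  then show ?thesis unfolding sqdist_qr[OF q] sum_distrib_left by simp
qed

lemma sum_tail_diff:
  fixes f :: "nat \<Rightarrow> real"
  assumes "k \<le> k'" "k' \<le> n"
  shows "(\<Sum>i\<in>{k<..n}. f i) = (\<Sum>i\<in>{k<..k'}. f i) + (\<Sum>i\<in>{k'<..n}. f i)"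
proof -
  have "{k<..n} = {k<..k'} \<union> {k'<..n}" using assms by auto
  then show ?thesis by (simp add: sum.union_disjoint ivl_disj_int)
qed

text \<open>Both spaces contain the signal, so the gain from the extra columns is \<sigma>^2 times a
  sum of at most \<open>m\<close> squared Gaussian coordinates.\<close>

lemma overfit_tail:
  assumes q: "qr n T T' k V" and \<mu>: "\<mu> \<in> V" and B: "finite B" "card B \<le> m" and \<sigma>: "\<sigma> > 0"
  shows "\<P>(u in std_gauss n.
      x \<le> sqdist n V (\<lambda>i\<in>{1..n}. \<mu> i + \<sigma> * u i) - sqdist n (adds X B V) (\<lambda>i\<in>{1..n}. \<mu> i + \<sigma> * u i))
    \<le> sqrt 2 ^ m * exp (- x / (4 * \<sigma>\<^sup>2))"
proof -
  obtain S S' k' where S: "qr n S S' k' (adds X B V)" "qr n S S' k V" "k \<le> k'" "k' \<le> k + card B"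
    using qr_adds[OF q B(1)] by blast
  have J: "{k<..k'} \<subseteq> {1..n}" "card {k<..k'} \<le> m" using qr_le[OF S(1)] S(4) B(2) by auto
  have \<mu>': "\<mu> \<in> adds X B V"
  proof -
    have "\<mu> = (\<lambda>i. (\<Sum>j\<in>B. X i j * (\<lambda>_. 0) j) + \<mu> i)" by simp
    then show ?thesis using \<mu> unfolding adds_def by (intro CollectI exI[of _ "\<lambda>_. 0"] exI[of _ \<mu>]) simp
  qed
  have "x \<le> sqdist n V (\<lambda>i\<in>{1..n}. \<mu> i + \<sigma> * u i) - sqdist n (adds X B V) (\<lambda>i\<in>{1..n}. \<mu> i + \<sigma> * u i)
      \<longleftrightarrow> x / \<sigma>\<^sup>2 \<le> (\<Sum>i\<in>{k<..k'}. (S u i)\<^sup>2)" for u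
    unfolding sqdist_observation[OF S(2) \<mu>] sqdist_observation[OF S(1) \<mu>']
    unfolding sqdist_qr[OF S(2)] sqdist_qr[OF S(1)]
      sum_tail_diff[OF S(3) qr_le[OF S(1)]]
    using \<sigma> by (simp add: algebra_simps pos_divide_le_eq)
  then have "\<P>(u in std_gauss n.
      x \<le> sqdist n V (\<lambda>i\<in>{1..n}. \<mu> i + \<sigma> * u i) - sqdist n (adds X B V) (\<lambda>i\<in>{1..n}. \<mu> i + \<sigma> * u i))
    = \<P>(u in std_gauss n. x / \<sigma>\<^sup>2 \<le> (\<Sum>i\<in>{k<..k'}. (S u i)\<^sup>2))" by simp
  also have "\<dots> = \<P>(z in std_gauss n. x / \<sigma>\<^sup>2 \<le> (\<Sum>i\<in>{k<..k'}. (z i)\<^sup>2))"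
    by (rule measure_rot[OF qr_rot[OF S(1)]]) (use measurable_sum_sq[OF J(1)] in measurable)
  also have "\<dots> \<le> sqrt 2 ^ m * exp (- (x / \<sigma>\<^sup>2) / 4)" by (rule chi_square_tail[OF J])
  finally show ?thesis by (simp add: mult.commute)
qed

text \<open>Off the larger space the signal is one direction, rotated into coordinate j with length
  \<alpha>. In the difference of the two distances the squares of the noise from j onwards cancel,
  leaving \<alpha>^2 plus 2 \<alpha> \<sigma> times the j-th noise coordinate minus \<sigma>^2 times
  a sum of at most \<open>m\<close> squares.\<close>

lemma underfit_tail:
  assumes q: "qr n T T' k V" and B: "finite B" "card B \<le> m" and \<sigma>: "\<sigma> > 0"
    and a: "sqdist n (adds X B V) \<mu> > 0"
  shows "\<P>(u in std_gauss n.
      sqdist n (adds X B V) (\<lambda>i\<in>{1..n}. \<mu> i + \<sigma> * u i) - \<sigma>\<^sup>2 * sqdist n V u \<le> L)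
    \<le> sqrt 2 ^ m * exp (- (sqdist n (adds X B V) \<mu> / 8 - L / 4) / \<sigma>\<^sup>2)"
proof -
  let ?G = "std_gauss n" and ?W = "adds X B V"
  obtain S S' k' where S: "qr n S S' k' ?W" "qr n S S' k V" "k \<le> k'" "k' \<le> k + card B"
    using qr_adds[OF q B(1)] by blast
  from qr_step[OF S(1), of \<mu>] obtain R R' k'' where
    R: "qr n R R' k'' (adj \<mu> ?W)" "qr n R R' k' ?W" and eq: "\<And>x i. i \<in> {1..k'} \<Longrightarrow> R x i = S x i"
    and k'': "k'' = k' \<and> (\<exists>v\<in>?W. \<forall>i\<in>{1..n}. v i = \<mu> i) \<or> k'' = k' + 1" by blast
  have RV: "qr n R R' k V" by (rule qr_change[OF S(2) qr_rot[OF R(1)]]) (use eq S(3) in auto)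
  note rR = qr_rot[OF R(1)]
  define j where "j = k' + 1"
  \<comment> \<open>Positive distance means that the signal is not in the span, so adjoining it
    raises the rank.\<close>
  have "k'' \<noteq> k'"
  proof
    assume "k'' = k'"
    then obtain v where v: "v \<in> ?W" "\<forall>i\<in>{1..n}. v i = \<mu> i" using k'' by auto
    have "(\<Sum>i\<in>{k'<..n}. (R \<mu> i)\<^sup>2) \<le> (\<Sum>i=1..n. (\<mu> i - v i)\<^sup>2)" by (rule qr_nearest(2)[OF R(2) v(1)])
    also have "\<dots> = 0" using v(2) by simp
    finally show False using a unfolding sqdist_qr[OF R(2)] by simp
  qed
  then have kj: "k'' = j" using k'' j_def by auto
  have jn: "j \<le> n" "k' < j" using qr_le[OF R(1)] kj j_def by auto
  have ins: "{k'<..n} = insert j {j<..n}" using jn by (auto simp: j_def)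
  obtain v0 where v0: "v0 \<in> ?W" "\<And>i. 1 \<le> i \<Longrightarrow> i \<le> n \<Longrightarrow> R v0 i = 0" using qr_onto[OF R(2), of "\<lambda>_. 0"] by auto
  have z\<mu>: "R \<mu> i = 0" if "j < i" "i \<le> n" for i
  proof -
    have "R (\<lambda>i. 1 * \<mu> i + v0 i) i = 0"
      using qr_zero[OF R(1) adjI[OF v0(1)], of i 1] that kj by auto
    then show ?thesis using rot_linear[OF rR, of 1 \<mu> 1 v0] v0(2)[of i] that by simp
  qed
  define \<alpha> where "\<alpha> = R \<mu> j"
  have a2: "sqdist n ?W \<mu> = \<alpha>\<^sup>2"
    unfolding sqdist_qr[OF R(2)] ins using z\<mu> by (simp add: \<alpha>_def)
  have J: "{k<..k'} \<subseteq> {1..n}" "card {k<..k'} \<le> m" "j \<in> {1..n} - {k<..k'}"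
    using jn S(4) B(2) by auto
  \<comment> \<open>The negated random part of the difference, divided by 4 \<sigma>^2. Its linear
    term has moment exp (\<alpha>^2 / (8 \<sigma>^2)), which halves the deterministic gain
    \<alpha>^2 / (4 \<sigma>^2): this is the 1/8 in the conclusion.\<close>
  define h where "h z = (\<Sum>i\<in>{k<..k'}. (z i)\<^sup>2 / 4) + (- (\<alpha> / (2 * \<sigma>))) * z j" for z :: "nat \<Rightarrow> real"
  have hm [measurable]: "h \<in> borel_measurable ?G"
    unfolding h_def using J(1,3)
    by (intro borel_measurable_add borel_measurable_sum borel_measurable_divide borel_measurable_power
        borel_measurable_times borel_measurable_const measurable_std_gauss_component) auto
  have key: "(\<alpha>\<^sup>2 - L) / (4 * \<sigma>\<^sup>2) \<le> h (R u)"
    if "sqdist n ?W (\<lambda>i\<in>{1..n}. \<mu> i + \<sigma> * u i) - \<sigma>\<^sup>2 * sqdist n V u \<le> L" for u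
  proof -
    let ?y = "\<lambda>i\<in>{1..n}. \<mu> i + \<sigma> * u i"
    have y: "R ?y i = R \<mu> i + \<sigma> * R u i" if "i \<in> {1..n}" for i by (rule rot_observation[OF rR that])
    have "sqdist n ?W ?y = (\<alpha> + \<sigma> * R u j)\<^sup>2 + \<sigma>\<^sup>2 * (\<Sum>i\<in>{j<..n}. (R u i)\<^sup>2)"
      unfolding sqdist_qr[OF R(2)] ins using z\<mu> y jn
      by (simp add: \<alpha>_def sum_distrib_left power_mult_distrib)
    moreover have "\<sigma>\<^sup>2 * sqdist n V u = \<sigma>\<^sup>2 * (\<Sum>i\<in>{k<..k'}. (R u i)\<^sup>2) + \<sigma>\<^sup>2 * (R u j)\<^sup>2 + \<sigma>\<^sup>2 * (\<Sum>i\<in>{j<..n}. (R u i)\<^sup>2)"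
      unfolding sqdist_qr[OF RV] sum_tail_diff[OF S(3) qr_le[OF R(2)]] ins by (simp add: ring_distribs)
    ultimately have "\<alpha>\<^sup>2 - L \<le> \<sigma>\<^sup>2 * (\<Sum>i\<in>{k<..k'}. (R u i)\<^sup>2) - 2 * \<alpha> * \<sigma> * R u j"
      using that by (simp add: power2_sum power_mult_distrib)
    also have "\<dots> = 4 * \<sigma>\<^sup>2 * h (R u)"
      using \<sigma> by (simp add: h_def sum_divide_distrib[symmetric] field_simps power2_eq_square)
    finally show ?thesis using \<sigma> by (simp add: divide_le_eq mult.commute)
  qed
  have "measure ?G {u \<in> space ?G. sqdist n ?W (\<lambda>i\<in>{1..n}. \<mu> i + \<sigma> * u i) - \<sigma>\<^sup>2 * sqdist n V u \<le> L}
      \<le> measure ?G {u \<in> space ?G. (\<alpha>\<^sup>2 - L) / (4 * \<sigma>\<^sup>2) \<le> h (R u)}"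
  proof (rule finite_measure.finite_measure_mono)
    show "finite_measure ?G" using prob_space_std_gauss[of n] by (simp add: prob_space_def)
    show "{u \<in> space ?G. (\<alpha>\<^sup>2 - L) / (4 * \<sigma>\<^sup>2) \<le> h (R u)} \<in> sets ?G"
      using measurable_compose[OF measurable_rot[OF rR] hm] by measurable
  qed (use key in auto)
  also have "\<dots> = measure ?G {z \<in> space ?G. (\<alpha>\<^sup>2 - L) / (4 * \<sigma>\<^sup>2) \<le> h z}"
    by (rule measure_rot[OF rR]) measurable
  also have "\<dots> \<le> (sqrt 2 ^ m * exp (\<alpha>\<^sup>2 / (8 * \<sigma>\<^sup>2))) * exp (- ((\<alpha>\<^sup>2 - L) / (4 * \<sigma>\<^sup>2)))"
  proof (rule exp_Markov[OF hm])
    have "(\<integral>\<^sup>+z. ennreal (exp (h z)) \<partial>?G)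
      = ennreal (sqrt 2) ^ card {k<..k'} * ennreal (exp ((- (\<alpha> / (2 * \<sigma>)))\<^sup>2 / 2))"
      unfolding h_def
      by (subst nn_integral_std_gauss_exp[OF J(1,3), where f="\<lambda>x. x\<^sup>2 / 4" and g="\<lambda>x. - (\<alpha> / (2 * \<sigma>)) * x"])
        (simp_all only: exp_quarter nn_integral_gauss_exp_linear, auto)
    also have "\<dots> = ennreal (sqrt 2 ^ card {k<..k'} * exp (\<alpha>\<^sup>2 / (8 * \<sigma>\<^sup>2)))"
      by (simp add: ennreal_power ennreal_mult power_divide power_mult_distrib)
    also have "\<dots> \<le> ennreal (sqrt 2 ^ m * exp (\<alpha>\<^sup>2 / (8 * \<sigma>\<^sup>2)))"
      using J(2) by (intro ennreal_leI mult_right_mono power_increasing) auto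
    finally show "(\<integral>\<^sup>+z. ennreal (exp (h z)) \<partial>?G) \<le> ennreal (sqrt 2 ^ m * exp (\<alpha>\<^sup>2 / (8 * \<sigma>\<^sup>2)))" .
  qed simp
  also have "\<dots> = sqrt 2 ^ m * exp (- (\<alpha>\<^sup>2 / 8 - L / 4) / \<sigma>\<^sup>2)"
    using \<sigma> by (simp add: exp_add[symmetric] mult.assoc field_simps)
  finally show ?thesis unfolding a2 .
qed

text \<open>Off \<open>V\<close> the signal occupies one coordinate j, and adjoining
  \<open>w\<close> removes the fraction P / (P + Q) of it, where P is the square of the j-th rotated
  coordinate of \<open>w\<close> and Q the sum of the squares after it. Removing more than 4/5 means
  P > 4 Q, which is unlikely because Q has n - k - 1 terms. The bound uses \<open>s\<close> so that
  it is uniform over models of different rank.\<close>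

lemma aligned_tail:
  assumes q: "qr n T T' k V" and s: "k \<le> s" "s < n"
  shows "\<P>(w in std_gauss n. sqdist n (adj w V) \<mu> < 0.2 * sqdist n V \<mu>)
    \<le> sqrt 2 * (1 / sqrt 3) ^ (n - s - 1)"
proof -
  let ?G = "std_gauss n"
  from qr_step[OF q, of \<mu>] obtain R R' k' where
    R: "qr n R R' k' (adj \<mu> V)" "qr n R R' k V"
    and k': "k' = k \<and> (\<exists>v\<in>V. \<forall>i\<in>{1..n}. v i = \<mu> i) \<or> k' = k + 1" by blast
  note rR = qr_rot[OF R(1)]
  obtain v0 where v0: "v0 \<in> V" "\<And>i. 1 \<le> i \<Longrightarrow> i \<le> n \<Longrightarrow> R v0 i = 0" using qr_onto[OF R(2), of "\<lambda>_. 0"] by auto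
  define j where "j = k + 1"
  have jn: "j \<le> n" "k < j" using s by (auto simp: j_def)
  have ins: "{k<..n} = insert j {j<..n}" using jn by (auto simp: j_def)
  have z\<mu>: "R \<mu> i = 0" if "j < i" "i \<le> n" for i
  proof -
    have "R (\<lambda>i. 1 * \<mu> i + v0 i) i = 0"
      using qr_zero[OF R(1) adjI[OF v0(1)], of i 1] that k' j_def by auto
    then show ?thesis using rot_linear[OF rR, of 1 \<mu> 1 v0] v0(2)[of i] that by simp
  qed
  define \<alpha> where "\<alpha> = R \<mu> j"
  have a2: "sqdist n V \<mu> = \<alpha>\<^sup>2"
    unfolding sqdist_qr[OF R(2)] ins using z\<mu> by (simp add: \<alpha>_def)
  have au: "sqdist n (adj w V) \<mu> = \<alpha>\<^sup>2 - (\<alpha> * R w j)\<^sup>2 / ((R w j)\<^sup>2 + (\<Sum>i\<in>{j<..n}. (R w i)\<^sup>2))" for w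
    unfolding sqdist_adj[OF R(2)] ins using z\<mu> by (simp add: \<alpha>_def)
  \<comment> \<open>P / 4 - Q. Its exponential moment is sqrt 2 from P / 4 times 1 / sqrt 3 for each
    term of Q.\<close>
  define h where "h z = (\<Sum>i\<in>{j<..n}. - (z i)\<^sup>2) + (z j)\<^sup>2 / 4" for z :: "nat \<Rightarrow> real"
  have J: "{j<..n} \<subseteq> {1..n}" "j \<in> {1..n} - {j<..n}" using jn by auto
  have hm [measurable]: "h \<in> borel_measurable ?G"
    unfolding h_def using J
    by (intro borel_measurable_add borel_measurable_sum borel_measurable_divide borel_measurable_power
        borel_measurable_uminus borel_measurable_const measurable_std_gauss_component) auto
  have key: "0 \<le> h (R w)" if w: "sqdist n (adj w V) \<mu> < 0.2 * sqdist n V \<mu>" for w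
  proof (rule ccontr)
    assume "\<not> 0 \<le> h (R w)"
    define P Q where "P = (R w j)\<^sup>2" and "Q = (\<Sum>i\<in>{j<..n}. (R w i)\<^sup>2)"
    have PQ: "0 \<le> P" "P < 4 * Q" using \<open>\<not> 0 \<le> h (R w)\<close> by (simp_all add: h_def P_def Q_def sum_negf)
    have "P / (P + Q) \<le> 0.8" using PQ by (simp add: divide_le_eq)
    then have "\<alpha>\<^sup>2 * (P / (P + Q)) \<le> \<alpha>\<^sup>2 * 0.8" by (intro mult_left_mono) auto
    moreover have "\<alpha>\<^sup>2 - \<alpha>\<^sup>2 * P / (P + Q) < 0.2 * \<alpha>\<^sup>2"
      using w unfolding au a2 by (simp add: power_mult_distrib P_def Q_def)
    ultimately show False by simp
  qed
  have "measure ?G {w \<in> space ?G. sqdist n (adj w V) \<mu> < 0.2 * sqdist n V \<mu>} \<le> measure ?G {w \<in> space ?G. 0 \<le> h (R w)}"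
  proof (rule finite_measure.finite_measure_mono)
    show "finite_measure ?G" using prob_space_std_gauss[of n] by (simp add: prob_space_def)
    show "{w \<in> space ?G. 0 \<le> h (R w)} \<in> sets ?G"
      using measurable_compose[OF measurable_rot[OF rR] hm] by measurable
  qed (use key in auto)
  also have "\<dots> = measure ?G {z \<in> space ?G. 0 \<le> h z}"
    by (rule measure_rot[OF rR]) measurable
  also have "\<dots> \<le> (1 / sqrt 3) ^ card {j<..n} * sqrt 2 * exp (- 0)"
  proof (rule exp_Markov[OF hm])
    have "(\<integral>\<^sup>+x. ennreal (exp (- x\<^sup>2)) \<partial>gauss) = ennreal (1 / sqrt 3)"
      using nn_integral_gauss_exp_sq[of "-1"] by simp
    then show "(\<integral>\<^sup>+z. ennreal (exp (h z)) \<partial>?G) \<le> ennreal ((1 / sqrt 3) ^ card {j<..n} * sqrt 2)"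
      unfolding h_def
      by (subst nn_integral_std_gauss_exp[OF J, where f="\<lambda>x. - x\<^sup>2" and g="\<lambda>x. x\<^sup>2 / 4"])
        (simp_all add: exp_quarter ennreal_power[symmetric] ennreal_mult)
  qed simp
  also have "\<dots> \<le> sqrt 2 * (1 / sqrt 3) ^ (n - s - 1)"
  proof -
    have "(1 / sqrt 3) ^ card {j<..n} \<le> (1 / sqrt 3 :: real) ^ (n - s - 1)"
      using s by (intro power_decreasing) (auto simp: j_def)
    then show ?thesis by (simp add: mult.commute)
  qed
  finally show ?thesis .
qed

section \<open>Selection of the true model\<close>

lemma qr_adj_sp: "finite \<tau> \<Longrightarrow> \<exists>T T' k. qr n T T' k (adj u (sp X \<tau>))"
  using qr_sp[of \<tau> n X] qr_step by blast

lemma L2_set_sq: "(L2_set f A)\<^sup>2 = (\<Sum>i\<in>A. (f i)\<^sup>2)"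
  by (simp add: L2_set_def sum_nonneg)

lemma INF_coeffs_noise:
  assumes \<tau>: "finite \<tau>"
  shows "(INF (\<beta>, \<sigma>)\<in>coeffs_of \<tau> \<times> (UNIV :: real set).
      (L2_set (\<lambda>i. y i - fit n X \<tau> \<beta> i - \<sigma> * ub i) {1..n})\<^sup>2 + c) = sqdist n (adj ub (sp X \<tau>)) y + c"
proof -
  obtain T T' k where q: "qr n T T' k (adj ub (sp X \<tau>))" using qr_adj_sp[OF \<tau>] by blast
  let ?f = "\<lambda>v. (\<Sum>i=1..n. (y i - v i)\<^sup>2) + c"
  let ?v = "\<lambda>\<beta> \<sigma> i. \<sigma> * ub i + (\<Sum>j\<in>\<tau>. X i j * \<beta> j)"
  have eq: "(L2_set (\<lambda>i. y i - fit n X \<tau> \<beta> i - \<sigma> * ub i) {1..n})\<^sup>2 + c = ?f (?v \<beta> \<sigma>)" for \<beta> \<sigma>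
    unfolding L2_set_sq fit_def by (simp add: algebra_simps)
  have "(\<lambda>(\<beta>, \<sigma>). (L2_set (\<lambda>i. y i - fit n X \<tau> \<beta> i - \<sigma> * ub i) {1..n})\<^sup>2 + c) ` (coeffs_of \<tau> \<times> UNIV)
      = ?f ` adj ub (sp X \<tau>)" (is "?L = ?R")
  proof (intro equalityI subsetI)
    fix x assume "x \<in> ?L"
    then obtain \<beta> \<sigma> where "x = ?f (?v \<beta> \<sigma>)" unfolding eq by auto
    moreover have "?v \<beta> \<sigma> \<in> adj ub (sp X \<tau>)" by (rule adjI) (simp add: sp_eq)
    ultimately show "x \<in> ?R" by (rule image_eqI)
  next
    fix x assume "x \<in> ?R"
    then obtain \<sigma> \<beta> where x: "x = ?f (?v \<beta> \<sigma>)" unfolding adj_def sp_eq by auto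
    have "?v \<beta> \<sigma> = ?v (restrict \<beta> \<tau>) \<sigma>" by simp
    with x have "x = ?f (?v (restrict \<beta> \<tau>) \<sigma>)" by simp
    moreover have "restrict \<beta> \<tau> \<in> coeffs_of \<tau>" by (simp add: coeffs_of_def)
    ultimately show "x \<in> ?L" unfolding eq by (intro image_eqI[of _ _ "(restrict \<beta> \<tau>, \<sigma>)"]) auto
  qed
  then show ?thesis using qr_INF[OF q, of y c] sqdist_qr[OF q, of y] by simp
qed

lemma INF_coeffs:
  assumes \<tau>: "finite \<tau>"
  shows "(INF \<beta>\<in>coeffs_of \<tau>. (L2_set (\<lambda>i. y i - fit n X \<tau> \<beta> i) {1..n})\<^sup>2) = sqdist n (sp X \<tau>) y"
proof -
  let ?f = "\<lambda>v. (\<Sum>i=1..n. (y i - v i)\<^sup>2)"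
  let ?v = "\<lambda>\<beta> i. (\<Sum>j\<in>\<tau>. X i j * \<beta> j)"
  have eq: "(L2_set (\<lambda>i. y i - fit n X \<tau> \<beta> i) {1..n})\<^sup>2 = ?f (?v \<beta>)" for \<beta>
    unfolding L2_set_sq fit_def by simp
  have "(\<lambda>\<beta>. (L2_set (\<lambda>i. y i - fit n X \<tau> \<beta> i) {1..n})\<^sup>2) ` coeffs_of \<tau> = ?f ` sp X \<tau>"  (is "?L = ?R")
  proof (intro equalityI subsetI)
    fix x assume "x \<in> ?R"
    then obtain \<beta> where "x = ?f (?v \<beta>)" unfolding sp_eq by auto
    then have "x = ?f (?v (restrict \<beta> \<tau>))" by simp
    moreover have "restrict \<beta> \<tau> \<in> coeffs_of \<tau>" by (simp add: coeffs_of_def)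
    ultimately show "x \<in> ?L" unfolding eq by blast
  qed (auto simp: eq sp_eq)
  then show ?thesis by (simp add: sqdist_def)
qed

abbreviation signal :: "(nat \<Rightarrow> nat \<Rightarrow> real) \<Rightarrow> nat set \<Rightarrow> (nat \<Rightarrow> real) \<Rightarrow> nat \<Rightarrow> real" where
  "signal X \<tau> \<beta> \<equiv> (\<lambda>i. \<Sum>j\<in>\<tau>. X i j * \<beta> j)"

lemma observation_eq: "observation n X \<tau> \<beta> \<sigma> u = (\<lambda>i\<in>{1..n}. signal X \<tau> \<beta> i + \<sigma> * u i)"
  by (auto simp: observation_def fit_def)

lemma measurable_observation [measurable]: "observation n X \<tau> \<beta> \<sigma> \<in> std_gauss n \<rightarrow>\<^sub>M std_gauss n"
  unfolding observation_eq std_gauss_def by (rule measurable_into_gaussP) measurable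

section \<open>Measurability of distances\<close>

lemma measurable_sqdist:
  assumes q: "qr n T T' k V"
  shows "sqdist n V \<in> borel_measurable (std_gauss n)"
proof -
  have "(\<lambda>y. \<Sum>i\<in>{k<..n}. (T y i)\<^sup>2) \<in> borel_measurable (std_gauss n)"
    by (rule measurable_compose[OF measurable_rot[OF qr_rot[OF q]] measurable_sum_sq]) auto
  moreover have "sqdist n V = (\<lambda>y. \<Sum>i\<in>{k<..n}. (T y i)\<^sup>2)" by (rule ext) (rule sqdist_qr[OF q])
  ultimately show ?thesis by simp
qed

lemma measurable_sqdist_sp [measurable]: "finite \<tau> \<Longrightarrow> sqdist n (sp X \<tau>) \<in> borel_measurable (std_gauss n)"
  using qr_sp[of \<tau> n X] measurable_sqdist by blast

text \<open>A rotation adapted to \<open>adj u (sp X \<tau>)\<close> would depend on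
  \<open>u\<close>. The explicit formula \<open>sqdist_adj\<close> uses a rotation for
  \<open>sp X \<tau>\<close> alone, which makes joint measurability visible.\<close>

lemma measurable_sqdist_adj [measurable]:
  assumes "finite \<tau>"
  shows "(\<lambda>(y, u). sqdist n (adj u (sp X \<tau>)) y) \<in> borel_measurable (std_gauss n \<Otimes>\<^sub>M std_gauss n)"
proof -
  obtain T T' k where q: "qr n T T' k (sp X \<tau>)" using qr_sp[OF assms] by blast
  note m = measurable_compose[OF measurable_compose[OF _ measurable_rot[OF qr_rot[OF q]]] measurable_std_gauss_component]
  show ?thesis
    unfolding sqdist_adj[OF q] split_def
    by (intro borel_measurable_diff borel_measurable_divide borel_measurable_power borel_measurable_sum
        borel_measurable_times m) auto
qed

lemma measurable_sqdist_adj_right: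
  assumes "finite \<tau>"
  shows "(\<lambda>w. sqdist n (adj w (sp X \<tau>)) y) \<in> borel_measurable (std_gauss n)"
proof -
  obtain T T' k where q: "qr n T T' k (sp X \<tau>)" using qr_sp[OF assms] by blast
  note m = measurable_compose[OF measurable_rot[OF qr_rot[OF q]] measurable_std_gauss_component]
  show ?thesis
    unfolding sqdist_adj[OF q]
    by (intro borel_measurable_diff borel_measurable_divide borel_measurable_power borel_measurable_sum
        borel_measurable_times borel_measurable_const m) auto
qed

section \<open>Counting models\<close>

lemma sum_power_card_Pow:
  fixes q :: real
  assumes "finite A"
  shows "(\<Sum>B\<in>Pow A. q ^ card B) = (1 + q) ^ card A"
  using prod_add[OF assms, of "\<lambda>_. q" "\<lambda>_. 1"] by (simp add: add.commute)

lemma one_plus_power_le_exp: "0 \<le> (q::real) \<Longrightarrow> (1 + q) ^ m \<le> exp (real m * q)"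
  using power_mono[of "1 + q" "exp q" m] exp_ge_add_one_self[of q] by (simp add: exp_of_nat_mult)

lemma card_small_subsets:
  assumes "finite A" "card A \<ge> 1"
  shows "real (card {\<tau>. \<tau> \<subseteq> A \<and> card \<tau> \<le> s}) \<le> 3 * real (card A) ^ s"
proof -
  let ?p = "real (card A)"
  have p: "?p \<ge> 1" using assms by simp
  have "real (card {\<tau>. \<tau> \<subseteq> A \<and> card \<tau> \<le> s}) = (\<Sum>\<tau> | \<tau> \<subseteq> A \<and> card \<tau> \<le> s. 1)" by simp
  \<comment> \<open>Each counted set has weight p^(s - card \<tau>) \<ge> 1, and over all subsets
    the weights sum to p^s (1 + 1/p)^p, at most e p^s.\<close>
  also have "\<dots> \<le> (\<Sum>\<tau> | \<tau> \<subseteq> A \<and> card \<tau> \<le> s. ?p ^ s * (1 / ?p) ^ card \<tau>)"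
  proof (rule sum_mono)
    fix \<tau> assume "\<tau> \<in> {\<tau>. \<tau> \<subseteq> A \<and> card \<tau> \<le> s}"
    then have "?p ^ s * (1 / ?p) ^ card \<tau> = ?p ^ (s - card \<tau>)" using p by (simp add: power_diff power_one_over field_simps)
    then show "1 \<le> ?p ^ s * (1 / ?p) ^ card \<tau>" using p by (simp add: one_le_power)
  qed
  also have "\<dots> \<le> (\<Sum>\<tau>\<in>Pow A. ?p ^ s * (1 / ?p) ^ card \<tau>)"
    by (rule sum_mono2) (use assms in auto)
  also have "\<dots> = ?p ^ s * (1 + 1 / ?p) ^ card A"
    by (simp add: sum_distrib_left[symmetric] sum_power_card_Pow[OF assms(1)])
  also have "\<dots> \<le> ?p ^ s * exp (?p * (1 / ?p))"
    by (intro mult_left_mono one_plus_power_le_exp) auto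
  also have "\<dots> \<le> ?p ^ s * 3" using p exp_le by (intro mult_left_mono) auto
  finally show ?thesis by simp
qed

lemma is_arg_min_cong: "(\<And>x. P x \<Longrightarrow> f x = g x) \<Longrightarrow> is_arg_min f P x = is_arg_min g P x"
  unfolding is_arg_min_def by auto

text \<open>The hypotheses at a single sample size, cleared of denominators, with \<open>C\<close>
  in the role of \<open>C_min\<close>. Models larger than \<open>\<tau>0\<close> exist only for p
  \<ge> 2, where ln (p / 2) is nonnegative; hence the condition in \<open>lam_lower\<close>.
  \<open>C_t\<close> is the consequence of the range of \<open>lam\<close> that provides the
  exponential rate against wrong models of size at most card \<open>\<tau>0\<close>.\<close>

locale regression =
  fixes n p :: nat and X :: "nat \<Rightarrow> nat \<Rightarrow> real" and \<tau>0 :: "nat set" and \<beta>0 :: "nat \<Rightarrow> real"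
    and \<sigma> lam t C :: real and tie :: "nat set set \<Rightarrow> nat set"
  assumes n: "n \<ge> 1" and \<tau>0: "\<tau>0 \<subseteq> {1..p}" "\<tau>0 \<noteq> {}" and \<sigma>: "\<sigma> > 0" and t: "t > 0" and tie: "tie_rule tie"
    and C: "\<And>\<tau>. \<tau> \<subseteq> {1..p} \<Longrightarrow> \<tau> \<noteq> \<tau>0 \<Longrightarrow> card \<tau> \<le> card \<tau>0 \<Longrightarrow>
      C * (real n * real (max (card (\<tau>0 - \<tau>)) 1)) \<le> sqdist n (sp X \<tau>) (signal X \<tau>0 \<beta>0)"
    and lam_lower: "p \<ge> 2 \<Longrightarrow> 6 * \<sigma>\<^sup>2 * ((real (card \<tau>0) + 1) * ln (real p / 2)) + real n * t \<le> lam"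
    and lam_upper: "lam \<le> 0.05 * C * real n"
    and lam_pos: "lam > 0"
    and C_t: "10 * t \<le> C"
    and C_signal: "120 * ((real (card \<tau>0) + 2) * ln (real p + 1)) * \<sigma>\<^sup>2 \<le> C * real n"
begin

abbreviation "G \<equiv> std_gauss n"
abbreviation "\<mu> \<equiv> signal X \<tau>0 \<beta>0"
abbreviation "obs \<equiv> observation n X \<tau>0 \<beta>0 \<sigma>"

sublocale G: prob_space G by (rule prob_space_std_gauss)

lemma fin_sub: "\<tau> \<subseteq> {1..p} \<Longrightarrow> finite \<tau>"
  using finite_subset by blast

lemma fin\<tau>0: "finite \<tau>0" using \<tau>0 fin_sub by blast

lemma card_\<tau>0: "card \<tau>0 \<ge> 1" using \<tau>0 fin\<tau>0 card_gt_0_iff[of \<tau>0] by linarith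

lemma p_pos: "p \<ge> 1" using \<tau>0 by (cases p) auto

text \<open>The restriction to models no larger than \<open>\<tau>0\<close> keeps the union bound
  affordable; larger models are excluded by the penalty for every \<open>w\<close>.\<close>

definition good :: "(nat \<Rightarrow> real) \<Rightarrow> bool" where
  "good w \<longleftrightarrow> (\<forall>\<tau>. \<tau> \<subseteq> {1..p} \<and> card \<tau> \<le> card \<tau>0 \<longrightarrow> 0.2 * sqdist n (sp X \<tau>) \<mu> \<le> sqdist n (adj w (sp X \<tau>)) \<mu>)"

abbreviation crit :: "(nat \<Rightarrow> real) \<Rightarrow> nat set \<Rightarrow> (nat \<Rightarrow> real) \<Rightarrow> real" where
  "crit w \<tau> y \<equiv> sqdist n (adj w (sp X \<tau>)) y + lam * real (card \<tau>)"

lemma tau_hat_eq: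
  "tau_hat n p X lam tie w y = tie {\<tau>. is_arg_min (\<lambda>\<tau>. crit w \<tau> y) (\<lambda>\<tau>. \<tau> \<subseteq> {1..p}) \<tau>}"
  unfolding tau_hat_def
  by (rule arg_cong[where f=tie], rule Collect_cong, rule is_arg_min_cong)
    (rule INF_coeffs_noise[OF fin_sub])

lemma tau_hat_unique:
  assumes "\<And>\<tau>. \<tau> \<subseteq> {1..p} \<Longrightarrow> \<tau> \<noteq> \<tau>0 \<Longrightarrow> crit w \<tau>0 y < crit w \<tau> y"
  shows "tau_hat n p X lam tie w y = \<tau>0"
proof -
  have "{\<tau>. is_arg_min (\<lambda>\<tau>. crit w \<tau> y) (\<lambda>\<tau>. \<tau> \<subseteq> {1..p}) \<tau>} = {\<tau>0}"
    unfolding is_arg_min_def using assms \<tau>0(1) by (auto, metis less_asym less_irrefl)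
  then show ?thesis unfolding tau_hat_eq using tie by (auto simp: tie_rule_def)
qed

lemma \<mu>_mem: "\<mu> \<in> sp X \<tau>0" by (auto simp: sp_eq)

text \<open>A larger model fits no better than its union with \<open>\<tau>0\<close>, which is
  nested and determined by the added columns. The events are therefore indexed by \<open>B\<close>
  and not by the model.\<close>

definition overfit_event :: "(nat \<Rightarrow> real) \<Rightarrow> nat set \<Rightarrow> (nat \<Rightarrow> real) set" where
  "overfit_event w B = {u \<in> space G. 6 * \<sigma>\<^sup>2 * (real (card B) * ln (real p / 2)) + real n * t
      \<le> sqdist n (adj w (sp X \<tau>0)) (obs u) - sqdist n (adds X B (adj w (sp X \<tau>0))) (obs u)}"

text \<open>\<sigma>^2 times the noise distance to the intersection bounds the residual of
  \<open>\<tau>0\<close> from above. With it as reference the two spaces are nested, differing only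
  by the columns in \<tau> - \<open>\<tau>0\<close>.\<close>

definition underfit_event :: "(nat \<Rightarrow> real) \<Rightarrow> nat set \<Rightarrow> (nat \<Rightarrow> real) set" where
  "underfit_event w \<tau> = {u \<in> space G. sqdist n (adj w (sp X \<tau>)) (obs u)
      - \<sigma>\<^sup>2 * sqdist n (adj w (sp X (\<tau> \<inter> \<tau>0))) u \<le> lam * real (card (\<tau>0 - \<tau>))}"

lemma tau_hat_miss:
  assumes u: "u \<in> space G" and miss: "tau_hat n p X lam tie w (obs u) \<noteq> \<tau>0"
  shows "p \<ge> 2 \<and> (\<exists>B\<in>Pow {1..p}. u \<in> overfit_event w B) \<or>
    (\<exists>\<tau>. \<tau> \<subseteq> {1..p} \<and> \<tau> \<noteq> \<tau>0 \<and> card \<tau> \<le> card \<tau>0 \<and> u \<in> underfit_event w \<tau>)"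
proof -
  obtain \<tau> where \<tau>: "\<tau> \<subseteq> {1..p}" "\<tau> \<noteq> \<tau>0" and le: "crit w \<tau> (obs u) \<le> crit w \<tau>0 (obs u)"
    using tau_hat_unique miss by (meson not_le)
  note fin = fin_sub[OF \<tau>(1)]
  let ?D = "\<lambda>\<tau>. sqdist n (adj w (sp X \<tau>)) (obs u)"
  have cards: "card \<tau> = card (\<tau> \<inter> \<tau>0) + card (\<tau> - \<tau>0)" "card \<tau>0 = card (\<tau> \<inter> \<tau>0) + card (\<tau>0 - \<tau>)"
    using card_Int_Diff[OF fin, of \<tau>0] card_Int_Diff[OF fin\<tau>0, of \<tau>] by (simp_all add: Int_commute)
  show ?thesis
  proof (cases "card \<tau> \<le> card \<tau>0")
    case True
    obtain T T' k where q: "qr n T T' k (adj w (sp X \<tau>0))" using qr_adj_sp[OF fin\<tau>0] by blast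
    have "?D \<tau>0 = \<sigma>\<^sup>2 * sqdist n (adj w (sp X \<tau>0)) u"
      unfolding observation_eq by (rule sqdist_observation[OF q]) (use subset_adj \<mu>_mem in blast)
    also have "\<dots> \<le> \<sigma>\<^sup>2 * sqdist n (adj w (sp X (\<tau> \<inter> \<tau>0))) u"
      by (intro mult_left_mono sqdist_mono adj_mono sp_mono adj_nonempty sp_nonempty fin\<tau>0) auto
    finally have "?D \<tau> - \<sigma>\<^sup>2 * sqdist n (adj w (sp X (\<tau> \<inter> \<tau>0))) u \<le> lam * (real (card \<tau>0) - real (card \<tau>))"
      using le by (simp add: algebra_simps)
    also have "\<dots> \<le> lam * real (card (\<tau>0 - \<tau>))" using cards lam_pos by (intro mult_left_mono) auto
    finally show ?thesis using \<tau> True u by (auto simp: underfit_event_def)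
  next
    case False
    let ?B = "\<tau> - \<tau>0"
    have "card \<tau> \<le> p" using card_mono[OF _ \<tau>(1)] by simp
    then have p2: "p \<ge> 2" using False card_\<tau>0 by linarith
    have k1: "1 \<le> real (card \<tau>) - real (card \<tau>0)" using False by linarith
    \<comment> \<open>This is where the factor card \<open>\<tau>0\<close> + 1 in the lower bound
      for \<open>lam\<close> is spent: the penalty only sees the difference of sizes, while up to
      card \<open>\<tau>0\<close> further columns may have been exchanged.\<close>
    have kB: "real (card ?B) \<le> (real (card \<tau>0) + 1) * (real (card \<tau>) - real (card \<tau>0))"
    proof -
      have "real (card ?B) \<le> real (card \<tau>0) * 1 + (real (card \<tau>) - real (card \<tau>0))" using cards by simp
      also have "\<dots> \<le> real (card \<tau>0) * (real (card \<tau>) - real (card \<tau>0)) + (real (card \<tau>) - real (card \<tau>0))"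
        using k1 by (intro add_right_mono mult_left_mono) auto
      finally show ?thesis by (simp add: algebra_simps)
    qed
    have eq: "adds X ?B (adj w (sp X \<tau>0)) = adj w (sp X (\<tau> \<union> \<tau>0))"
    proof -
      have "adds X ?B (sp X \<tau>0) = sp X (?B \<union> \<tau>0)" unfolding sp_def by (rule adds_Un) (use fin fin\<tau>0 in auto)
      then show ?thesis using fin by (simp add: adds_adj)
    qed
    have "6 * \<sigma>\<^sup>2 * (real (card ?B) * ln (real p / 2)) + real n * t
      \<le> 6 * \<sigma>\<^sup>2 * ((real (card \<tau>0) + 1) * (real (card \<tau>) - real (card \<tau>0)) * ln (real p / 2))
        + real n * t * (real (card \<tau>) - real (card \<tau>0))"
      using kB k1 p2 t n by (intro add_mono mult_left_mono mult_right_mono) auto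
    also have "\<dots> = (6 * \<sigma>\<^sup>2 * ((real (card \<tau>0) + 1) * ln (real p / 2)) + real n * t) * (real (card \<tau>) - real (card \<tau>0))"
      by (simp add: algebra_simps)
    also have "\<dots> \<le> lam * (real (card \<tau>) - real (card \<tau>0))"
      using k1 by (intro mult_right_mono lam_lower p2) auto
    also have "\<dots> \<le> ?D \<tau>0 - ?D \<tau>" using le by (simp add: algebra_simps)
    also have "\<dots> \<le> ?D \<tau>0 - sqdist n (adds X ?B (adj w (sp X \<tau>0))) (obs u)"
      unfolding eq by (intro diff_left_mono sqdist_mono adj_mono sp_mono adj_nonempty sp_nonempty) (use fin fin\<tau>0 in auto)
    finally have "u \<in> overfit_event w ?B" using u by (simp add: overfit_event_def)
    then show ?thesis using p2 \<tau>(1) by blast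
  qed
qed

lemma sets_overfit_event: "B \<in> Pow {1..p} \<Longrightarrow> overfit_event w B \<in> sets G"
proof -
  assume "B \<in> Pow {1..p}"
  then have B: "finite B" using fin_sub by auto
  obtain T T' k where q: "qr n T T' k (adj w (sp X \<tau>0))" using qr_adj_sp[OF fin\<tau>0] by blast
  obtain S S' k' where S: "qr n S S' k' (adds X B (adj w (sp X \<tau>0)))" using qr_adds[OF q B] by blast
  note [measurable] = measurable_sqdist[OF q] measurable_sqdist[OF S]
  show ?thesis unfolding overfit_event_def by measurable
qed

lemma sets_underfit_event: "\<tau> \<subseteq> {1..p} \<Longrightarrow> underfit_event w \<tau> \<in> sets G"
proof -
  assume "\<tau> \<subseteq> {1..p}"
  then have \<tau>: "finite \<tau>" "finite (\<tau> \<inter> \<tau>0)" using fin_sub by auto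
  obtain T T' k where q: "qr n T T' k (adj w (sp X \<tau>))" using qr_adj_sp[OF \<tau>(1)] by blast
  obtain S S' k' where S: "qr n S S' k' (adj w (sp X (\<tau> \<inter> \<tau>0)))" using qr_adj_sp[OF \<tau>(2)] by blast
  note [measurable] = measurable_sqdist[OF q] measurable_sqdist[OF S]
  show ?thesis unfolding underfit_event_def by measurable
qed

lemma overfit_event_le:
  assumes B: "B \<in> Pow {1..p}" and p2: "p \<ge> 2"
  shows "measure G (overfit_event w B) \<le> (2 * sqrt 2 / real p) ^ card B * exp (- (real n * t / (16 * \<sigma>\<^sup>2)))"
proof -
  have finB: "finite B" using B fin_sub by auto
  obtain T T' k where q: "qr n T T' k (adj w (sp X \<tau>0))" using qr_adj_sp[OF fin\<tau>0] by blast
  let ?l = "ln (real p / 2)"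
  have l: "0 \<le> ?l" using p2 by simp
  let ?x = "6 * \<sigma>\<^sup>2 * (real (card B) * ?l) + real n * t"
  have "measure G (overfit_event w B) \<le> sqrt 2 ^ card B * exp (- ?x / (4 * \<sigma>\<^sup>2))"
    unfolding overfit_event_def observation_eq
    by (rule overfit_tail[OF q _ finB order_refl \<sigma>]) (use subset_adj \<mu>_mem in blast)
  also have "\<dots> \<le> sqrt 2 ^ card B * ((2 / real p) ^ card B * exp (- (real n * t / (16 * \<sigma>\<^sup>2))))"
  proof (rule mult_left_mono)
    \<comment> \<open>6 / 4 = 1.5, of which 1 is kept for the factor (2 / p)^card B. The rate t / 4
      is lowered to t / 16 to agree with the other case.\<close>
    have "?x / (4 * \<sigma>\<^sup>2) = 1.5 * (real (card B) * ?l) + real n * t / (4 * \<sigma>\<^sup>2)"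
      using \<sigma> by (simp add: field_simps)
    moreover have "real n * t / (16 * \<sigma>\<^sup>2) \<le> real n * t / (4 * \<sigma>\<^sup>2)"
      using \<sigma> t by (intro divide_left_mono) auto
    moreover have "real (card B) * ?l \<le> 1.5 * (real (card B) * ?l)" using l by simp
    ultimately have "- (?x / (4 * \<sigma>\<^sup>2)) \<le> - (real (card B) * ?l) - real n * t / (16 * \<sigma>\<^sup>2)"
      by linarith
    then have "exp (- ?x / (4 * \<sigma>\<^sup>2)) \<le> exp (- (real (card B) * ?l) - real n * t / (16 * \<sigma>\<^sup>2))"
      unfolding minus_divide_left by (rule exp_le_cancel_iff[THEN iffD2])
    also have "\<dots> = exp (- ?l) ^ card B * exp (- (real n * t / (16 * \<sigma>\<^sup>2)))"
      by (simp add: exp_of_nat_mult[symmetric] exp_add[symmetric])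
    also have "exp (- ?l) = 2 / real p" using p2 by (simp add: exp_minus)
    finally show "exp (- ?x / (4 * \<sigma>\<^sup>2)) \<le> (2 / real p) ^ card B * exp (- (real n * t / (16 * \<sigma>\<^sup>2)))" .
  qed simp
  also have "\<dots> = (2 * sqrt 2 / real p) ^ card B * exp (- (real n * t / (16 * \<sigma>\<^sup>2)))"
    by (simp add: power_mult_distrib power_divide)
  finally show ?thesis .
qed

text \<open>The bound is a power of the size of the symmetric difference because taking it with
  \<open>\<tau>0\<close> permutes the set of all models, which turns the union bound into a binomial
  sum.\<close>

lemma underfit_event_le:
  assumes w: "good w" and \<tau>: "\<tau> \<subseteq> {1..p}" "\<tau> \<noteq> \<tau>0" "card \<tau> \<le> card \<tau>0"
  shows "measure G (underfit_event w \<tau>)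
    \<le> (2 / (real p + 1)) ^ card (sym_diff \<tau> \<tau>0) * exp (- (real n * t / (16 * \<sigma>\<^sup>2)))"
proof -
  note fin = fin_sub[OF \<tau>(1)]
  define m where "m = card (\<tau>0 - \<tau>)"
  let ?V = "adj w (sp X (\<tau> \<inter> \<tau>0))" and ?B = "\<tau> - \<tau>0" and ?r = "2 / (real p + 1)"
  have cards: "card \<tau> = card (\<tau> \<inter> \<tau>0) + card ?B" "card \<tau>0 = card (\<tau> \<inter> \<tau>0) + m"
    using card_Int_Diff[OF fin, of \<tau>0] card_Int_Diff[OF fin\<tau>0, of \<tau>] by (simp_all add: Int_commute m_def)
  have Bm: "card ?B \<le> m" using cards \<tau>(3) by simp
  \<comment> \<open>A model that contains \<open>\<tau>0\<close> and is not larger equals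
    \<open>\<tau>0\<close>.\<close>
  have m: "m \<ge> 1"
  proof (rule ccontr)
    assume "\<not> m \<ge> 1"
    then have "card (\<tau>0 - \<tau>) = 0" "card ?B = 0" using Bm by (simp_all add: m_def)
    then have "\<tau>0 - \<tau> = {}" "?B = {}" using fin fin\<tau>0 by simp_all
    then show False using \<tau>(2) by blast
  qed
  obtain T T' k where q: "qr n T T' k ?V" using qr_adj_sp[of "\<tau> \<inter> \<tau>0"] fin by blast
  have eq: "adds X ?B ?V = adj w (sp X \<tau>)"
  proof -
    have U: "?B \<union> (\<tau> \<inter> \<tau>0) = \<tau>" by auto
    have "adds X ?B (sp X (\<tau> \<inter> \<tau>0)) = sp X (?B \<union> (\<tau> \<inter> \<tau>0))"
      unfolding sp_def by (rule adds_Un) (use fin in auto)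
    then show ?thesis using fin unfolding U by (simp add: adds_adj)
  qed
  define M where "M = C * (real n * real m)"
  let ?A = "sqdist n (adj w (sp X \<tau>)) \<mu>"
  have C0: "C > 0" using C_t t by linarith
  have M0: "M > 0" using C0 n m by (simp add: M_def)
  have "M \<le> sqdist n (sp X \<tau>) \<mu>" using C[OF \<tau>] m by (simp add: M_def m_def max_def split: if_splits)
  moreover have "0.2 * sqdist n (sp X \<tau>) \<mu> \<le> ?A" using w \<tau> by (auto simp: good_def)
  ultimately have A: "0.2 * M \<le> ?A" by linarith
  have L: "lam * real m \<le> 0.05 * M"
    using mult_right_mono[OF lam_upper, of "real m"] by (simp add: M_def mult_ac)
  have M1: "10 * t * real n \<le> M"
  proof -
    have "10 * t * (real n * 1) \<le> C * (real n * real m)" using C_t C0 t m by (intro mult_mono) auto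
    then show ?thesis by (simp add: M_def)
  qed
  \<comment> \<open>360 = 120 * 3, since card \<open>\<tau>0\<close> + 2 \<ge> 3.\<close>
  have M2: "360 * real m * ln (real p + 1) * \<sigma>\<^sup>2 \<le> M"
  proof -
    have l: "0 \<le> ln (real p + 1)" by simp
    have "120 * (3 * ln (real p + 1)) * \<sigma>\<^sup>2 \<le> 120 * ((real (card \<tau>0) + 2) * ln (real p + 1)) * \<sigma>\<^sup>2"
      using card_\<tau>0 l by (intro mult_right_mono mult_left_mono) auto
    also note C_signal
    finally have "120 * (3 * ln (real p + 1)) * \<sigma>\<^sup>2 * real m \<le> C * real n * real m" by (rule mult_right_mono) simp
    then show ?thesis by (simp add: M_def mult_ac)
  qed
  have "measure G (underfit_event w \<tau>) \<le> sqrt 2 ^ m * exp (- (?A / 8 - lam * real m / 4) / \<sigma>\<^sup>2)"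
    unfolding underfit_event_def observation_eq m_def[symmetric]
    using underfit_tail[OF q _ Bm \<sigma>, of X \<mu> "lam * real m"] fin A M0 unfolding eq by simp
  also have "\<dots> \<le> sqrt 2 ^ m * exp (- (2 * (real m * ln (real p + 1))) - real n * t / (16 * \<sigma>\<^sup>2))"
  proof (intro mult_left_mono exp_le_cancel_iff[THEN iffD2])
    \<comment> \<open>M (0.2 / 8 - 0.05 / 4) = M / 80 is split into equal halves: \<open>M2\<close>
      gives M / 160 \<ge> 2.25 m ln (p + 1) \<sigma>^2, and \<open>M1\<close> gives M / 160 \<ge> n
      t / 16.\<close>
    have "2 * (real m * ln (real p + 1)) * \<sigma>\<^sup>2 + real n * t / 16 \<le> M / 160 + M / 160"
    proof (rule add_mono)
      define Z where "Z = real m * ln (real p + 1) * \<sigma>\<^sup>2"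
      have "0 \<le> Z" unfolding Z_def by (intro mult_nonneg_nonneg) auto
      moreover have "360 * Z \<le> M" using M2 by (simp add: Z_def mult_ac)
      ultimately have "2 * Z \<le> M / 160" by linarith
      then show "2 * (real m * ln (real p + 1)) * \<sigma>\<^sup>2 \<le> M / 160" by (simp add: Z_def mult_ac)
      show "real n * t / 16 \<le> M / 160" using M1 by (simp add: mult_ac)
    qed
    also have "\<dots> \<le> ?A / 8 - lam * real m / 4" using A L by simp
    finally have "(2 * (real m * ln (real p + 1)) * \<sigma>\<^sup>2 + real n * t / 16) / \<sigma>\<^sup>2 \<le> (?A / 8 - lam * real m / 4) / \<sigma>\<^sup>2"
      by (rule divide_right_mono) simp
    also have "(2 * (real m * ln (real p + 1)) * \<sigma>\<^sup>2 + real n * t / 16) / \<sigma>\<^sup>2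
        = 2 * (real m * ln (real p + 1)) + real n * t / (16 * \<sigma>\<^sup>2)"
      using \<sigma> by (simp add: add_divide_distrib)
    finally have *: "2 * (real m * ln (real p + 1)) + real n * t / (16 * \<sigma>\<^sup>2) \<le> (?A / 8 - lam * real m / 4) / \<sigma>\<^sup>2" .
    have neg: "b + c \<le> x / v \<Longrightarrow> - x / v \<le> - b - c" for b c x v :: real
      using minus_divide_left[of x v] by linarith
    show "- (?A / 8 - lam * real m / 4) / \<sigma>\<^sup>2 \<le> - (2 * (real m * ln (real p + 1))) - real n * t / (16 * \<sigma>\<^sup>2)"
      by (rule neg) (rule *)
  qed simp
  also have "\<dots> = (sqrt 2 / (real p + 1)\<^sup>2) ^ m * exp (- (real n * t / (16 * \<sigma>\<^sup>2)))"
  proof -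
    have "exp (- (2 * (real m * ln (real p + 1)))) = exp (real m * - (2 * ln (real p + 1)))" by simp
    also have "\<dots> = exp (- (2 * ln (real p + 1))) ^ m" by (rule exp_of_nat_mult)
    also have "exp (- (2 * ln (real p + 1))) = 1 / (real p + 1)\<^sup>2"
      by (simp add: exp_minus exp_double inverse_eq_divide)
    finally have e: "exp (- (2 * (real m * ln (real p + 1)))) = (1 / (real p + 1)\<^sup>2) ^ m" .
    have "sqrt 2 ^ m * exp (- (2 * (real m * ln (real p + 1))) - real n * t / (16 * \<sigma>\<^sup>2))
        = (sqrt 2 ^ m * (1 / (real p + 1)\<^sup>2) ^ m) * exp (- (real n * t / (16 * \<sigma>\<^sup>2)))"
      by (simp only: diff_conv_add_uminus exp_add e mult.assoc)
    also have "sqrt 2 ^ m * (1 / (real p + 1)\<^sup>2) ^ m = (sqrt 2 / (real p + 1)\<^sup>2) ^ m"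
      by (simp only: power_mult_distrib[symmetric]) simp
    finally show ?thesis .
  qed
  also have "\<dots> \<le> ?r ^ card (sym_diff \<tau> \<tau>0) * exp (- (real n * t / (16 * \<sigma>\<^sup>2)))"
  proof (rule mult_right_mono)
    \<comment> \<open>The symmetric difference has at most 2 m elements, so each factor with (p +
      1)^2 in the denominator covers two of them.\<close>
    have "(sqrt 2 / (real p + 1)\<^sup>2) ^ m \<le> (?r\<^sup>2) ^ m"
    proof (rule power_mono)
      have "sqrt 2 \<le> 4" by (rule real_le_lsqrt) auto
      then show "sqrt 2 / (real p + 1)\<^sup>2 \<le> ?r\<^sup>2" by (simp add: power_divide divide_right_mono)
    qed simp
    also have "\<dots> = ?r ^ (2 * m)" by (simp add: power_mult)
    also have "\<dots> \<le> ?r ^ card (sym_diff \<tau> \<tau>0)"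
    proof (rule power_decreasing)
      have "card (sym_diff \<tau> \<tau>0) \<le> card ?B + m" unfolding m_def by (rule card_Un_le)
      then show "card (sym_diff \<tau> \<tau>0) \<le> 2 * m" using Bm by simp
      show "?r \<le> 1" using p_pos by simp
    qed simp
    finally show "(sqrt 2 / (real p + 1)\<^sup>2) ^ m \<le> ?r ^ card (sym_diff \<tau> \<tau>0)" .
  qed simp
  finally show ?thesis .
qed

lemma exp_bounds: "exp (4::real) \<le> 81" "exp (2::real) \<le> 9"
proof -
  have "exp (4::real) = exp 1 ^ 4" by (simp add: exp_of_nat_mult[symmetric])
  also have "\<dots> \<le> 3 ^ 4" using exp_le by (intro power_mono) auto
  finally show "exp (4::real) \<le> 81" by simp
  have "exp (2::real) = exp 1 ^ 2" by (simp add: exp_of_nat_mult[symmetric])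
  also have "\<dots> \<le> 3 ^ 2" using exp_le by (intro power_mono) auto
  finally show "exp (2::real) \<le> 9" by simp
qed

text \<open>Uniform over all \<open>good\<close> values \<open>w\<close> of the artificial noise, so
  it can be used section by section.\<close>

lemma tau_hat_miss_prob:
  assumes w: "good w"
  shows "\<P>(u in G. tau_hat n p X lam tie w (obs u) \<noteq> \<tau>0) \<le> 90 * exp (- (real n * t / (16 * \<sigma>\<^sup>2)))"
proof -
  let ?e = "exp (- (real n * t / (16 * \<sigma>\<^sup>2)))"
  let ?I = "if p \<ge> 2 then Pow {1..p} else {}"
  let ?K = "{\<tau>. \<tau> \<subseteq> {1..p} \<and> \<tau> \<noteq> \<tau>0 \<and> card \<tau> \<le> card \<tau>0}"
  have finK: "finite ?K" by (rule finite_subset[of _ "Pow {1..p}"]) auto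
  have sA: "overfit_event w ` ?I \<subseteq> sets G" and sB: "underfit_event w ` ?K \<subseteq> sets G"
    using sets_overfit_event sets_underfit_event by (auto split: if_splits)
  have A: "measure G (\<Union>B\<in>?I. overfit_event w B) \<le> 81 * ?e"
  proof -
    have "measure G (\<Union>B\<in>?I. overfit_event w B) \<le> (\<Sum>B\<in>?I. measure G (overfit_event w B))"
      by (rule G.finite_measure_subadditive_finite) (use sA in auto)
    also have "\<dots> \<le> (\<Sum>B\<in>?I. (2 * sqrt 2 / real p) ^ card B * ?e)"
      by (rule sum_mono) (use overfit_event_le in \<open>auto split: if_splits\<close>)
    also have "\<dots> \<le> (\<Sum>B\<in>Pow {1..p}. (2 * sqrt 2 / real p) ^ card B * ?e)"
      by (rule sum_mono2) auto
    also have "\<dots> = (1 + 2 * sqrt 2 / real p) ^ p * ?e"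
      by (simp add: sum_distrib_right[symmetric] sum_power_card_Pow)
    also have "\<dots> \<le> exp (real p * (2 * sqrt 2 / real p)) * ?e"
      by (intro mult_right_mono one_plus_power_le_exp) auto
    also have "\<dots> \<le> 81 * ?e"
    proof (rule mult_right_mono)
      have "sqrt 2 \<le> 2" by (rule real_le_lsqrt) auto
      then have "real p * (2 * sqrt 2 / real p) \<le> 4" using p_pos by simp
      then show "exp (real p * (2 * sqrt 2 / real p)) \<le> 81"
        using exp_bounds(1) by (meson exp_le_cancel_iff order_trans)
    qed simp
    finally show ?thesis .
  qed
  have B: "measure G (\<Union>\<tau>\<in>?K. underfit_event w \<tau>) \<le> 9 * ?e"
  proof -
    let ?r = "2 / (real p + 1)"
    have "measure G (\<Union>\<tau>\<in>?K. underfit_event w \<tau>) \<le> (\<Sum>\<tau>\<in>?K. measure G (underfit_event w \<tau>))"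
      by (rule G.finite_measure_subadditive_finite) (use sB finK in auto)
    also have "\<dots> \<le> (\<Sum>\<tau>\<in>?K. ?r ^ card (sym_diff \<tau> \<tau>0) * ?e)"
      by (rule sum_mono) (use underfit_event_le[OF w] in auto)
    also have "\<dots> \<le> (\<Sum>\<tau>\<in>Pow {1..p}. ?r ^ card (sym_diff \<tau> \<tau>0) * ?e)"
      by (rule sum_mono2) auto
    \<comment> \<open>Symmetric difference with \<open>\<tau>0\<close> is an involution on the
      subsets of {1..p}.\<close>
    also have "\<dots> = (\<Sum>B\<in>Pow {1..p}. ?r ^ card B * ?e)"
      by (rule sum.reindex_bij_witness[of _ "\<lambda>\<tau>. sym_diff \<tau> \<tau>0" "\<lambda>\<tau>. sym_diff \<tau> \<tau>0"]) (use \<tau>0 in auto)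
    also have "\<dots> = (1 + ?r) ^ p * ?e"
      by (simp add: sum_distrib_right[symmetric] sum_power_card_Pow)
    also have "\<dots> \<le> exp (real p * ?r) * ?e"
      by (intro mult_right_mono one_plus_power_le_exp) auto
    also have "\<dots> \<le> 9 * ?e"
    proof (rule mult_right_mono)
      have "real p * ?r \<le> 2" by (simp add: divide_le_eq)
      then show "exp (real p * ?r) \<le> 9"
        using exp_bounds(2) by (meson exp_le_cancel_iff order_trans)
    qed simp
    finally show ?thesis .
  qed
  have "\<P>(u in G. tau_hat n p X lam tie w (obs u) \<noteq> \<tau>0)
      \<le> measure G ((\<Union>B\<in>?I. overfit_event w B) \<union> (\<Union>\<tau>\<in>?K. underfit_event w \<tau>))"
  proof (rule G.finite_measure_mono)
    show "{u \<in> space G. tau_hat n p X lam tie w (obs u) \<noteq> \<tau>0} \<subseteq> (\<Union>B\<in>?I. overfit_event w B) \<union> (\<Union>\<tau>\<in>?K. underfit_event w \<tau>)"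
      using tau_hat_miss[of _ w] by fastforce
    show "(\<Union>B\<in>?I. overfit_event w B) \<union> (\<Union>\<tau>\<in>?K. underfit_event w \<tau>) \<in> sets G"
      using sA sB finK by (intro sets.Un sets.finite_UN) auto
  qed
  also have "\<dots> \<le> measure G (\<Union>B\<in>?I. overfit_event w B) + measure G (\<Union>\<tau>\<in>?K. underfit_event w \<tau>)"
    using sA sB finK by (intro measure_Un_le sets.finite_UN) auto
  also have "\<dots> \<le> 90 * ?e" using A B by simp
  finally show ?thesis .
qed

lemma sets_good [measurable]: "{w \<in> space G. good w} \<in> sets G"
proof -
  have "{w \<in> space G. 0.2 * sqdist n (sp X \<tau>) \<mu> \<le> sqdist n (adj w (sp X \<tau>)) \<mu>} \<in> sets G" if "\<tau> \<subseteq> {1..p}" for \<tau>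
  proof -
    note [measurable] = measurable_sqdist_adj_right[OF fin_sub[OF that]]
    show ?thesis by measurable
  qed
  then have "{w \<in> space G. \<forall>\<tau>\<in>{\<tau>. \<tau> \<subseteq> {1..p} \<and> card \<tau> \<le> card \<tau>0}. 0.2 * sqdist n (sp X \<tau>) \<mu> \<le> sqdist n (adj w (sp X \<tau>)) \<mu>} \<in> sets G"
    by (intro sets.sets_Collect_finite_All) (auto intro: finite_subset[of _ "Pow {1..p}"])
  then show ?thesis by (simp add: good_def)
qed

lemma bad_prob:
  assumes s: "card \<tau>0 < n"
  shows "\<P>(w in G. \<not> good w) \<le> 3 * real p ^ card \<tau>0 * (sqrt 2 * (1 / sqrt 3) ^ (n - card \<tau>0 - 1))"
proof -
  let ?K = "{\<tau>. \<tau> \<subseteq> {1..p} \<and> card \<tau> \<le> card \<tau>0}"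
  let ?b = "sqrt 2 * (1 / sqrt 3) ^ (n - card \<tau>0 - 1)"
  let ?E = "\<lambda>\<tau>. {w \<in> space G. sqdist n (adj w (sp X \<tau>)) \<mu> < 0.2 * sqdist n (sp X \<tau>) \<mu>}"
  have finK: "finite ?K" by (rule finite_subset[of _ "Pow {1..p}"]) auto
  have sE: "?E \<tau> \<in> sets G" if "\<tau> \<in> ?K" for \<tau>
  proof -
    have "finite \<tau>" using that fin_sub by auto
    note [measurable] = measurable_sqdist_adj_right[OF this]
    show ?thesis by measurable
  qed
  have "{w \<in> space G. \<not> good w} = (\<Union>\<tau>\<in>?K. ?E \<tau>)" by (auto simp: good_def not_le)
  then have "\<P>(w in G. \<not> good w) \<le> (\<Sum>\<tau>\<in>?K. measure G (?E \<tau>))"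
    using G.finite_measure_subadditive_finite[OF finK, of ?E] sE by auto
  also have "\<dots> \<le> (\<Sum>\<tau>\<in>?K. ?b)"
  proof (rule sum_mono)
    fix \<tau> assume \<tau>: "\<tau> \<in> ?K"
    then obtain T T' k where q: "qr n T T' k (sp X \<tau>)" "k \<le> card \<tau>" using qr_sp[of \<tau>] fin_sub by blast
    show "measure G (?E \<tau>) \<le> ?b" by (rule aligned_tail[OF q(1) _ s]) (use q(2) \<tau> in auto)
  qed
  also have "\<dots> = real (card ?K) * ?b" by simp
  also have "\<dots> \<le> (3 * real p ^ card \<tau>0) * ?b"
    using card_small_subsets[of "{1..p}" "card \<tau>0"] p_pos by (intro mult_right_mono) auto
  finally show ?thesis .
qed

end

section \<open>Exact levels of the two tests\<close>

text \<open>The infimum defining the quantile is approached from the right, and right continuity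
  carries the bound over to it.\<close>

lemma cdf_quantile:
  assumes "real_distribution M" and q: "0 < q" "q < 1"
  shows "q \<le> cdf M (quantile M q)"
proof -
  interpret real_distribution M by fact
  let ?S = "{x. q \<le> cdf M x}"
  have "\<forall>\<^sub>F x in at_top. q < cdf M x"
    by (rule order_tendstoD(1)[OF cdf_lim_at_top_prob q(2)])
  then obtain b where "q < cdf M b" by (metis eventually_at_top_linorder order_refl)
  then have ne: "?S \<noteq> {}" by (auto intro: less_imp_le)
  have "\<forall>\<^sub>F x in at_bot. cdf M x < q"
    by (rule order_tendstoD(2)[OF cdf_lim_at_bot q(1)])
  then obtain a where a: "\<And>x. x \<le> a \<Longrightarrow> cdf M x < q" by (auto simp: eventually_at_bot_linorder)
  have bdd: "bdd_below ?S"
  proof (rule bdd_belowI)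
    fix x assume "x \<in> ?S"
    then show "a \<le> x" using a[of x] by (cases "x \<le> a") auto
  qed
  have "\<forall>\<^sub>F x in at_right (Inf ?S). q \<le> cdf M x"
  proof -
    have "q \<le> cdf M x" if x: "Inf ?S < x" for x
    proof -
      obtain y where "y \<in> ?S" "y < x" using x ne bdd by (auto simp: cInf_less_iff)
      then show ?thesis using cdf_nondecreasing[of y x] by simp
    qed
    then show ?thesis by (auto simp: eventually_at_filter)
  qed
  moreover have "(cdf M \<longlongrightarrow> cdf M (Inf ?S)) (at_right (Inf ?S))"
    using cdf_is_right_cont[of "Inf ?S"] by (simp add: continuous_within)
  ultimately have "q \<le> cdf M (Inf ?S)" by (intro tendsto_lowerbound[of "cdf M"]) auto
  then show ?thesis by (simp add: quantile_def)
qed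

lemma ex_is_arg_min_finite:
  fixes f :: "'a \<Rightarrow> real"
  assumes "finite P" "P \<noteq> {}"
  shows "\<exists>x. is_arg_min f (\<lambda>x. x \<in> P) x"
proof -
  have "Min (f ` P) \<in> f ` P" using assms by (intro Min_in) auto
  then obtain x where x: "x \<in> P" "f x = Min (f ` P)" by auto
  have "\<not> f y < f x" if "y \<in> P" for y
    unfolding x(2) not_less using assms(1) that by (intro Min_le) auto
  then have "is_arg_min f (\<lambda>x. x \<in> P) x" using x(1) by (simp add: is_arg_min_def)
  then show ?thesis by (rule exI)
qed

text \<open>The tie rule is an arbitrary function, so measurability is shown for the set of
  minimizers. That set takes finitely many values, and from a discrete space any function is
  measurable.\<close>

lemma measurable_tie_arg_min:
  fixes f :: "'b \<Rightarrow> 'a \<Rightarrow> real"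
  assumes P: "finite P" and f: "\<And>\<tau>. \<tau> \<in> P \<Longrightarrow> f \<tau> \<in> borel_measurable M"
  shows "(\<lambda>x. tie {\<tau>. is_arg_min (\<lambda>\<tau>. f \<tau> x) (\<lambda>\<tau>. \<tau> \<in> P) \<tau>}) \<in> M \<rightarrow>\<^sub>M count_space UNIV"
proof -
  define Q where "Q \<tau> x \<longleftrightarrow> (\<forall>\<tau>'\<in>P. \<not> f \<tau>' x < f \<tau> x)" for \<tau> x
  define A where "A x = {\<tau> \<in> P. Q \<tau> x}" for x
  have Q: "{x \<in> space M. Q \<tau> x} \<in> sets M" if \<tau>: "\<tau> \<in> P" for \<tau>
    unfolding Q_def
  proof (rule sets.sets_Collect_finite_All[OF _ P])
    fix \<tau>' assume "\<tau>' \<in> P"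
    note [measurable] = f[OF \<tau>] f[OF this]
    show "{x \<in> space M. \<not> f \<tau>' x < f \<tau> x} \<in> sets M" by measurable
  qed
  have "A -` {S} \<inter> space M \<in> sets M" if S: "S \<subseteq> P" for S
  proof -
    have "A -` {S} \<inter> space M = {x \<in> space M. \<forall>\<tau>\<in>P. \<tau> \<in> S \<longleftrightarrow> Q \<tau> x}"
      using S unfolding A_def by blast
    also have "\<dots> \<in> sets M"
    proof (rule sets.sets_Collect_finite_All[OF _ P])
      fix \<tau> assume "\<tau> \<in> P"
      note [measurable] = Q[OF this]
      show "{x \<in> space M. \<tau> \<in> S \<longleftrightarrow> Q \<tau> x} \<in> sets M" by measurable
    qed
    finally show ?thesis .
  qed
  moreover have "A x \<subseteq> P" for x unfolding A_def by blast
  ultimately have "A \<in> M \<rightarrow>\<^sub>M count_space (Pow P)"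
    using P by (subst measurable_count_space_eq2) auto
  then have "(\<lambda>x. tie (A x)) \<in> M \<rightarrow>\<^sub>M count_space UNIV"
    by (rule measurable_compose) simp
  moreover have "A x = {\<tau>. is_arg_min (\<lambda>\<tau>. f \<tau> x) (\<lambda>\<tau>. \<tau> \<in> P) \<tau>}" for x
    unfolding A_def Q_def is_arg_min_def by blast
  ultimately show ?thesis by simp
qed

text \<open>Take a rejected outcome of largest probability: all rejected outcomes are at most as
  probable, so they lie in the very set whose total was found to be below the threshold.\<close>

lemma highest_probability_complement:
  fixes P :: "'a \<Rightarrow> real"
  assumes fin: "finite \<Omega>" and nn: "\<And>x. 0 \<le> P x" and \<alpha>: "\<alpha> \<le> 1"
  shows "(\<Sum>x | x \<in> \<Omega> \<and> \<not> 1 - \<alpha> \<le> (\<Sum>y | y \<in> \<Omega> \<and> P y \<le> P x. P y). P x) \<le> 1 - \<alpha>"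
proof -
  let ?C = "{x. x \<in> \<Omega> \<and> \<not> 1 - \<alpha> \<le> (\<Sum>y | y \<in> \<Omega> \<and> P y \<le> P x. P y)}"
  have finC: "finite ?C" using fin by simp
  show ?thesis
  proof (cases "?C = {}")
    case True
    then show ?thesis unfolding True using \<alpha> by simp
  next
    case False
    have "Max (P ` ?C) \<in> P ` ?C" using finC False by (intro Max_in) auto
    then obtain x where x: "x \<in> ?C" "P x = Max (P ` ?C)" by auto
    have "?C \<subseteq> {y. y \<in> \<Omega> \<and> P y \<le> P x}" using finC by (auto simp: x(2) intro!: Max_ge)
    then have "(\<Sum>x\<in>?C. P x) \<le> (\<Sum>y | y \<in> \<Omega> \<and> P y \<le> P x. P y)"
      by (intro sum_mono2) (use fin nn in auto)
    also have "\<dots> \<le> 1 - \<alpha>" using x(1) by simp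
    finally show ?thesis .
  qed
qed

section \<open>Projections in rotated coordinates\<close>

lemma col_span_eq: "col_span n X \<tau> = (\<lambda>v. restrict v {1..n}) ` sp X \<tau>"
proof (intro equalityI subsetI)
  fix w assume "w \<in> col_span n X \<tau>"
  then obtain \<beta> where w: "w = (\<lambda>i\<in>{1..n}. \<Sum>j\<in>\<tau>. X i j * \<beta> j)" unfolding col_span_def fit_def by blast
  have "(\<lambda>i. \<Sum>j\<in>\<tau>. X i j * \<beta> j) \<in> sp X \<tau>" by (simp add: sp_eq)
  with w show "w \<in> (\<lambda>v. restrict v {1..n}) ` sp X \<tau>" by (rule image_eqI)
next
  fix w assume "w \<in> (\<lambda>v. restrict v {1..n}) ` sp X \<tau>"
  then obtain \<beta> where "w = (\<lambda>i\<in>{1..n}. \<Sum>j\<in>\<tau>. X i j * \<beta> j)" by (auto simp: sp_eq)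
  then have "w = fit n X \<tau> (restrict \<beta> \<tau>)" by (simp add: fit_def)
  moreover have "restrict \<beta> \<tau> \<in> coeffs_of \<tau>" by (simp add: coeffs_of_def)
  ultimately show "w \<in> col_span n X \<tau>" unfolding col_span_def by (rule image_eqI)
qed

lemma proj_qr:
  assumes q: "qr n T T' k (sp X \<tau>)"
  shows "proj n X \<tau> y = restrict (T' (\<lambda>i. if i \<le> k then T y i else 0)) {1..n}" (is "_ = ?v")
  unfolding proj_def
proof (rule the_equality)
  note T = qr_rot[OF q]
  let ?z = "\<lambda>i. if i \<le> k then T y i else 0"
  have Tv: "T ?v i = ?z i" if "i \<in> {1..n}" for i
    using rot_cong[OF T, of ?v "T' ?z" i] that by (simp add: rot_inv2[OF T])
  have "\<exists>v\<in>sp X \<tau>. \<forall>i. 1 \<le> i \<longrightarrow> i \<le> n \<longrightarrow> T v i = ?z i" by (rule qr_onto[OF q]) simp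
  then obtain v where v: "v \<in> sp X \<tau>" "\<And>i. i \<in> {1..n} \<Longrightarrow> T v i = ?z i" by auto
  have "v i = T' ?z i" if "i \<in> {1..n}" for i
    using rot_cong[OF rot_sym[OF T], of "T v" ?z i] v(2) that by (simp add: rot_inv1[OF T])
  then have vv: "?v = restrict v {1..n}" by (intro restrict_ext) simp
  have mem: "?v \<in> col_span n X \<tau>" unfolding col_span_eq vv using v(1) by (rule imageI)
  have orth: "(\<Sum>i=1..n. (y i - ?v i) * w i) = 0" if w: "w \<in> sp X \<tau>" for w
  proof -
    have "(\<Sum>i=1..n. (y i - ?v i) * w i) = (\<Sum>i=1..n. T (\<lambda>i. y i - ?v i) i * T w i)"
      by (rule rot_inner[OF T, symmetric])
    also have "\<dots> = (\<Sum>i=1..n. (T y i - T ?v i) * T w i)" by (simp only: rot_diff[OF T])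
    also have "\<dots> = 0"
    proof (rule sum.neutral, rule ballI)
      fix i assume i: "i \<in> {1..n}"
      show "(T y i - T ?v i) * T w i = 0" using Tv[OF i] qr_zero[OF q w, of i] i by (cases "i \<le> k") auto
    qed
    finally show ?thesis .
  qed
  have res: "(\<Sum>i=1..n. a i * restrict w {1..n} i) = (\<Sum>i=1..n. a i * w i)" for a w :: "nat \<Rightarrow> real"
    by (intro sum.cong) auto
  have orth': "(\<Sum>i=1..n. (y i - ?v i) * w i) = 0" if w: "w \<in> col_span n X \<tau>" for w
  proof -
    obtain u where u: "u \<in> sp X \<tau>" "w = restrict u {1..n}" using w unfolding col_span_eq by blast
    show ?thesis unfolding u(2) res by (rule orth[OF u(1)])
  qed
  show "?v \<in> col_span n X \<tau> \<and> (\<forall>w\<in>col_span n X \<tau>. (\<Sum>i=1..n. (y i - ?v i) * w i) = 0)"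
    by (intro conjI ballI mem orth')
  fix v' assume v': "v' \<in> col_span n X \<tau> \<and> (\<forall>w\<in>col_span n X \<tau>. (\<Sum>i=1..n. (y i - v' i) * w i) = 0)"
  then obtain u where u: "u \<in> sp X \<tau>" "v' = restrict u {1..n}" unfolding col_span_eq by blast
  have o: "(\<Sum>i=1..n. (y i - v' i) * w i) = 0" "(\<Sum>i=1..n. (y i - ?v i) * w i) = 0" if "w \<in> col_span n X \<tau>" for w
    using v' that by (blast, intro orth' that)
  \<comment> \<open>Uniqueness: the squared distance of two candidates expands into inner products
    of their residuals with elements of the span, all zero.\<close>
  have "(\<Sum>i=1..n. (v' i - ?v i)\<^sup>2) = ((\<Sum>i=1..n. (y i - ?v i) * v' i) - (\<Sum>i=1..n. (y i - ?v i) * ?v i))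
     - ((\<Sum>i=1..n. (y i - v' i) * v' i) - (\<Sum>i=1..n. (y i - v' i) * ?v i))"
    unfolding sum_subtractf[symmetric] by (intro sum.cong) (auto simp: power2_eq_square algebra_simps)
  also have "\<dots> = 0" using o[OF mem] o[of v'] v' by simp
  finally have "\<forall>i\<in>{1..n}. v' i = ?v i" by (subst (asm) sum_nonneg_eq_0_iff) auto
  then show "v' = ?v" unfolding u(2) by (intro restrict_ext) simp
qed

lemma rot_proj:
  assumes q: "qr n T T' k (sp X \<tau>)" and i: "i \<in> {1..n}"
  shows "T (proj n X \<tau> y) i = (if i \<le> k then T y i else 0)"
    and "T (resid n X \<tau> y) i = (if i \<le> k then 0 else T y i)"
proof -
  note T = qr_rot[OF q]
  let ?z = "\<lambda>i. if i \<le> k then T y i else 0"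
  show 1: "T (proj n X \<tau> y) i = ?z i"
    using rot_cong[OF T, of "proj n X \<tau> y" "T' ?z" i] i by (simp add: rot_inv2[OF T] proj_qr[OF q])
  have "T (resid n X \<tau> y) i = T (\<lambda>i. y i - proj n X \<tau> y i) i"
    by (rule rot_cong[OF T _ i]) (simp add: resid_def)
  then show "T (resid n X \<tau> y) i = (if i \<le> k then 0 else T y i)"
    unfolding rot_diff[OF T] 1 by simp
qed

lemma L2_set_resid:
  assumes q: "qr n T T' k (sp X \<tau>)"
  shows "L2_set (resid n X \<tau> y) {1..n} = L2_set (T y) {k<..n}"
proof -
  note T = qr_rot[OF q]
  have "(\<Sum>i=1..n. (resid n X \<tau> y i)\<^sup>2) = (\<Sum>i=1..n. (T (resid n X \<tau> y) i)\<^sup>2)"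
    by (rule rot_norm[OF T, symmetric])
  also have "\<dots> = (\<Sum>i=1..n. (if i \<le> k then 0 else T y i)\<^sup>2)"
    by (intro sum.cong refl) (simp only: rot_proj(2)[OF q])
  also have "\<dots> = (\<Sum>i\<in>{k<..n}. (T y i)\<^sup>2)"
    by (intro sum.mono_neutral_cong_right) auto
  finally show ?thesis by (simp add: L2_set_def)
qed

lemma indicator_le_indicator: "(x \<in> A \<Longrightarrow> y \<in> B) \<Longrightarrow> indicator A x \<le> (indicator B y :: ennreal)"
  by (auto simp: indicator_def)

lemma is_arg_minD: "is_arg_min f P x \<Longrightarrow> P x"
  by (simp add: is_arg_min_def)

text \<open>Here only \<open>U\<close> is random and the candidate set does not enter. The rank
  \<open>k\<close> is a parameter; \<open>F_stat_cover\<close> adds \<open>k = card \<tau>0\<close>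
  so that the degrees of freedom agree. \<open>kn\<close> leaves a nonzero residual space.\<close>

locale confidence =
  fixes n p :: nat and X :: "nat \<Rightarrow> nat \<Rightarrow> real" and \<tau>0 :: "nat set" and \<beta>0 :: "nat \<Rightarrow> real"
    and \<sigma> :: real and tie :: "nat set set \<Rightarrow> nat set" and T T' k
  assumes \<tau>0: "\<tau>0 \<subseteq> {1..p}" and \<sigma>: "\<sigma> > 0" and tie: "tie_rule tie"
    and q: "qr n T T' k (sp X \<tau>0)" and kn: "k < n"
begin

abbreviation "G \<equiv> std_gauss n"
abbreviation "\<mu> \<equiv> signal X \<tau>0 \<beta>0"
abbreviation "obs \<equiv> observation n X \<tau>0 \<beta>0 \<sigma>"

sublocale G: prob_space G by (rule prob_space_std_gauss)

lemmas rT = qr_rot[OF q]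
lemmas [measurable] = measurable_rot[OF rT] measurable_rot_inv[OF rT]

lemma rot_obs: "i \<in> {1..n} \<Longrightarrow> T (obs u) i = T \<mu> i + \<sigma> * T u i"
  unfolding observation_eq by (rule rot_observation[OF rT])

lemma rot_signal: "k < i \<Longrightarrow> i \<le> n \<Longrightarrow> T \<mu> i = 0"
  using qr_zero[OF q, of \<mu> i] by (auto simp: sp_eq)

text \<open>After rotation \<sigma>^2 cancels, and numerator and denominator are sums of squares
  over disjoint blocks of a standard Gaussian vector.\<close>

lemma F_stat_cover:
  assumes k: "k = card \<tau>0" and \<alpha>: "0 < \<alpha>" "\<alpha> < 1"
  shows "{u \<in> space G. F_stat n X (obs u) (\<tau>0, \<beta>0) \<in> B_joint n \<alpha> (\<tau>0, \<beta>0)} \<in> sets G" (is "?E \<in> _")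
    and "\<alpha> \<le> \<P>(u in G. F_stat n X (obs u) (\<tau>0, \<beta>0) \<in> B_joint n \<alpha> (\<tau>0, \<beta>0))"
proof -
  define S where "S z = ((\<Sum>i=1..k. (z i)\<^sup>2) / real k) / ((\<Sum>i\<in>{k<..n}. (z i)\<^sup>2) / real (n - k))" for z :: "nat \<Rightarrow> real"
  have Sm [measurable]: "S \<in> borel_measurable G"
    unfolding S_def using kn by (intro borel_measurable_divide measurable_sum_sq borel_measurable_const) auto
  have S0: "0 \<le> S z" for z unfolding S_def by (intro divide_nonneg_nonneg sum_nonneg) auto
  have F: "F_stat n X (obs u) (\<tau>0, \<beta>0) = S (T u)" for u
  proof -
    let ?r = "\<lambda>i\<in>{1..n}. obs u i - fit n X \<tau>0 \<beta>0 i"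
    have r: "T ?r i = \<sigma> * T u i" if "i \<in> {1..n}" for i
    proof -
      have "T ?r i = T (\<lambda>i. \<sigma> * u i) i"
        by (rule rot_cong[OF rT _ that]) (simp add: observation_def)
      then show ?thesis by (simp add: rot_scale[OF rT])
    qed
    have 1: "(\<Sum>i=1..n. ?r i * proj n X \<tau>0 ?r i) = \<sigma>\<^sup>2 * (\<Sum>i=1..k. (T u i)\<^sup>2)"
    proof -
      have "(\<Sum>i=1..n. ?r i * proj n X \<tau>0 ?r i) = (\<Sum>i=1..n. T ?r i * T (proj n X \<tau>0 ?r) i)"
        by (rule rot_inner[OF rT, symmetric])
      also have "\<dots> = (\<Sum>i=1..n. if i \<le> k then \<sigma>\<^sup>2 * (T u i)\<^sup>2 else 0)"
        by (intro sum.cong refl) (simp add: rot_proj[OF q] r power2_eq_square)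
      also have "\<dots> = (\<Sum>i=1..k. \<sigma>\<^sup>2 * (T u i)\<^sup>2)"
        by (intro sum.mono_neutral_cong_right) (use kn in auto)
      finally show ?thesis by (simp add: sum_distrib_left)
    qed
    have 2: "(\<Sum>i=1..n. ?r i * resid n X \<tau>0 ?r i) = \<sigma>\<^sup>2 * (\<Sum>i\<in>{k<..n}. (T u i)\<^sup>2)"
    proof -
      have "(\<Sum>i=1..n. ?r i * resid n X \<tau>0 ?r i) = (\<Sum>i=1..n. T ?r i * T (resid n X \<tau>0 ?r) i)"
        by (rule rot_inner[OF rT, symmetric])
      also have "\<dots> = (\<Sum>i=1..n. if i \<le> k then 0 else \<sigma>\<^sup>2 * (T u i)\<^sup>2)"
        by (intro sum.cong refl) (simp add: rot_proj[OF q] r power2_eq_square)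
      also have "\<dots> = (\<Sum>i\<in>{k<..n}. \<sigma>\<^sup>2 * (T u i)\<^sup>2)"
        by (intro sum.mono_neutral_cong_right) (use kn in auto)
      finally show ?thesis by (simp add: sum_distrib_left)
    qed
    show ?thesis unfolding F_stat_def Let_def fst_conv snd_conv 1 2 S_def k[symmetric] using \<sigma> by simp
  qed
  \<comment> \<open>\<open>F_dist k (n - k)\<close> lives on k + (n - k) coordinates, hence on the
    same Gaussian space, and is literally the law of \<open>S\<close>.\<close>
  have kk: "k + (n - k) = n" "{k + 1..n} = {k<..n}" using kn by auto
  have FD: "F_dist k (n - k) = distr G borel S"
    unfolding F_dist_def S_def kk ..
  interpret FD: real_distribution "F_dist k (n - k)" unfolding FD by (rule G.real_distribution_distr) measurable
  define c where "c = quantile (F_dist k (n - k)) \<alpha>"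
  \<comment> \<open>The lower end of the acceptance interval is 0, and \<open>S\<close> is
    nonnegative.\<close>
  have E: "?E = {u \<in> space G. S (T u) \<le> c}"
    unfolding F B_joint_def fst_conv k[symmetric] c_def[symmetric] using S0 by auto
  show "?E \<in> sets G"
    unfolding E using measurable_compose[OF measurable_rot[OF rT] Sm] by measurable
  have "\<alpha> \<le> cdf (F_dist k (n - k)) c"
    unfolding c_def by (rule cdf_quantile[OF FD.real_distribution_axioms \<alpha>])
  also have "\<dots> = \<P>(z in G. S z \<le> c)"
    unfolding FD cdf_def by (subst measure_distr) (auto simp: vimage_def Int_def conj_commute)
  also have "\<dots> = measure G ?E"
    unfolding E by (rule measure_rot[OF rT, symmetric]) measurable
  finally show "\<alpha> \<le> measure G ?E" .
qed

section \<open>Level of the model test\<close>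

lemma fin_sub: "\<tau> \<subseteq> {1..p} \<Longrightarrow> finite \<tau>"
  using finite_subset by blast

lemma T0_stat_eq:
  "T0_stat n p X tie y \<tau>0 = tie {\<tau>. is_arg_min (\<lambda>\<tau>. sqdist n (sp X \<tau>) y) (\<lambda>\<tau>. \<tau> \<in> {\<tau>. \<tau> \<subseteq> {1..p} \<and> card \<tau> \<le> card \<tau>0}) \<tau>}"
  unfolding T0_stat_def mem_Collect_eq
  by (rule arg_cong[where f=tie], rule Collect_cong, rule is_arg_min_cong, rule INF_coeffs)
    (simp add: fin_sub)

lemma finite_models: "finite {\<tau>. \<tau> \<subseteq> {1..p} \<and> card \<tau> \<le> card \<tau>0}"
  by (rule finite_subset[of _ "Pow {1..p}"]) auto

lemma T0_stat_subset: "T0_stat n p X tie y \<tau>0 \<subseteq> {1..p}"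
proof -
  let ?P = "{\<tau>. \<tau> \<subseteq> {1..p} \<and> card \<tau> \<le> card \<tau>0}"
  let ?A = "{\<tau>. is_arg_min (\<lambda>\<tau>. sqdist n (sp X \<tau>) y) (\<lambda>\<tau>. \<tau> \<in> ?P) \<tau>}"
  have mem: "x \<in> A \<Longrightarrow> tie A \<in> A" for x A using tie unfolding tie_rule_def by blast
  have "?P \<noteq> {}" using \<tau>0 by blast
  then obtain x where "is_arg_min (\<lambda>\<tau>. sqdist n (sp X \<tau>) y) (\<lambda>\<tau>. \<tau> \<in> ?P) x"
    using ex_is_arg_min_finite[OF finite_models, of "\<lambda>\<tau>. sqdist n (sp X \<tau>) y"] by (auto simp only:)
  then have "tie ?A \<in> ?A" by (intro mem[of x]) (rule CollectI)
  then have "is_arg_min (\<lambda>\<tau>. sqdist n (sp X \<tau>) y) (\<lambda>\<tau>. \<tau> \<in> ?P) (tie ?A)" by (rule CollectD)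
  then have "tie ?A \<in> ?P" by (rule is_arg_minD)
  then show ?thesis unfolding T0_stat_eq by blast
qed

lemma measurable_T0_stat [measurable]: "(\<lambda>y. T0_stat n p X tie y \<tau>0) \<in> G \<rightarrow>\<^sub>M count_space UNIV"
  unfolding T0_stat_eq
  by (rule measurable_tie_arg_min[OF finite_models]) (simp add: fin_sub measurable_sqdist_sp)

text \<open>Both arguments are noise in rotated coordinates. The result is the data vector with the
  projection and residual norm belonging to \<open>z\<close> and the residual direction of
  \<open>v\<close>.\<close>

definition resample :: "(nat \<Rightarrow> real) \<Rightarrow> (nat \<Rightarrow> real) \<Rightarrow> nat \<Rightarrow> real" where
  "resample z v = obs (T' (polar n k z v))"

lemma measurable_resample: "(\<lambda>(z, v). resample z v) \<in> G \<Otimes>\<^sub>M G \<rightarrow>\<^sub>M G"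
  unfolding resample_def
  using measurable_compose[OF measurable_compose[OF measurable_polar measurable_rot_inv[OF rT]] measurable_observation]
  by (simp add: split_def)

text \<open>Both sides are compared after rotation: the heads agree, and the tail norm of the
  rotated data is \<sigma> times that of the rotated noise because the signal has no tail.\<close>

lemma T0_prob_argument:
  assumes "u \<in> space G" "v \<in> space G"
  shows "(\<lambda>i\<in>{1..n}. fst (W_stat n X (obs u) \<tau>0) i + snd (W_stat n X (obs u) \<tau>0)
      * (resid n X \<tau>0 v i / L2_set (resid n X \<tau>0 v) {1..n})) = resample (T u) (T v)" (is "?A = ?B")
proof -
  let ?y = "obs u" and ?J = "{k<..n}"
  define b where "b = L2_set (T ?y) ?J / L2_set (T v) ?J"
  have A: "?A = (\<lambda>i\<in>{1..n}. proj n X \<tau>0 ?y i + b * resid n X \<tau>0 v i)"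
    by (auto simp: W_stat_def L2_set_resid[OF q] b_def)
  have L: "L2_set (T ?y) ?J = \<sigma> * L2_set (T u) ?J"
  proof -
    have "L2_set (T ?y) ?J = L2_set (\<lambda>i. \<sigma> * T u i) ?J"
      by (rule L2_set_cong) (auto simp: rot_obs rot_signal)
    also have "\<dots> = L2_set (\<lambda>i\<in>?J. \<sigma> * T u i) ?J" by (rule L2_set_cong) auto
    also have "\<dots> = \<sigma> * L2_set (T u) ?J"
      unfolding L2_set_scale using \<sigma> by simp
    finally show ?thesis .
  qed
  have "T ?A i = T ?B i" if i: "i \<in> {1..n}" for i
  proof -
    have "T ?A i = T (\<lambda>i. 1 * proj n X \<tau>0 ?y i + b * resid n X \<tau>0 v i) i"
      unfolding A by (rule rot_cong[OF rT _ i]) simp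
    also have "\<dots> = (if i \<le> k then T ?y i else b * T v i)"
      unfolding rot_linear[OF rT] using rot_proj[OF q i] by simp
    also have "\<dots> = T ?B i"
      unfolding resample_def rot_obs[OF i] rot_inv2[OF rT] using i
      by (auto simp: polar_def rot_obs rot_signal b_def L)
    finally show ?thesis .
  qed
  then have *: "?A i = ?B i" if "i \<in> {1..n}" for i
    using rot_cong[OF rot_sym[OF rT], of "T ?A" "T ?B" i] that by (simp only: rot_inv1[OF rT])
  show ?thesis
  proof (rule extensionalityI)
    show "?B \<in> extensional {1..n}" by (simp add: resample_def observation_def)
  qed (use * in auto)
qed

text \<open>The conditional law of the model statistic; \<open>z\<close> matters only through its
  head and the norm of its tail.\<close>

definition post :: "(nat \<Rightarrow> real) \<Rightarrow> nat set \<Rightarrow> real" where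
  "post z \<tau> = \<P>(v in G. T0_stat n p X tie (resample z v) \<tau>0 = \<tau>)"

lemma measurable_resample_right: "z \<in> space G \<Longrightarrow> resample z \<in> G \<rightarrow>\<^sub>M G"
  using measurable_compose[OF measurable_Pair1' measurable_resample] by simp

lemma sets_T0_resample: "z \<in> space G \<Longrightarrow> {v \<in> space G. T0_stat n p X tie (resample z v) \<tau>0 \<in> S} \<in> sets G"
  using measurable_sets[OF measurable_compose[OF measurable_resample_right measurable_T0_stat], of z S]
  by (simp add: vimage_def Int_def conj_commute)

lemma T0_prob_eq:
  assumes u: "u \<in> space G"
  shows "T0_prob n p X tie (W_stat n X (obs u) \<tau>0) \<tau>0 \<tau> = post (T u) \<tau>"
proof -
  have Tu: "T u \<in> space G" using measurable_space[OF measurable_rot[OF rT] u] .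
  have "T0_prob n p X tie (W_stat n X (obs u) \<tau>0) \<tau>0 \<tau>
    = \<P>(v in G. T0_stat n p X tie (resample (T u) (T v)) \<tau>0 = \<tau>)"
    unfolding T0_prob_def using T0_prob_argument[OF u] by (intro arg_cong[where f="measure G"]) auto
  also have "\<dots> = post (T u) \<tau>"
    unfolding post_def by (rule measure_rot[OF rT]) (use sets_T0_resample[OF Tu, of "{\<tau>}"] in simp)
  finally show ?thesis .
qed

lemma measurable_post [measurable]: "(\<lambda>z. post z \<tau>) \<in> borel_measurable G"
proof -
  have "{x \<in> space (G \<Otimes>\<^sub>M G). T0_stat n p X tie (case x of (z, v) \<Rightarrow> resample z v) \<tau>0 = \<tau>} \<in> sets (G \<Otimes>\<^sub>M G)"
    using measurable_sets[OF measurable_compose[OF measurable_resample measurable_T0_stat], of "{\<tau>}"]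
    by (simp add: vimage_def Int_def conj_commute)
  then have "(\<lambda>z. emeasure G (Pair z -` {x \<in> space (G \<Otimes>\<^sub>M G). T0_stat n p X tie (case x of (z, v) \<Rightarrow> resample z v) \<tau>0 = \<tau>}))
    \<in> borel_measurable G"
    by (rule G.measurable_emeasure_Pair)
  then have "(\<lambda>z. enn2real (emeasure G (Pair z -` {x \<in> space (G \<Otimes>\<^sub>M G). T0_stat n p X tie (case x of (z, v) \<Rightarrow> resample z v) \<tau>0 = \<tau>})))
    \<in> borel_measurable G" by measurable
  then show ?thesis
    by (rule measurable_cong[THEN iffD1, rotated])
      (auto simp: post_def measure_def space_pair_measure vimage_def intro!: arg_cong[where f="\<lambda>A. enn2real (emeasure G A)"])
qed

definition accept :: "real \<Rightarrow> (nat \<Rightarrow> real) \<Rightarrow> nat set \<Rightarrow> bool" where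
  "accept \<alpha> z \<tau> \<longleftrightarrow> 1 - \<alpha> \<le> (\<Sum>\<tau>' | \<tau>' \<in> Pow {1..p} \<and> post z \<tau>' \<le> post z \<tau>. post z \<tau>')"

lemma sets_accept: "{z \<in> space G. accept \<alpha> z \<tau>} \<in> sets G"
proof -
  have "accept \<alpha> z \<tau> \<longleftrightarrow> 1 - \<alpha> \<le> (\<Sum>\<tau>'\<in>Pow {1..p}. if post z \<tau>' \<le> post z \<tau> then post z \<tau>' else 0)" for z
    unfolding accept_def by (subst sum.inter_filter) auto
  then show ?thesis by simp
qed

lemma B_model_iff:
  assumes "u \<in> space G"
  shows "T0_stat n p X tie y \<tau>0 \<in> B_model n p X tie \<alpha> \<tau>0 (W_stat n X (obs u) \<tau>0)
    \<longleftrightarrow> accept \<alpha> (T u) (T0_stat n p X tie y \<tau>0)"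
  unfolding B_model_def accept_def T0_prob_eq[OF assms] using T0_stat_subset[of y] by simp

text \<open>Expressed in the rotated noise, so that the resampling \<open>polar\<close> can act on
  the argument.\<close>

definition reject :: "real \<Rightarrow> (nat \<Rightarrow> real) \<Rightarrow> bool" where
  "reject \<alpha> z \<longleftrightarrow> \<not> accept \<alpha> z (T0_stat n p X tie (obs (T' z)) \<tau>0)"

lemma sets_reject [measurable]: "{z \<in> space G. reject \<alpha> z} \<in> sets G"
proof -
  have m: "(\<lambda>z. T0_stat n p X tie (obs (T' z)) \<tau>0) \<in> G \<rightarrow>\<^sub>M count_space UNIV"
    by (rule measurable_compose[OF measurable_compose[OF measurable_rot_inv[OF rT] measurable_observation] measurable_T0_stat])
  have "{z \<in> space G. T0_stat n p X tie (obs (T' z)) \<tau>0 = \<tau>} \<in> sets G" for \<tau>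
    using measurable_sets[OF m, of "{\<tau>}"] by (simp add: vimage_def Int_def conj_commute)
  moreover have "{z \<in> space G. reject \<alpha> z}
     = (\<Union>\<tau>\<in>Pow {1..p}. {z \<in> space G. T0_stat n p X tie (obs (T' z)) \<tau>0 = \<tau>} - {z \<in> space G. accept \<alpha> z \<tau>})"
    using T0_stat_subset by (auto simp: reject_def)
  ultimately show ?thesis using sets_accept by (auto intro!: sets.finite_UN)
qed

text \<open>Resampling the direction of the residual keeps the projection and the residual norm, hence the
  conditional law used by the test.\<close>

lemma post_polar:
  assumes "L2_set v {k<..n} > 0"
  shows "post (polar n k z v) = post z"
proof -
  have L: "L2_set (polar n k z v) {k<..n} = L2_set z {k<..n}"
  proof -
    have "L2_set (polar n k z v) {k<..n} = L2_set (\<lambda>i\<in>{k<..n}. (L2_set z {k<..n} / L2_set v {k<..n}) * v i) {k<..n}"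
      by (rule L2_set_cong) (auto simp: polar_def)
    also have "\<dots> = \<bar>L2_set z {k<..n} / L2_set v {k<..n}\<bar> * L2_set v {k<..n}" by (rule L2_set_scale)
    also have "\<dots> = L2_set z {k<..n}" using assms by simp
    finally show ?thesis .
  qed
  have "polar n k (polar n k z v) v' = polar n k z v'" for v'
    unfolding polar_def[of n k "polar n k z v"] L by (auto simp: polar_def)
  then show ?thesis by (intro ext) (simp only: post_def resample_def)
qed

lemma AE_tail_pos: "AE v in G. L2_set v {k<..n} > 0"
proof -
  have "AE y in gauss. y \<noteq> 0"
    by (subst AE_density) (use AE_lborel_singleton[of 0] in auto)
  then have "AE x in G. x n \<noteq> 0"
    unfolding std_gauss_def by (intro AE_PiM_component prob_space_gauss) (use kn in auto)
  then show ?thesis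
  proof eventually_elim
    case (elim x)
    then have "L2_set x {k<..n} \<noteq> 0" using kn by (auto simp: L2_set_eq_0_iff)
    then show ?case using L2_set_nonneg[of x "{k<..n}"] by linarith
  qed
qed

text \<open>Given \<open>z\<close>, the resampled statistic has law \<open>post z\<close> and, by
  \<open>post_polar\<close>, is tested against this same law. Rejection therefore means falling into
  the set \<open>C\<close> of rejected outcomes. A resampling direction of norm zero is a null
  event.\<close>

lemma reject_prob_inner:
  assumes \<alpha>: "\<alpha> \<le> 1" and z: "z \<in> space G"
  shows "(\<integral>\<^sup>+v. indicator {z \<in> space G. reject \<alpha> z} (polar n k z v) \<partial>G) \<le> ennreal (1 - \<alpha>)"
proof -
  define f where "f v = T0_stat n p X tie (resample z v) \<tau>0" for v
  define C where "C = {\<tau>. \<tau> \<in> Pow {1..p} \<and> \<not> accept \<alpha> z \<tau>}"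
  have finC: "finite C" by (simp add: C_def)
  have sets_f: "{v \<in> space G. f v \<in> S} \<in> sets G" for S
    unfolding f_def by (rule sets_T0_resample[OF z])
  have single: "{v \<in> space G. f v = \<tau>} \<in> sets G" for \<tau>
    using sets_f[of "{\<tau>}"] by simp
  have imp: "f v \<in> C" if L: "0 < L2_set v {k<..n}" and r: "reject \<alpha> (polar n k z v)" for v
  proof -
    have "\<not> accept \<alpha> z (f v)"
      using r unfolding reject_def accept_def post_polar[OF L, of z] resample_def f_def .
    then show ?thesis using T0_stat_subset by (simp add: C_def f_def)
  qed
  have "(\<integral>\<^sup>+v. indicator {z \<in> space G. reject \<alpha> z} (polar n k z v) \<partial>G) \<le> (\<integral>\<^sup>+v. indicator {v \<in> space G. f v \<in> C} v \<partial>G)"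
  proof (rule nn_integral_mono_AE)
    show "AE v in G. indicator {z \<in> space G. reject \<alpha> z} (polar n k z v) \<le> (indicator {v \<in> space G. f v \<in> C} v :: ennreal)"
      using AE_tail_pos AE_space
    proof eventually_elim
      case (elim v)
      then show ?case using imp[OF elim(1)] by (intro indicator_le_indicator) simp
    qed
  qed
  also have "\<dots> = emeasure G {v \<in> space G. f v \<in> C}"
    by (rule nn_integral_indicator[OF sets_f])
  also have "\<dots> = ennreal (\<P>(v in G. f v \<in> C))" by (rule G.emeasure_eq_measure)
  also have "\<P>(v in G. f v \<in> C) = (\<Sum>\<tau>\<in>C. post z \<tau>)"
  proof -
    have "{v \<in> space G. f v \<in> C} = (\<Union>\<tau>\<in>C. {v \<in> space G. f v = \<tau>})" by blast
    also have "measure G \<dots> = (\<Sum>\<tau>\<in>C. \<P>(v in G. f v = \<tau>))"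
      by (rule G.finite_measure_finite_Union[OF finC]) (auto simp: disjoint_family_on_def single)
    finally show ?thesis by (simp add: post_def f_def)
  qed
  also have "(\<Sum>\<tau>\<in>C. post z \<tau>) \<le> 1 - \<alpha>"
    unfolding C_def accept_def
    by (rule highest_probability_complement[where P="post z" and \<Omega>="Pow {1..p}"]) (simp_all only: post_def \<alpha> measure_nonneg finite_Pow_iff finite_atLeastAtMost)
  finally show ?thesis by (simp add: ennreal_leI)
qed

text \<open>\<open>polar\<close> resampling preserves the Gaussian law, so the rejection probability
  is the average of the conditional ones.\<close>

lemma reject_prob:
  assumes \<alpha>: "\<alpha> \<le> 1"
  shows "\<P>(z in G. reject \<alpha> z) \<le> 1 - \<alpha>"
proof -
  have "emeasure G {z \<in> space G. reject \<alpha> z} = (\<integral>\<^sup>+y. indicator {z \<in> space G. reject \<alpha> z} y \<partial>G)" by simp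
  also have "\<dots> = (\<integral>\<^sup>+z. \<integral>\<^sup>+v. indicator {z \<in> space G. reject \<alpha> z} (polar n k z v) \<partial>G \<partial>G)"
    by (rule nn_integral_std_gauss_polar[OF kn, symmetric]) measurable
  also have "\<dots> \<le> (\<integral>\<^sup>+z. ennreal (1 - \<alpha>) \<partial>G)" by (intro nn_integral_mono reject_prob_inner \<alpha>)
  also have "\<dots> = ennreal (1 - \<alpha>)" by (simp add: G.emeasure_space_1)
  finally show ?thesis using \<alpha> by (simp add: G.emeasure_eq_measure)
qed

lemma T0_cover:
  assumes \<alpha>: "\<alpha> \<le> 1"
  shows "{u \<in> space G. T0_stat n p X tie (obs u) \<tau>0 \<in> B_model n p X tie \<alpha> \<tau>0 (W_stat n X (obs u) \<tau>0)} \<in> sets G" (is "?E \<in> _")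
    and "\<alpha> \<le> \<P>(u in G. T0_stat n p X tie (obs u) \<tau>0 \<in> B_model n p X tie \<alpha> \<tau>0 (W_stat n X (obs u) \<tau>0))"
proof -
  have E: "?E = {u \<in> space G. \<not> reject \<alpha> (T u)}"
    using B_model_iff by (auto simp: reject_def rot_inv1[OF rT])
  have m: "{z \<in> space G. \<not> reject \<alpha> z} \<in> sets G" by measurable
  have "{u \<in> space G. \<not> reject \<alpha> (T u)} = T -` {z \<in> space G. \<not> reject \<alpha> z} \<inter> space G"
    using measurable_space[OF measurable_rot[OF rT]] by auto
  then show "?E \<in> sets G" unfolding E using measurable_sets[OF measurable_rot[OF rT] m] by simp
  have "measure G ?E = \<P>(z in G. \<not> reject \<alpha> z)"
    unfolding E by (rule measure_rot[OF rT m])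
  also have "\<dots> = 1 - \<P>(z in G. reject \<alpha> z)"
    using G.prob_neg[of "reject \<alpha>"] sets_reject[of \<alpha>] by simp
  finally show "\<alpha> \<le> measure G ?E" using reject_prob[OF \<alpha>] by simp
qed

end

section \<open>Coverage given the artificial noise\<close>

lemma (in pair_sigma_finite) measurable_measure_section:
  assumes E: "E \<in> sets (M1 \<Otimes>\<^sub>M M2)"
  shows "(\<lambda>y. measure M1 {x \<in> space M1. (x, y) \<in> E}) \<in> borel_measurable M2"
proof -
  have "(\<lambda>y. enn2real (emeasure M1 ((\<lambda>x. (x, y)) -` E))) \<in> borel_measurable M2"
    using measurable_emeasure_Pair2[OF E] by measurable
  moreover have "(\<lambda>x. (x, y)) -` E = {x \<in> space M1. (x, y) \<in> E}" for y
    using sets.sets_into_space[OF E] by (auto simp: space_pair_measure)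
  ultimately show ?thesis by (simp add: measure_def)
qed

text \<open>For a product measure, conditioning on the second coordinate is integration over the
  first. By Fubini it suffices to test on preimages of measurable sets under \<open>snd\<close>,
  which form the whole sub-sigma-algebra.\<close>

lemma cond_exp_section:
  fixes M1 :: "'a measure" and M2 :: "'b measure"
  assumes "prob_space M1" "prob_space M2" and E: "E \<in> sets (M1 \<Otimes>\<^sub>M M2)"
  defines "g \<equiv> \<lambda>y. measure M1 {x \<in> space M1. (x, y) \<in> E}"
  shows "measure (M1 \<Otimes>\<^sub>M M2) E = (\<integral>y. g y \<partial>M2)"
    and "AE \<omega> in M1 \<Otimes>\<^sub>M M2. real_cond_exp (M1 \<Otimes>\<^sub>M M2)
      (vimage_algebra (space (M1 \<Otimes>\<^sub>M M2)) snd M2) (indicator E) \<omega> = g (snd \<omega>)"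
proof -
  interpret M1: prob_space M1 by fact
  interpret M2: prob_space M2 by fact
  interpret P: pair_prob_space M1 M2 ..
  let ?M = "M1 \<Otimes>\<^sub>M M2" and ?F = "vimage_algebra (space (M1 \<Otimes>\<^sub>M M2)) snd M2"
  note [measurable] = E
  have g [measurable]: "g \<in> borel_measurable M2" unfolding g_def by (rule P.measurable_measure_section[OF E])
  have g1: "\<bar>g y\<bar> \<le> 1" for y by (simp add: g_def)
  have slice: "(\<integral>x. indicator E (x, y) \<partial>M1) = g y" if "y \<in> space M2" for y
  proof -
    have "{x \<in> space M1. (x, y) \<in> E} \<in> sets M1" using that by measurable
    moreover have "(\<integral>x. (indicator E (x, y) :: real) \<partial>M1) = (\<integral>x. indicator {x \<in> space M1. (x, y) \<in> E} x \<partial>M1)"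
      by (intro Bochner_Integration.integral_cong) (auto simp: indicator_def)
    ultimately show ?thesis by (simp add: g_def)
  qed
  have key: "(\<integral>\<omega>. indicator B (snd \<omega>) * indicator E \<omega> \<partial>?M) = (\<integral>y. indicator B y * g y \<partial>M2)"
    "(\<integral>\<omega>. indicator B (snd \<omega>) * g (snd \<omega>) \<partial>?M) = (\<integral>y. indicator B y * g y \<partial>M2)"
    if B [measurable]: "B \<in> sets M2" for B
  proof -
    have "integrable ?M (\<lambda>(x, y). indicator B y * indicator E (x, y) :: real)"
      by (intro P.integrable_const_bound[of _ 1]) (auto simp: indicator_def split_beta')
    from P.integral_snd[OF this]
    show "(\<integral>\<omega>. indicator B (snd \<omega>) * indicator E \<omega> \<partial>?M) = (\<integral>y. indicator B y * g y \<partial>M2)"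
      by (simp add: split_beta' slice cong: Bochner_Integration.integral_cong)
    have "integrable ?M (\<lambda>(x, y). indicator B y * g y)"
      using g1 by (intro P.integrable_const_bound[of _ 1]) (auto simp: indicator_def split_beta')
    from P.integral_snd[OF this]
    show "(\<integral>\<omega>. indicator B (snd \<omega>) * g (snd \<omega>) \<partial>?M) = (\<integral>y. indicator B y * g y \<partial>M2)"
      by (simp add: split_beta' M1.prob_space)
  qed
  show "measure ?M E = (\<integral>y. g y \<partial>M2)"
  proof -
    have "measure ?M E = (\<integral>\<omega>. (indicator (space M2) (snd \<omega>) * indicator E \<omega> :: real) \<partial>?M)"
    proof -
      have "(\<integral>\<omega>. (indicator (space M2) (snd \<omega>) * indicator E \<omega> :: real) \<partial>?M) = (\<integral>\<omega>. indicator E \<omega> \<partial>?M)"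
        by (intro Bochner_Integration.integral_cong) (auto simp: space_pair_measure)
      then show ?thesis by simp
    qed
    also have "\<dots> = (\<integral>y. indicator (space M2) y * g y \<partial>M2)" by (rule key) simp
    also have "\<dots> = (\<integral>y. g y \<partial>M2)" by (intro Bochner_Integration.integral_cong) auto
    finally show ?thesis .
  qed
  have snd_m: "snd \<in> space ?M \<rightarrow> space M2" by (auto simp: space_pair_measure)
  have sub: "subalgebra ?M ?F"
    unfolding subalgebra_def
    by (auto simp: sets_vimage_algebra2[OF snd_m] intro!: measurable_sets[OF measurable_snd])
  interpret finite_measure_subalgebra ?M ?F
    using sub by unfold_locales
  have gF: "(\<lambda>\<omega>. g (snd \<omega>)) \<in> borel_measurable ?F"
    by (rule measurable_compose[OF measurable_vimage_algebra1[OF snd_m] g])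
  show "AE \<omega> in ?M. real_cond_exp ?M ?F (indicator E) \<omega> = g (snd \<omega>)"
  proof (rule real_cond_exp_charact[OF _ _ _ gF])
    fix A assume "A \<in> sets ?F"
    then obtain B where B: "B \<in> sets M2" "A = snd -` B \<inter> space ?M" by (auto simp: sets_vimage_algebra2[OF snd_m])
    have "(\<integral>\<omega>\<in>A. f \<omega> \<partial>?M) = (\<integral>\<omega>. indicator B (snd \<omega>) * f \<omega> \<partial>?M)" for f :: "'a \<times> 'b \<Rightarrow> real"
      unfolding set_lebesgue_integral_def B(2) by (intro Bochner_Integration.integral_cong) (auto simp: indicator_def)
    then show "(\<integral>\<omega>\<in>A. indicator E \<omega> \<partial>?M) = (\<integral>\<omega>\<in>A. g (snd \<omega>) \<partial>?M)" using key[OF B(1)] by simp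
  next
    show "integrable ?M (indicator E :: _ \<Rightarrow> real)"
      by (rule integrable_real_indicator[OF E]) (simp add: P.emeasure_eq_measure)
    show "integrable ?M (\<lambda>\<omega>. g (snd \<omega>))"
      using g1 by (intro P.integrable_const_bound[of _ 1]) auto
  qed
qed

text \<open>A column depending on the others could hand its coefficient over to them, representing
  the same signal with fewer columns, against the minimality of \<open>\<tau>0\<close>.\<close>

lemma identifiable_rank:
  assumes ident: "identifiable n p X \<tau>0 \<beta>0" and \<tau>0: "\<tau>0 \<subseteq> {1..p}"
  shows "\<exists>T T'. qr n T T' (card \<tau>0) (sp X \<tau>0)"
proof -
  have fin: "finite \<tau>0" using \<tau>0 finite_subset by blast
  let ?R = "\<lambda>\<tau>. \<tau> \<subseteq> {1..p} \<and> (\<exists>\<beta>\<in>coeffs_of \<tau>. fit n X \<tau> \<beta> = fit n X \<tau>0 \<beta>0)"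
  have am: "is_arg_min card ?R \<tau>0" using ident unfolding identifiable_def by blast
  obtain T T' k where q: "qr n T T' k (sp X \<tau>0)"
    and k: "k = card \<tau>0 \<or> (\<exists>j\<in>\<tau>0. \<exists>v\<in>sp X (\<tau>0 - {j}). \<forall>i\<in>{1..n}. v i = X i j)"
    using qr_sp_rank[OF fin] by blast
  have "\<not> (\<exists>j\<in>\<tau>0. \<exists>v\<in>sp X (\<tau>0 - {j}). \<forall>i\<in>{1..n}. v i = X i j)"
  proof
    assume "\<exists>j\<in>\<tau>0. \<exists>v\<in>sp X (\<tau>0 - {j}). \<forall>i\<in>{1..n}. v i = X i j"
    then obtain j v where j: "j \<in> \<tau>0" and v: "v \<in> sp X (\<tau>0 - {j})" "\<forall>i\<in>{1..n}. v i = X i j" by blast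
    from v(1) obtain \<gamma> where "v = (\<lambda>i. \<Sum>l\<in>\<tau>0 - {j}. X i l * \<gamma> l)" unfolding sp_eq by blast
    with v(2) have \<gamma>: "(\<Sum>l\<in>\<tau>0 - {j}. X i l * \<gamma> l) = X i j" if "i \<in> {1..n}" for i using that by simp
    let ?\<beta> = "\<lambda>l\<in>\<tau>0 - {j}. \<beta>0 l + \<beta>0 j * \<gamma> l"
    have "(\<Sum>l\<in>\<tau>0 - {j}. X i l * ?\<beta> l) = (\<Sum>l\<in>\<tau>0. X i l * \<beta>0 l)" if i: "i \<in> {1..n}" for i
    proof -
      have "(\<Sum>l\<in>\<tau>0 - {j}. X i l * ?\<beta> l) = (\<Sum>l\<in>\<tau>0 - {j}. X i l * \<beta>0 l + \<beta>0 j * (X i l * \<gamma> l))"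
        by (intro sum.cong) (auto simp: algebra_simps)
      also have "\<dots> = (\<Sum>l\<in>\<tau>0 - {j}. X i l * \<beta>0 l) + \<beta>0 j * X i j"
        by (simp add: sum.distrib sum_distrib_left[symmetric] \<gamma>[OF i])
      also have "\<dots> = (\<Sum>l\<in>\<tau>0. X i l * \<beta>0 l)"
        using sum.remove[OF fin j, of "\<lambda>l. X i l * \<beta>0 l"] by (simp add: mult.commute)
      finally show ?thesis .
    qed
    then have "fit n X (\<tau>0 - {j}) ?\<beta> = fit n X \<tau>0 \<beta>0" unfolding fit_def by (intro restrict_ext)
    moreover have "?\<beta> \<in> coeffs_of (\<tau>0 - {j})" by (simp add: coeffs_of_def)
    ultimately have "?R (\<tau>0 - {j})" using \<tau>0 by blast
    moreover have "card (\<tau>0 - {j}) < card \<tau>0" using j fin by (rule card_Diff1_less[rotated])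
    ultimately show False using am unfolding is_arg_min_def by blast
  qed
  then show ?thesis using q k by blast
qed

lemma C_min_le:
  assumes \<tau>: "\<tau> \<subseteq> {1..p}" "\<tau> \<noteq> \<tau>0" "card \<tau> \<le> card \<tau>0" and n: "n \<ge> 1"
  shows "C_min n p X \<tau>0 \<beta>0 * (real n * real (max (card (\<tau>0 - \<tau>)) 1)) \<le> sqdist n (sp X \<tau>) (signal X \<tau>0 \<beta>0)"
proof -
  let ?d = "real n * real (max (card (\<tau>0 - \<tau>)) 1)"
  let ?f = "\<lambda>\<tau> \<beta>. (L2_set (\<lambda>i. fit n X \<tau>0 \<beta>0 i - fit n X \<tau> \<beta> i) {1..n})\<^sup>2"
  have fin: "finite \<tau>" using \<tau>(1) finite_subset by blast
  have d: "?d > 0" using n by (intro mult_pos_pos) auto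
  have c1: "C_min n p X \<tau>0 \<beta>0 \<le> (INF \<beta>\<in>coeffs_of \<tau>. ?f \<tau> \<beta> / ?d)"
    unfolding C_min_def
  proof (rule Min_le)
    show "finite ((\<lambda>\<tau>. INF \<beta>\<in>coeffs_of \<tau>. ?f \<tau> \<beta> / (real n * real (max (card (\<tau>0 - \<tau>)) 1)))
        ` {\<tau>. \<tau> \<subseteq> {1..p} \<and> \<tau> \<noteq> \<tau>0 \<and> card \<tau> \<le> card \<tau>0})"
      by (rule finite_imageI, rule finite_subset[of _ "Pow {1..p}"]) auto
  qed (use \<tau> in blast)
  have "C_min n p X \<tau>0 \<beta>0 * ?d \<le> ?f \<tau> \<beta>" if "\<beta> \<in> coeffs_of \<tau>" for \<beta>
  proof -
    have "(INF \<beta>\<in>coeffs_of \<tau>. ?f \<tau> \<beta> / ?d) \<le> ?f \<tau> \<beta> / ?d"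
      by (rule cINF_lower[OF _ that]) (intro bdd_belowI2[of _ 0] divide_nonneg_nonneg, auto)
    then have "C_min n p X \<tau>0 \<beta>0 \<le> ?f \<tau> \<beta> / ?d" using c1 by simp
    then show ?thesis using d by (simp add: pos_le_divide_eq)
  qed
  moreover have "(L2_set (\<lambda>i. signal X \<tau>0 \<beta>0 i - fit n X \<tau> \<beta> i) {1..n}) = L2_set (\<lambda>i. fit n X \<tau>0 \<beta>0 i - fit n X \<tau> \<beta> i) {1..n}" for \<beta>
    by (rule L2_set_cong) (auto simp: fit_def)
  moreover have "coeffs_of \<tau> \<noteq> {}" by (auto simp: coeffs_of_def PiE_eq_empty_iff)
  ultimately show ?thesis unfolding INF_coeffs[OF fin, symmetric] by (intro cINF_greatest) auto
qed

lemma prob_space_Ud_law: "prob_space (Ud_law n d)"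
  unfolding Ud_law_def by (rule prob_space_PiM) (rule prob_space_std_gauss)

lemma measurable_Ud_component: "b \<in> {1..d} \<Longrightarrow> (\<lambda>us. us b) \<in> Ud_law n d \<rightarrow>\<^sub>M std_gauss n"
  unfolding Ud_law_def by (rule measurable_component_singleton)

lemma measure_Ud_component:
  assumes b: "b \<in> {1..d}" and P: "{w \<in> space (std_gauss n). P w} \<in> sets (std_gauss n)"
  shows "\<P>(us in Ud_law n d. P (us b)) = \<P>(w in std_gauss n. P w)"
proof -
  have "distr (Ud_law n d) (std_gauss n) (\<lambda>us. us b) = std_gauss n"
    unfolding Ud_law_def by (rule distr_PiM_component) (use b prob_space_std_gauss in auto)
  then have "\<P>(w in std_gauss n. P w)
     = measure (distr (Ud_law n d) (std_gauss n) (\<lambda>us. us b)) {w \<in> space (std_gauss n). P w}" by simp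
  also have "\<dots> = measure (Ud_law n d) ((\<lambda>us. us b) -` {w \<in> space (std_gauss n). P w} \<inter> space (Ud_law n d))"
    by (rule measure_distr[OF measurable_Ud_component[OF b] P])
  also have "(\<lambda>us. us b) -` {w \<in> space (std_gauss n). P w} \<inter> space (Ud_law n d) = {us \<in> space (Ud_law n d). P (us b)}"
    using measurable_space[OF measurable_Ud_component[OF b, of n]] by auto
  finally show ?thesis ..
qed

text \<open>Coverage splits into three events; the artificial noise enters the first one
  alone.\<close>

lemma joint_conf_set_iff:
  assumes "\<beta>0 \<in> coeffs_of \<tau>0"
  shows "(\<tau>0, \<beta>0) \<in> joint_conf_set n p X lam tieS tieT d \<alpha>1 \<alpha>2 us y \<longleftrightarrow>
    (\<exists>b\<in>{1..d}. tau_hat n p X lam tieS (us b) y = \<tau>0) \<and>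
    T0_stat n p X tieT y \<tau>0 \<in> B_model n p X tieT \<alpha>1 \<tau>0 (W_stat n X y \<tau>0) \<and>
    F_stat n X y (\<tau>0, \<beta>0) \<in> B_joint n \<alpha>2 (\<tau>0, \<beta>0)"
  using assms unfolding joint_conf_set_def model_conf_set_def candidates_def by auto

context regression
begin

lemma measurable_tau_hat:
  assumes b: "b \<in> {1..d}"
  shows "(\<lambda>(u, us). tau_hat n p X lam tie (us b) (obs u)) \<in> joint_law n d \<rightarrow>\<^sub>M count_space UNIV"
proof -
  have pair: "(\<lambda>z. (obs (fst z), snd z b)) \<in> joint_law n d \<rightarrow>\<^sub>M G \<Otimes>\<^sub>M G"
    unfolding joint_law_def
    by (intro measurable_Pair measurable_compose[OF measurable_fst measurable_observation]
        measurable_compose[OF measurable_snd measurable_Ud_component[OF b]])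
  have "(\<lambda>z. tie {\<tau>. is_arg_min (\<lambda>\<tau>. crit (snd z b) \<tau> (obs (fst z))) (\<lambda>\<tau>. \<tau> \<in> Pow {1..p}) \<tau>}) \<in> joint_law n d \<rightarrow>\<^sub>M count_space UNIV"
  proof (rule measurable_tie_arg_min)
    fix \<tau> assume "\<tau> \<in> Pow {1..p}"
    then have "finite \<tau>" using fin_sub by simp
    from measurable_compose[OF pair measurable_sqdist_adj[OF this]]
    have [measurable]: "(\<lambda>z. sqdist n (adj (snd z b) (sp X \<tau>)) (obs (fst z))) \<in> borel_measurable (joint_law n d)"
      by (simp only: prod.case)
    show "(\<lambda>z. crit (snd z b) \<tau> (obs (fst z))) \<in> borel_measurable (joint_law n d)" by measurable
  qed simp
  then show ?thesis by (simp only: split_beta' tau_hat_eq Pow_iff)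
qed

text \<open>The events \<open>A\<close> and \<open>B\<close> of the two tests do not involve
  \<open>us\<close>, so their levels hold in every section. Only the selection error depends on
  \<open>us\<close>, through its first component.\<close>

lemma coverage_section:
  assumes K: "confidence n p X \<tau>0 \<sigma> tieT T T' (card \<tau>0)"
    and \<beta>0: "\<beta>0 \<in> coeffs_of \<tau>0" and d: "d \<ge> 1"
    and \<alpha>1: "\<alpha>1 < 1" and \<alpha>2: "0 < \<alpha>2" "\<alpha>2 < 1"
    and E: "E = {(u, us) \<in> space (joint_law n d). (\<tau>0, \<beta>0) \<in> joint_conf_set n p X lam tie tieT d \<alpha>1 \<alpha>2 us (obs u)}"
  shows "E \<in> sets (joint_law n d)"
    and "us \<in> space (Ud_law n d) \<Longrightarrow> good (us 1) \<Longrightarrow>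
      \<alpha>1 + \<alpha>2 - 1 - 90 * exp (- (real n * t / (16 * \<sigma>\<^sup>2))) \<le> \<P>(u in G. (u, us) \<in> E)"
proof -
  interpret K: confidence n p X \<tau>0 \<beta>0 \<sigma> tieT T T' "card \<tau>0" by fact
  define A where "A = {u \<in> space G. T0_stat n p X tieT (obs u) \<tau>0 \<in> B_model n p X tieT \<alpha>1 \<tau>0 (W_stat n X (obs u) \<tau>0)}"
  define B where "B = {u \<in> space G. F_stat n X (obs u) (\<tau>0, \<beta>0) \<in> B_joint n \<alpha>2 (\<tau>0, \<beta>0)}"
  have A: "A \<in> sets G" "\<alpha>1 \<le> measure G A" unfolding A_def using K.T0_cover[of \<alpha>1] \<alpha>1 by auto
  have B: "B \<in> sets G" "\<alpha>2 \<le> measure G B" unfolding B_def by (rule K.F_stat_cover[OF refl \<alpha>2])+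
  define H where "H b = {z \<in> space (joint_law n d). tau_hat n p X lam tie (snd z b) (obs (fst z)) = \<tau>0}" for b
  have H: "H b \<in> sets (joint_law n d)" if "b \<in> {1..d}" for b
    using measurable_sets[OF measurable_tau_hat[OF that], of "{\<tau>0}"]
    by (simp add: H_def vimage_def Int_def conj_commute split_beta')
  have Eeq: "E = (\<Union>b\<in>{1..d}. H b) \<inter> ((A \<inter> B) \<times> space (Ud_law n d))"
  proof (rule set_eqI)
    fix z :: "(nat \<Rightarrow> real) \<times> (nat \<Rightarrow> nat \<Rightarrow> real)"
    obtain u ws where z: "z = (u, ws)" by (cases z)
    have U: "z \<in> (\<Union>b\<in>{1..d}. H b) \<longleftrightarrow> z \<in> space (joint_law n d) \<and> (\<exists>b\<in>{1..d}. tau_hat n p X lam tie (ws b) (obs u) = \<tau>0)"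
      unfolding H_def z by auto
    show "z \<in> E \<longleftrightarrow> z \<in> (\<Union>b\<in>{1..d}. H b) \<inter> ((A \<inter> B) \<times> space (Ud_law n d))"
      unfolding Int_iff[of z] U unfolding z E A_def B_def joint_conf_set_iff[OF \<beta>0] joint_law_def space_pair_measure
      by blast
  qed
  have AB: "(A \<inter> B) \<times> space (Ud_law n d) \<in> sets (joint_law n d)"
    unfolding joint_law_def using A B by (intro pair_measureI) auto
  show Es: "E \<in> sets (joint_law n d)"
    unfolding Eeq using H AB by (intro sets.Int sets.finite_UN) auto
  assume us: "us \<in> space (Ud_law n d)" and good: "good (us 1)"
  define S where "S = {u \<in> space G. tau_hat n p X lam tie (us 1) (obs u) \<noteq> \<tau>0}"
  have S: "measure G S \<le> 90 * exp (- (real n * t / (16 * \<sigma>\<^sup>2)))"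
    unfolding S_def by (rule tau_hat_miss_prob[OF good])
  have us1: "us 1 \<in> space G" by (rule measurable_space[OF measurable_Ud_component us]) (use d in auto)
  have Ss: "S \<in> sets G"
  proof -
    have "(\<lambda>u. (u, us)) \<in> G \<rightarrow>\<^sub>M joint_law n d" unfolding joint_law_def by (rule measurable_Pair2'[OF us])
    from measurable_compose[OF this measurable_tau_hat[of 1]] d
    have "(\<lambda>u. tau_hat n p X lam tie (us 1) (obs u)) \<in> G \<rightarrow>\<^sub>M count_space UNIV" by simp
    from measurable_sets[OF this, of "- {\<tau>0}"] show ?thesis
      by (simp add: S_def vimage_def Int_def conj_commute)
  qed
  \<comment> \<open>Union bound over the three ways to fail: model test, F test, selection.\<close>
  have "\<alpha>1 + \<alpha>2 - 1 - measure G S \<le> measure G ((A \<inter> B) - S)"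
  proof -
    have "measure G (space G - ((A \<inter> B) - S)) \<le> measure G ((space G - A) \<union> (space G - B) \<union> S)"
      using A B Ss by (intro G.finite_measure_mono) auto
    also have "\<dots> \<le> measure G (space G - A) + measure G (space G - B) + measure G S"
      using measure_Un_le[of "(space G - A) \<union> (space G - B)" G S] measure_Un_le[of "space G - A" G "space G - B"] A B Ss
      by (auto intro: order_trans)
    finally show ?thesis
      using A B Ss G.prob_compl[of A] G.prob_compl[of B] G.prob_compl[of "(A \<inter> B) - S"] by simp
  qed
  also have "\<dots> \<le> \<P>(u in G. (u, us) \<in> E)"
  proof (rule G.finite_measure_mono)
    show "(A \<inter> B) - S \<subseteq> {u \<in> space G. (u, us) \<in> E}"
    proof
      fix u assume u: "u \<in> (A \<inter> B) - S"
      then have uG: "u \<in> space G" by (simp add: A_def)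
      have "(u, us) \<in> H 1" using u uG us by (simp add: H_def S_def joint_law_def space_pair_measure)
      then show "u \<in> {u \<in> space G. (u, us) \<in> E}" unfolding Eeq using u uG us d by auto
    qed
    have "(\<lambda>u. (u, us)) \<in> G \<rightarrow>\<^sub>M joint_law n d" unfolding joint_law_def by (rule measurable_Pair2'[OF us])
    from measurable_sets[OF this Es] show "{u \<in> space G. (u, us) \<in> E} \<in> sets G"
      by (simp add: vimage_def Int_def conj_commute)
  qed
  finally show "\<alpha>1 + \<alpha>2 - 1 - 90 * exp (- (real n * t / (16 * \<sigma>\<^sup>2))) \<le> \<P>(u in G. (u, us) \<in> E)"
    using S by simp
qed

text \<open>The at most \<open>3 p\<^sup>s\<close> models of size \<open>s = |\<tau>\<^sub>0|\<close> or less contribute \<open>exp (0.23 n)\<close>, which is beaten by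
  the alignment bound \<open>3 powr (- (n - s) / 2)\<close>.\<close>

lemma bad_prob_exp:
  assumes s: "real (card \<tau>0) \<le> 0.35 * real n" and dim: "real (card \<tau>0) * ln (real p) \<le> 0.23 * real n"
  shows "\<P>(w in G. \<not> good w) \<le> 9 * exp (- 0.09 * real n)"
proof -
  have "real (card \<tau>0) < real n" using s n by simp
  then have sn: "card \<tau>0 < n" by simp
  have pw: "real p ^ card \<tau>0 \<le> exp (0.23 * real n)"
  proof -
    have "real p ^ card \<tau>0 = exp (real (card \<tau>0) * ln (real p))"
      using p_pos by (simp add: exp_of_nat_mult)
    then show ?thesis using dim by simp
  qed
  have exp_half: "(exp (1/2 :: real))\<^sup>2 \<le> 3" using exp_le by (simp add: exp_double[symmetric])
  have root: "1 / sqrt 3 \<le> exp (- (1/2 :: real))"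
  proof -
    have "exp (1/2 :: real) \<le> sqrt 3" using exp_half by (rule real_le_rsqrt)
    then show ?thesis by (simp add: exp_minus divide_simps)
  qed
  \<comment> \<open>As s \<le> 0.35 n, the exponent satisfies (n - s - 1) / 2 \<ge> 0.325 n -
    1/2.\<close>
  have pw3: "(1 / sqrt 3) ^ (n - card \<tau>0 - 1) \<le> exp (1 / 2 - 0.325 * real n)"
  proof -
    have "(1 / sqrt 3) ^ (n - card \<tau>0 - 1) \<le> exp (- (1/2 :: real)) ^ (n - card \<tau>0 - 1)"
      by (rule power_mono[OF root]) simp
    also have "\<dots> = exp (real (n - card \<tau>0 - 1) * (- (1/2)))" by (rule exp_of_nat_mult[symmetric])
    also have "\<dots> \<le> exp (1 / 2 - 0.325 * real n)"
    proof -
      have r: "real (n - card \<tau>0 - 1) = real n - real (card \<tau>0) - 1" using sn by simp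
      show ?thesis unfolding exp_le_cancel_iff r using s by (simp add: field_simps)
    qed
    finally show ?thesis .
  qed
  have "\<P>(w in G. \<not> good w) \<le> 3 * real p ^ card \<tau>0 * (sqrt 2 * (1 / sqrt 3) ^ (n - card \<tau>0 - 1))"
    by (rule bad_prob[OF sn])
  also have "\<dots> \<le> 3 * exp (0.23 * real n) * (1.5 * exp (1 / 2 - 0.325 * real n))"
  proof (intro mult_mono)
    show "sqrt 2 \<le> (1.5 :: real)" by (rule real_le_lsqrt) (auto simp: power2_eq_square)
  qed (use pw pw3 in auto)
  \<comment> \<open>0.23 - 0.325 = -0.095; the rate is then rounded to 0.09, and exp (1/2) \<le> 2
    gives the factor 9.\<close>
  also have "\<dots> = 4.5 * exp (1 / 2) * exp (- 0.095 * real n)"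
  proof -
    have "exp (0.23 * real n) * exp (1 / 2 - 0.325 * real n) = exp (1 / 2) * exp (- 0.095 * real n)"
      unfolding exp_add[symmetric] by (rule arg_cong[of _ _ exp]) simp
    then show ?thesis by simp
  qed
  also have "\<dots> \<le> 9 * exp (- 0.09 * real n)"
  proof (rule mult_mono)
    have "(exp (1/2 :: real))\<^sup>2 \<le> 2\<^sup>2" using exp_half by simp
    then have "exp (1/2 :: real) \<le> 2" by (rule power2_le_imp_le) simp
    then show "4.5 * exp (1 / 2) \<le> (9 :: real)" by simp
  qed auto
  finally show ?thesis .
qed

end

section \<open>Asymptotics\<close>

lemma exp_neg_tendsto_0:
  fixes a :: real
  assumes "a > 0"
  shows "(\<lambda>n. exp (- a * real n)) \<longlonglongrightarrow> 0"
proof -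
  have "exp (- a * real n) = exp (- a) ^ n" for n
    using exp_of_nat_mult[of n "- a"] by (simp add: mult.commute)
  moreover have "(\<lambda>n. exp (- a) ^ n) \<longlonglongrightarrow> 0" using assms by (intro LIMSEQ_realpow_zero) auto
  ultimately show ?thesis by simp
qed

lemma exp_neg_smallo:
  fixes a b :: real
  assumes "b < a"
  shows "(\<lambda>n. exp (- a * real n)) \<in> o(\<lambda>n. exp (- b * real n))"
proof (rule smalloI_tendsto)
  have "exp (- a * real n) / exp (- b * real n) = exp (- (a - b) * real n)" for n
    unfolding exp_diff[symmetric] by (rule arg_cong[of _ _ exp]) (simp add: algebra_simps)
  then show "(\<lambda>n. exp (- a * real n) / exp (- b * real n)) \<longlonglongrightarrow> 0"
    using exp_neg_tendsto_0[of "a - b"] assms by simp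
qed simp

text \<open>The two thresholds on \<open>n\<close> serve the case p = 1, where ln (p / 2) is
  negative and bounds on logarithms of \<open>p\<close> say nothing about \<open>s\<close>.\<close>

lemma regression_asymptotic:
  fixes \<sigma> t lam C :: real and n p s :: nat
  assumes n: "n \<ge> 3" "real n \<ge> 24 * \<sigma>\<^sup>2 / t" and p: "p \<ge> 1" and s: "1 \<le> s" "s \<le> p" and \<sigma>: "\<sigma> > 0" and t: "t > 0"
    and lam: "6 * \<sigma>\<^sup>2 * ((real s + 1) * ln (real p / 2) / real n) + t \<le> lam / real n" "lam / real n \<le> 0.05 * C"
    and dim: "real s * ln (real p) / real n < 0.23"
    and sig: "120 * ((real s + 2) * ln (real p + 1) / real n) * \<sigma>\<^sup>2 < C"
  shows "6 * \<sigma>\<^sup>2 * ((real s + 1) * ln (real p / 2)) + real n * t \<le> lam"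
    and "lam \<le> 0.05 * C * real n" and "10 * t \<le> C"
    and "120 * ((real s + 2) * ln (real p + 1)) * \<sigma>\<^sup>2 \<le> C * real n"
    and "real s \<le> 0.35 * real n" and "real s * ln (real p) \<le> 0.23 * real n"
proof -
  have n0: "real n > 0" using n by simp
  show "6 * \<sigma>\<^sup>2 * ((real s + 1) * ln (real p / 2)) + real n * t \<le> lam"
  proof -
    have "(c * (A / N) + t) * N = c * A + N * t" if "N > 0" for c A N :: real
      using that by (simp add: field_simps)
    from this[OF n0] mult_right_mono[OF lam(1), of "real n"] n0 show ?thesis by simp
  qed
  show "lam \<le> 0.05 * C * real n" using lam(2) n0 by (simp add: pos_divide_le_eq)
  show "120 * ((real s + 2) * ln (real p + 1)) * \<sigma>\<^sup>2 \<le> C * real n"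
    using mult_right_mono[OF less_imp_le[OF sig], of "real n"] n0 by (simp add: mult_ac)
  show d: "real s * ln (real p) \<le> 0.23 * real n" using dim n0 by (simp add: pos_divide_less_eq)
  have "t / 2 \<le> lam / real n"
  proof (cases "p \<ge> 2")
    case True
    then have "0 \<le> 6 * \<sigma>\<^sup>2 * ((real s + 1) * ln (real p / 2) / real n)"
      by (intro mult_nonneg_nonneg divide_nonneg_nonneg) auto
    then show ?thesis using lam(1) t by linarith
  next
    case False
    \<comment> \<open>The logarithmic term equals -12 \<sigma>^2 ln 2 / n, and n \<ge> 24 \<sigma>^2
      / t keeps it above - t / 2.\<close>
    then have ps: "p = 1" "s = 1" using p s by auto
    have "ln (2 :: real) \<le> 1" using ln_le_minus_one[of 2] by simp
    then have "12 * \<sigma>\<^sup>2 * ln 2 \<le> 12 * \<sigma>\<^sup>2 * 1" by (intro mult_left_mono) auto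
    moreover have "24 * \<sigma>\<^sup>2 \<le> real n * t" using n(2) t by (simp add: pos_divide_le_eq)
    ultimately have "12 * \<sigma>\<^sup>2 * ln 2 \<le> (t / 2) * real n" by (simp add: mult.commute)
    then have "12 * \<sigma>\<^sup>2 * ln 2 / real n \<le> t / 2" using n0 by (simp add: pos_divide_le_eq)
    moreover have "6 * \<sigma>\<^sup>2 * ((real s + 1) * ln (real p / 2) / real n) = - (12 * \<sigma>\<^sup>2 * ln 2 / real n)"
      unfolding ps by (simp add: ln_div)
    ultimately show ?thesis using lam(1) by linarith
  qed
  then have "t / 2 \<le> 0.05 * C" using lam(2) by (rule order_trans)
  then show "10 * t \<le> C" by simp
  show "real s \<le> 0.35 * real n"
  proof (cases "p \<ge> 2")
    case True
    \<comment> \<open>0.23 * 3/2 = 0.345, which explains the bound 0.35.\<close>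
    have "2 / 3 \<le> ln (2 :: real)" by (rule ln2_ge_two_thirds)
    also have "\<dots> \<le> ln (real p)" using True by simp
    finally have "real s * (2 / 3) \<le> real s * ln (real p)" by (intro mult_left_mono) auto
    then show ?thesis using d by simp
  next
    case False
    \<comment> \<open>Here s = 1, and n \<ge> 3 gives 0.35 n \<ge> 1.05.\<close>
    then show ?thesis using s n by simp
  qed
qed

theorem theorem15:
  fixes p :: "nat \<Rightarrow> nat"
    and X :: "nat \<Rightarrow> nat \<Rightarrow> nat \<Rightarrow> real"
    and \<tau>0 :: "nat \<Rightarrow> nat set"
    and \<beta>0 :: "nat \<Rightarrow> nat \<Rightarrow> real"
    and lam :: "nat \<Rightarrow> real"
    and tieS tieT :: "nat \<Rightarrow> nat set set \<Rightarrow> nat set"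
    and \<sigma>0 t \<alpha> \<alpha>1 \<alpha>2 :: real
    and d :: nat
    and E :: "nat \<Rightarrow> ((nat \<Rightarrow> real) \<times> (nat \<Rightarrow> nat \<Rightarrow> real)) set"
  assumes levels: "1/2 < \<alpha>1" "\<alpha>1 < 1" "1/2 < \<alpha>2" "\<alpha>2 < 1" "\<alpha>1 + \<alpha>2 - 1 = \<alpha>"
    and sigma0: "\<sigma>0 > 0"
    and t: "t > 0"
    and d: "d \<ge> 1"
    and p: "\<And>n. n \<ge> 1 \<Longrightarrow> p n \<ge> 1"
    and tau0: "\<And>n. n \<ge> 1 \<Longrightarrow> \<tau>0 n \<subseteq> {1..p n}" "\<And>n. n \<ge> 1 \<Longrightarrow> \<tau>0 n \<noteq> {}"
    and beta0: "\<And>n. n \<ge> 1 \<Longrightarrow> \<beta>0 n \<in> coeffs_of (\<tau>0 n)"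
    and ident: "\<And>n. n \<ge> 1 \<Longrightarrow> identifiable n (p n) (X n) (\<tau>0 n) (\<beta>0 n)"
    and C_pos: "\<And>n. n \<ge> 1 \<Longrightarrow> C_min n (p n) (X n) (\<tau>0 n) (\<beta>0 n) > 0"
    and lam_pos: "\<And>n. n \<ge> 1 \<Longrightarrow> lam n > 0"
    and ties: "\<And>n. n \<ge> 1 \<Longrightarrow> tie_rule (tieS n)" "\<And>n. n \<ge> 1 \<Longrightarrow> tie_rule (tieT n)"
    and lam_range: "\<forall>\<^sub>F n in sequentially.
       lam n / real n \<in> {6 * \<sigma>0\<^sup>2 * ((real (card (\<tau>0 n)) + 1) * ln (real (p n) / 2) / real n) + t
                         .. 0.05 * C_min n (p n) (X n) (\<tau>0 n) (\<beta>0 n)}"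
    and dim_growth: "\<forall>\<^sub>F n in sequentially.
       real (card (\<tau>0 n)) * ln (real (p n)) / real n < 0.23"
    and signal: "\<forall>\<^sub>F n in sequentially.
       C_min n (p n) (X n) (\<tau>0 n) (\<beta>0 n)
         > 120 * ((real (card (\<tau>0 n)) + 2) * ln (real (p n) + 1) / real n) * \<sigma>0\<^sup>2"
    and coverage: "\<And>n. E n =
       {(u, us) \<in> space (joint_law n d).
          (\<tau>0 n, \<beta>0 n) \<in> joint_conf_set n (p n) (X n) (lam n) (tieS n) (tieT n) d \<alpha>1 \<alpha>2 us
                            (observation n (X n) (\<tau>0 n) (\<beta>0 n) \<sigma>0 u)}"
  shows "\<exists>c2>0.
     (\<exists>r \<in> o(\<lambda>n. exp (- c2 * real n)).
        \<forall>\<^sub>F n in sequentially. measure (joint_law n d) (E n) \<ge> \<alpha> - r n) \<and>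
     (\<exists>R. little_op (\<lambda>n. Ud_law n d) R (\<lambda>n. exp (- c2 * real n)) \<and>
        (\<forall>\<^sub>F n in sequentially. AE \<omega> in joint_law n d.
           real_cond_exp (joint_law n d) (Ud_algebra n d) (indicator (E n)) \<omega> \<ge> \<alpha> - R n (snd \<omega>)))"
proof -
  let ?C = "\<lambda>n. C_min n (p n) (X n) (\<tau>0 n) (\<beta>0 n)"
  let ?G = std_gauss and ?U = "\<lambda>n. Ud_law n d" and ?J = "\<lambda>n. joint_law n d"
  define ok where "ok n \<longleftrightarrow> n \<ge> 1 \<and> regression n (p n) (X n) (\<tau>0 n) (\<beta>0 n) \<sigma>0 (lam n) t (?C n) (tieS n) \<and>
    real (card (\<tau>0 n)) \<le> 0.35 * real n \<and> real (card (\<tau>0 n)) * ln (real (p n)) \<le> 0.23 * real n" for n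
  have ev_ok: "\<forall>\<^sub>F n in sequentially. ok n"
    using lam_range dim_growth signal eventually_ge_at_top[of 3]
      eventually_ge_at_top[of "nat \<lceil>24 * \<sigma>0\<^sup>2 / t\<rceil>"]
  proof eventually_elim
    case (elim n)
    have n: "n \<ge> 1" "n \<ge> 3" using elim(4) by auto
    have nt: "real n \<ge> 24 * \<sigma>0\<^sup>2 / t" using elim(5) by linarith
    have fin: "finite (\<tau>0 n)" using tau0(1)[OF n(1)] finite_subset by blast
    have s: "1 \<le> card (\<tau>0 n)" "card (\<tau>0 n) \<le> p n"
      using card_gt_0_iff[of "\<tau>0 n"] fin tau0(2)[OF n(1)] card_mono[OF _ tau0(1)[OF n(1)]] by auto
    have l: "6 * \<sigma>0\<^sup>2 * ((real (card (\<tau>0 n)) + 1) * ln (real (p n) / 2) / real n) + t \<le> lam n / real n"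
      "lam n / real n \<le> 0.05 * ?C n" using elim(1) by auto
    note A = regression_asymptotic[OF n(2) nt p[OF n(1)] s sigma0 t l elim(2,3)]
    have "regression n (p n) (X n) (\<tau>0 n) (\<beta>0 n) \<sigma>0 (lam n) t (?C n) (tieS n)"
      by (rule regression.intro) (use n tau0 sigma0 t ties C_min_le lam_pos A in auto)
    then show ?case using A n unfolding ok_def by blast
  qed
  define gd where "gd n = regression.good n (p n) (X n) (\<tau>0 n) (\<beta>0 n)" for n
  define bad where "bad n = {w \<in> space (?G n). \<not> gd n w}" for n
  \<comment> \<open>The slower of the selection rate, valid for harmless artificial noise, and the
    rate at which harmful noise becomes unlikely.\<close>
  define a where "a = min (t / (16 * \<sigma>0\<^sup>2)) 0.09"
  have a: "a > 0" using t sigma0 by (simp add: a_def)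
  define e where "e n = exp (- a * real n)" for n
  define g where "g n us = \<P>(u in ?G n. (u, us) \<in> E n)" for n us
  \<comment> \<open>On the bad event the indicator makes the bound trivial. Off \<open>ok\<close>
    the remainder is set to 0, because \<open>little_op\<close> asks for measurability at every
    \<open>n\<close>.\<close>
  define R where "R n us = (if ok n then indicator (bad n) (us 1) + 90 * e n else 0 :: real)"
    for n and us :: "nat \<Rightarrow> nat \<Rightarrow> real"
  have one: "1 \<in> {1..d}" using d by simp
  have us1: "us 1 \<in> space (?G n)" if "us \<in> space (?U n)" for n and us :: "nat \<Rightarrow> nat \<Rightarrow> real"
    by (rule measurable_space[OF measurable_Ud_component[OF one] that])
  have \<alpha>1: "\<alpha> \<le> 1" using levels by simp
  have sets_bad: "bad n \<in> sets (?G n)" if "ok n" for n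
  proof -
    interpret r: regression n "p n" "X n" "\<tau>0 n" "\<beta>0 n" \<sigma>0 "lam n" t "?C n" "tieS n" using that by (simp add: ok_def)
    have "bad n = space (?G n) - {w \<in> space (?G n). r.good w}" by (auto simp: bad_def gd_def)
    then show ?thesis using sets.compl_sets[OF r.sets_good] by simp
  qed
  have sets_bad1: "{us \<in> space (?U n). us 1 \<in> bad n} \<in> sets (?U n)" if "ok n" for n
    using measurable_sets[OF measurable_Ud_component[OF one] sets_bad[OF that]]
    by (simp add: vimage_def Int_def conj_commute)
  have bad: "\<P>(us in ?U n. us 1 \<in> bad n) \<le> 9 * e n" if "ok n" for n
  proof -
    interpret r: regression n "p n" "X n" "\<tau>0 n" "\<beta>0 n" \<sigma>0 "lam n" t "?C n" "tieS n" using that by (simp add: ok_def)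
    have eq: "{w \<in> space (?G n). w \<in> bad n} = {w \<in> space (?G n). \<not> gd n w}" by (auto simp: bad_def)
    have "\<P>(us in ?U n. us 1 \<in> bad n) = \<P>(w in ?G n. w \<in> bad n)"
      by (rule measure_Ud_component[OF one]) (use sets_bad[OF that] in \<open>simp add: eq bad_def\<close>)
    also have "\<dots> \<le> 9 * exp (- 0.09 * real n)"
      unfolding eq gd_def by (rule r.bad_prob_exp) (use that in \<open>auto simp: ok_def\<close>)
    also have "\<dots> \<le> 9 * e n"
    proof -
      have "a * real n \<le> 0.09 * real n" unfolding a_def by (intro mult_right_mono) auto
      then show ?thesis by (simp add: e_def)
    qed
    finally show ?thesis .
  qed
  have core: "E n \<in> sets (?J n) \<and> (\<forall>us\<in>space (?U n). \<alpha> - R n us \<le> g n us)" if ok: "ok n" for n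
  proof -
    interpret r: regression n "p n" "X n" "\<tau>0 n" "\<beta>0 n" \<sigma>0 "lam n" t "?C n" "tieS n" using ok by (simp add: ok_def)
    obtain T T' where q: "qr n T T' (card (\<tau>0 n)) (sp (X n) (\<tau>0 n))"
      using identifiable_rank[OF ident tau0(1)] r.n by blast
    have "real (card (\<tau>0 n)) < real n" using ok r.n by (simp add: ok_def)
    then have K: "confidence n (p n) (X n) (\<tau>0 n) \<sigma>0 (tieT n) T T' (card (\<tau>0 n))"
      by (intro confidence.intro q tau0(1) sigma0 ties(2) r.n) simp
    note cov = r.coverage_section[OF K beta0[OF r.n] d levels(2) _ levels(4) coverage]
    have \<alpha>2: "0 < \<alpha>2" using levels by simp
    have "\<alpha> - R n us \<le> g n us" if us: "us \<in> space (?U n)" for us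
    proof (cases "gd n (us 1)")
      case True
      have "a * real n \<le> t / (16 * \<sigma>0\<^sup>2) * real n" unfolding a_def by (intro mult_right_mono) auto
      then have "exp (- (real n * t / (16 * \<sigma>0\<^sup>2))) \<le> e n" by (simp add: e_def mult.commute)
      moreover have "R n us = 90 * e n" using True ok by (simp add: R_def bad_def)
      moreover have "\<alpha>1 + \<alpha>2 - 1 - 90 * exp (- (real n * t / (16 * \<sigma>0\<^sup>2))) \<le> g n us"
        unfolding g_def by (rule cov(2)[OF \<alpha>2 us]) (use True in \<open>simp add: gd_def\<close>)
      ultimately show ?thesis using levels(5) by linarith
    next
      case False
      \<comment> \<open>The remainder exceeds 1, hence \<alpha>, so the lower bound is
        nonpositive.\<close>
      then have "R n us = 1 + 90 * e n" using ok us1[OF us] by (simp add: R_def bad_def)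
      moreover have "0 \<le> g n us" "0 \<le> e n" by (simp_all add: g_def e_def)
      ultimately show ?thesis using \<alpha>1 by linarith
    qed
    then show ?thesis using cov(1)[OF \<alpha>2] by blast
  qed
  have Rm: "R n \<in> borel_measurable (?U n)" for n
  proof (cases "ok n")
    case True
    have "(\<lambda>us. indicator (bad n) (us 1) :: real) \<in> borel_measurable (?U n)"
      by (rule measurable_compose[OF measurable_Ud_component[OF one] borel_measurable_indicator[OF sets_bad[OF True]]])
    then show ?thesis unfolding R_def using True by simp
  next
    case False
    then show ?thesis unfolding R_def by simp
  qed
  have sect: "measure (?J n) (E n) = (\<integral>us. g n us \<partial>?U n)"
    "AE \<omega> in ?J n. real_cond_exp (?J n) (Ud_algebra n d) (indicator (E n)) \<omega> = g n (snd \<omega>)" if "ok n" for n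
    using cond_exp_section[OF prob_space_std_gauss prob_space_Ud_law, of "E n" n n d] core[OF that]
    unfolding g_def joint_law_def Ud_algebra_def by auto
  have uncond: "\<alpha> - 99 * e n \<le> measure (?J n) (E n)" if ok: "ok n" for n
  proof -
    interpret U: prob_space "?U n" by (rule prob_space_Ud_law)
    have E: "E n \<in> sets (?G n \<Otimes>\<^sub>M ?U n)" using core[OF ok] by (simp add: joint_law_def)
    interpret G: prob_space "?G n" by (rule prob_space_std_gauss)
    interpret P: pair_sigma_finite "?G n" "?U n" ..
    have gm: "g n \<in> borel_measurable (?U n)" unfolding g_def by (rule P.measurable_measure_section[OF E])
    note B = sets_bad1[OF ok]
    let ?b = "indicator {us \<in> space (?U n). us 1 \<in> bad n} :: _ \<Rightarrow> real"
    have ib: "integrable (?U n) ?b" by (rule integrable_real_indicator[OF B]) (simp add: U.emeasure_eq_measure)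
    \<comment> \<open>99 = 9 + 90: the probability of harmful artificial noise plus the selection
      error otherwise.\<close>
    have "\<alpha> - 99 * e n \<le> \<alpha> - (\<P>(us in ?U n. us 1 \<in> bad n) + 90 * e n)"
      using bad[OF ok] by simp
    also have "\<dots> = (\<integral>us. \<alpha> - (?b us + 90 * e n) \<partial>?U n)"
      using ib B by (simp add: U.prob_space)
    also have "\<dots> \<le> (\<integral>us. g n us \<partial>?U n)"
    proof (rule integral_mono)
      show "integrable (?U n) (\<lambda>us. \<alpha> - (?b us + 90 * e n))" using ib by simp
      show "integrable (?U n) (g n)" using gm by (intro U.integrable_const_bound[of _ 1]) (auto simp: g_def)
      fix us assume us: "us \<in> space (?U n)"
      have "R n us = ?b us + 90 * e n" using us ok by (simp add: R_def indicator_def)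
      then show "\<alpha> - (?b us + 90 * e n) \<le> g n us" using core[OF ok] us by metis
    qed
    finally show ?thesis using sect(1)[OF ok] by simp
  qed
  \<comment> \<open>Halving the rate turns an error of order \<open>e\<close> into a
    little-o.\<close>
  have small: "e \<in> o(\<lambda>n. exp (- (a / 2) * real n))" unfolding e_def using a by (intro exp_neg_smallo) simp
  have "little_op ?U R (\<lambda>n. exp (- (a / 2) * real n))"
    unfolding little_op_def
  proof (intro conjI allI impI Rm)
    fix \<epsilon> :: real assume \<epsilon>: "\<epsilon> > 0"
    have small': "\<forall>\<^sub>F n in sequentially. norm (e n) \<le> \<epsilon> / 90 * norm (exp (- (a / 2) * real n))"
      using landau_o.smallD[OF small, of "\<epsilon> / 90"] \<epsilon> by simp
    \<comment> \<open>The indicator in \<open>R\<close> is not small, only rarely nonzero. The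
      deterministic part 90 e is eventually below the threshold, so \<open>R\<close> can exceed it
      on the bad event only.\<close>
    have ev: "\<forall>\<^sub>F n in sequentially. \<P>(x in ?U n. \<bar>R n x\<bar> > \<epsilon> * \<bar>exp (- (a / 2) * real n)\<bar>) \<le> 9 * e n"
      using ev_ok small'
    proof eventually_elim
      case (elim n)
      interpret U: prob_space "?U n" by (rule prob_space_Ud_law)
      have "90 * e n \<le> \<epsilon> * exp (- (a / 2) * real n)" using elim(2) by (simp add: e_def)
      then have "{x \<in> space (?U n). \<bar>R n x\<bar> > \<epsilon> * \<bar>exp (- (a / 2) * real n)\<bar>} \<subseteq> {us \<in> space (?U n). us 1 \<in> bad n}"
        using elim(1) by (auto simp: R_def indicator_def e_def split: if_splits)
      then have "\<P>(x in ?U n. \<bar>R n x\<bar> > \<epsilon> * \<bar>exp (- (a / 2) * real n)\<bar>)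
          \<le> \<P>(us in ?U n. us 1 \<in> bad n)" by (rule U.finite_measure_mono[OF _ sets_bad1[OF elim(1)]])
      then show ?case using bad[OF elim(1)] by simp
    qed
    have lim: "(\<lambda>n. 9 * e n) \<longlonglongrightarrow> 0" using tendsto_mult_right_zero[OF exp_neg_tendsto_0[OF a], of 9] by (simp add: e_def)
    show "(\<lambda>n. \<P>(x in ?U n. \<bar>R n x\<bar> > \<epsilon> * \<bar>exp (- (a / 2) * real n)\<bar>)) \<longlonglongrightarrow> 0"
      by (rule tendsto_sandwich[OF _ ev tendsto_const lim]) simp
  qed
  moreover have "\<forall>\<^sub>F n in sequentially. AE \<omega> in ?J n.
      real_cond_exp (?J n) (Ud_algebra n d) (indicator (E n)) \<omega> \<ge> \<alpha> - R n (snd \<omega>)"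
    using ev_ok
  proof eventually_elim
    case (elim n)
    show ?case using sect(2)[OF elim] AE_space
    proof eventually_elim
      case (elim \<omega>)
      then have "snd \<omega> \<in> space (?U n)" by (auto simp: joint_law_def space_pair_measure)
      then show ?case using elim(1) core[OF \<open>ok n\<close>] by simp
    qed
  qed
  moreover have "(\<lambda>n. 99 * e n) \<in> o(\<lambda>n. exp (- (a / 2) * real n))" using small by simp
  moreover have "\<forall>\<^sub>F n in sequentially. measure (?J n) (E n) \<ge> \<alpha> - 99 * e n"
    using ev_ok by eventually_elim (rule uncond)
  ultimately show ?thesis
    using a by (intro exI[of _ "a / 2"] conjI bexI[of _ "\<lambda>n. 99 * e n"] exI[of _ R]) simp_all
qed

end
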